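(* Let $X$ be an infinite dimensional complex Banach space and let $T \in L(X)$. The following conditions are equivalent: (i) $T$ is Koliha-Drazin invertible; (ii) $0 \notin \mathrm{int}\, \sigma_{desc}(T)$ and there exists $(M,N) \in Red(T)$ such that $T_M$ is upper semi-Weyl and $T_N$ is quasinilpotent; (iii) $0 \notin \mathrm{int}\, \sigma_{LD}(T)$ and there exists $(M,N) \in Red(T)$ such that $T_M$ is lower semi-Weyl and $T_N$ is quasinilpotent.
   Context: $L(X)$ is the algebra of bounded linear operators on $X$. A subspace $M$ of $X$ is $T$-invariant if $T(M)\subset M$, and then $T_M: M\to M$ is the restriction $T_Mx=Tx$. We write $(M,N)\in Red(T)$ if $M,N$ are closed $T$-invariant subspaces of $X$ with $X=M\oplus N$ (the trivial cases $M=\{0\}$ or $N=\{0\}$ are allowed). $T\in L(X)$ is Koliha-Drazin invertible (generalized Drazin invertible) if $0$ is not an accumulation point of the spectrum $\sigma(T)$. For a bounded operator $S$ on a complex Banach space, $N(S)$ and $R(S)$ are the null space and range, $\alpha(S)=\dim N(S)$, $\beta(S)=\mathrm{codim}\, R(S)$. $S$ is upper semi-Fredholm if $R(S)$ is closed and $\alpha(S)<\infty$; lower semi-Fredholm if $R(S)$ is closed and $\beta(S)<\infty$; in either case $\mathrm{ind}(S)=\alpha(S)-\beta(S)$. $S$ is upper semi-Weyl if it is upper semi-Fredholm with $\mathrm{ind}(S)\le 0$, and lower semi-Weyl if it is lower semi-Fredholm with $\mathrm{ind}(S)\ge 0$. $S$ is quasinilpotent if $\lim_n\|S^n\|^{1/n}=0$.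 The ascent $p(S)$ is the smallest integer $p\ge 0$ with $N(S^p)=N(S^{p+1})$ ($\infty$ if none exists); the descent $q(S)$ is the smallest integer $q\ge 0$ with $R(S^q)=R(S^{q+1})$ ($\infty$ if none exists). $S$ is left Drazin invertible if $p=p(S)<\infty$ and $R(S^{p+1})$ is closed. $\sigma_{desc}(T)=\{\lambda\in\mathbb{C}: q(T-\lambda I)=\infty\}$ and $\sigma_{LD}(T)=\{\lambda\in\mathbb{C}: T-\lambda I \text{ is not left Drazin invertible}\}$. For $F\subset\mathbb{C}$, $\mathrm{int}\,F$ is the interior of $F$ in $\mathbb{C}$. *)

theory Defs
  imports "HOL-Analysis.Analysis"
begin

text \<open>Complex Banach spaces, as real Banach spaces with a compatible complex scaling.\<close>

class complex_normed_vector = real_normed_vector +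
  fixes scaleC :: "complex \<Rightarrow> 'a \<Rightarrow> 'a"  (infixr \<open>*\<^sub>C\<close> 75)
  assumes scaleC_add_right: "c *\<^sub>C (x + y) = c *\<^sub>C x + c *\<^sub>C y"
    and scaleC_add_left: "(c + d) *\<^sub>C x = c *\<^sub>C x + d *\<^sub>C x"
    and scaleC_scaleC: "c *\<^sub>C d *\<^sub>C x = (c * d) *\<^sub>C x"
    and scaleC_of_real: "complex_of_real r *\<^sub>C x = r *\<^sub>R x"
    and norm_scaleC: "norm (c *\<^sub>C x) = cmod c * norm x"

class complex_banach = complex_normed_vector + complete_space

interpretation cvec: vector_space "scaleC :: complex \<Rightarrow> 'a \<Rightarrow> 'a::complex_normed_vector"
proof
  show "1 *\<^sub>C x = x" for x :: 'a
    using scaleC_of_real[of 1 x] by simp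
qed (simp_all add: scaleC_add_right scaleC_add_left scaleC_scaleC)

definition bounded_clinear :: "('a::complex_normed_vector \<Rightarrow> 'a) \<Rightarrow> bool" where
  "bounded_clinear T \<longleftrightarrow>
     Vector_Spaces.linear scaleC scaleC T \<and> (\<exists>K. \<forall>x. norm (T x) \<le> norm x * K)"

text \<open>The library's \<open>dim\<close> is 0 on infinite-dimensional spaces, hence the \<open>enat\<close>-valued version.\<close>

definition edim :: "'a::complex_normed_vector set \<Rightarrow> enat" where
  "edim V = (if \<exists>B. finite B \<and> V \<subseteq> cvec.span B then enat (cvec.dim V) else \<infinity>)"

text \<open>\<open>indep_mod W B\<close>: the cosets \<open>b + W\<close>, for \<open>b\<close> in \<open>B\<close>, are pairwise distinct and linearly
  independent in the quotient by \<open>W\<close>. The dimension of the quotient of \<open>V\<close> by \<open>W\<close> is the supremum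
  of the cardinalities of its finite linearly independent sets.\<close>

definition indep_mod :: "'a::complex_normed_vector set \<Rightarrow> 'a set \<Rightarrow> bool" where
  "indep_mod W B \<longleftrightarrow>
     (\<forall>F c. finite F \<and> F \<subseteq> B \<and> (\<Sum>b\<in>F. c b *\<^sub>C b) \<in> W \<longrightarrow> (\<forall>b\<in>F. c b = 0))"

definition ecodim :: "'a::complex_normed_vector set \<Rightarrow> 'a set \<Rightarrow> enat" where
  "ecodim V W = Sup {enat (card B) | B. finite B \<and> B \<subseteq> V \<and> indep_mod W B}"

lemma indep_mod_0: "indep_mod {0} B \<longleftrightarrow> cvec.independent B"
  unfolding indep_mod_def cvec.independent_explicit_finite_subsets by auto

lemma ecodim_0: "ecodim V {0} = edim V"
proof (cases "\<exists>B. finite B \<and> V \<subseteq> cvec.span B")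
  case True
  then obtain A where A: "finite A" "V \<subseteq> cvec.span A" by blast
  obtain B where B: "B \<subseteq> V" "cvec.independent B" "V \<subseteq> cvec.span B" "card B = cvec.dim V"
    using cvec.basis_exists[of V] by blast
  have "finite B" using cvec.independent_span_bound[OF A(1) B(2)] B(1) A(2) by blast
  moreover have "card C \<le> cvec.dim V" if "C \<subseteq> V" "cvec.independent C" for C
    using cvec.independent_span_bound[OF \<open>finite B\<close> that(2)] that(1) B(3,4) by auto
  ultimately have "ecodim V {0} = enat (cvec.dim V)"
    unfolding ecodim_def indep_mod_0 using B
    by (intro antisym Sup_least Sup_upper) (auto intro!: exI[of _ B])
  then show ?thesis using True by (simp add: edim_def)
next
  case False
  have "\<exists>B. finite B \<and> card B = n \<and> B \<subseteq> V \<and> cvec.independent B" for n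
  proof (induction n)
    case 0
    show ?case by (intro exI[of _ "{}"]) (simp add: cvec.independent_empty)
  next
    case (Suc n)
    then obtain B where B: "finite B" "card B = n" "B \<subseteq> V" "cvec.independent B" by blast
    then obtain x where x: "x \<in> V" "x \<notin> cvec.span B" using False by blast
    then have "x \<notin> B" using cvec.span_base by blast
    with B x show ?case by (intro exI[of _ "insert x B"]) (simp add: cvec.independent_insert)
  qed
  then have "enat n \<in> {enat (card B) | B. finite B \<and> B \<subseteq> V \<and> cvec.independent B}" for n
    by (smt (verit) mem_Collect_eq)
  then have "enat n \<le> ecodim V {0}" for n
    unfolding ecodim_def indep_mod_0 by (rule Sup_upper)
  then have "ecodim V {0} = \<infinity>"
    by (metis enat.exhaust enat_ord_simps(1) not_less_eq_eq order_refl)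
  then show ?thesis using False by (simp add: edim_def)
qed

text \<open>In the following definitions, \<open>M\<close> is a closed \<open>T\<close>-invariant subspace, and the notion
  refers to the restriction of \<open>T\<close> to an operator from \<open>M\<close> to \<open>M\<close>. As \<open>M\<close> is closed, being closed
  in \<open>M\<close> and being closed in the whole space are the same for subsets of \<open>M\<close>.\<close>

definition nullity_on :: "'a::complex_normed_vector set \<Rightarrow> ('a \<Rightarrow> 'a) \<Rightarrow> enat" where
  "nullity_on M T = edim {x \<in> M. T x = 0}"

definition defect_on :: "'a::complex_normed_vector set \<Rightarrow> ('a \<Rightarrow> 'a) \<Rightarrow> enat" where
  "defect_on M T = ecodim M (T ` M)"

definition upper_semi_Fredholm_on :: "'a::complex_normed_vector set \<Rightarrow> ('a \<Rightarrow> 'a) \<Rightarrow> bool" where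
  "upper_semi_Fredholm_on M T \<longleftrightarrow> closed (T ` M) \<and> nullity_on M T < \<infinity>"

definition lower_semi_Fredholm_on :: "'a::complex_normed_vector set \<Rightarrow> ('a \<Rightarrow> 'a) \<Rightarrow> bool" where
  "lower_semi_Fredholm_on M T \<longleftrightarrow> closed (T ` M) \<and> defect_on M T < \<infinity>"

text \<open>Only meaningful if one of the two terms is finite, as \<open>\<infinity> - \<infinity> = \<infinity>\<close> in \<open>ereal\<close>.\<close>

definition index_on :: "'a::complex_normed_vector set \<Rightarrow> ('a \<Rightarrow> 'a) \<Rightarrow> ereal" where
  "index_on M T = ereal_of_enat (nullity_on M T) - ereal_of_enat (defect_on M T)"

definition upper_semi_Weyl_on :: "'a::complex_normed_vector set \<Rightarrow> ('a \<Rightarrow> 'a) \<Rightarrow> bool" where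
  "upper_semi_Weyl_on M T \<longleftrightarrow> upper_semi_Fredholm_on M T \<and> index_on M T \<le> 0"

definition lower_semi_Weyl_on :: "'a::complex_normed_vector set \<Rightarrow> ('a \<Rightarrow> 'a) \<Rightarrow> bool" where
  "lower_semi_Weyl_on M T \<longleftrightarrow> lower_semi_Fredholm_on M T \<and> index_on M T \<ge> 0"

text \<open>The operator norm of the restriction; \<open>onorm_on UNIV\<close> is the library's \<open>onorm\<close>.\<close>

definition onorm_on :: "'a::complex_normed_vector set \<Rightarrow> ('a \<Rightarrow> 'a) \<Rightarrow> real" where
  "onorm_on M T = (SUP x\<in>M. norm (T x) / norm x)"

lemma onorm_on_UNIV: "onorm_on UNIV T = onorm T"
  by (simp add: onorm_on_def onorm_def)

definition quasinilpotent_on :: "'a::complex_normed_vector set \<Rightarrow> ('a \<Rightarrow> 'a) \<Rightarrow> bool" where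
  "quasinilpotent_on M T \<longleftrightarrow> (\<lambda>n. root n (onorm_on M (T ^^ n))) \<longlonglongrightarrow> 0"

definition Red :: "('a::complex_normed_vector \<Rightarrow> 'a) \<Rightarrow> ('a set \<times> 'a set) set" where
  "Red T = {(M, N).
     cvec.subspace M \<and> closed M \<and> T ` M \<subseteq> M \<and>
     cvec.subspace N \<and> closed N \<and> T ` N \<subseteq> N \<and>
     (\<forall>x. \<exists>m\<in>M. \<exists>n\<in>N. x = m + n) \<and> M \<inter> N = {0}}"

definition shift :: "('a::complex_normed_vector \<Rightarrow> 'a) \<Rightarrow> complex \<Rightarrow> 'a \<Rightarrow> 'a" where
  "shift T z = (\<lambda>x. T x - z *\<^sub>C x)"

definition spectrum :: "('a::complex_normed_vector \<Rightarrow> 'a) \<Rightarrow> complex set" where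
  "spectrum T =
     {z. \<not> (\<exists>S. bounded_clinear S \<and> S \<circ> shift T z = id \<and> shift T z \<circ> S = id)}"

definition Koliha_Drazin_invertible :: "('a::complex_normed_vector \<Rightarrow> 'a) \<Rightarrow> bool" where
  "Koliha_Drazin_invertible T \<longleftrightarrow> \<not> 0 islimpt spectrum T"

definition null_space :: "('a::complex_normed_vector \<Rightarrow> 'a) \<Rightarrow> 'a set" where
  "null_space S = {x. S x = 0}"

definition ascent :: "('a::complex_normed_vector \<Rightarrow> 'a) \<Rightarrow> enat" where
  "ascent S =
     (if \<exists>p. null_space (S ^^ p) = null_space (S ^^ (p + 1))
      then enat (LEAST p. null_space (S ^^ p) = null_space (S ^^ (p + 1))) else \<infinity>)"

definition descent :: "('a::complex_normed_vector \<Rightarrow> 'a) \<Rightarrow> enat" where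
  "descent S =
     (if \<exists>q. range (S ^^ q) = range (S ^^ (q + 1))
      then enat (LEAST q. range (S ^^ q) = range (S ^^ (q + 1))) else \<infinity>)"

definition left_Drazin_invertible :: "('a::complex_normed_vector \<Rightarrow> 'a) \<Rightarrow> bool" where
  "left_Drazin_invertible S \<longleftrightarrow> (\<exists>p. ascent S = enat p \<and> closed (range (S ^^ (p + 1))))"

definition spectrum_desc :: "('a::complex_normed_vector \<Rightarrow> 'a) \<Rightarrow> complex set" where
  "spectrum_desc T = {z. descent (shift T z) = \<infinity>}"

definition spectrum_LD :: "('a::complex_normed_vector \<Rightarrow> 'a) \<Rightarrow> complex set" where
  "spectrum_LD T = {z. \<not> left_Drazin_invertible (shift T z)}"

end

theory Submission
  imports Defs
begin

text \<open>
  If \<open>0\<close> is at most an isolated point of the spectrum, the averages of \<open>z (z - T)\<^sup>-\<^sup>1\<close> over the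
  \<open>n\<close> points \<open>z\<close> with \<open>z ^ n = r ^ n\<close> equal \<open>(I - (T / r) ^ n)\<^sup>-\<^sup>1\<close>. As \<open>n\<close> grows they converge, and the
  limit is a projection that does not depend on the small radius \<open>r\<close>, the Riesz projection
  (\<open>riesz_decomposition\<close>). On its range \<open>T ^ n\<close> is eventually bounded by \<open>r ^ n\<close> for each \<open>r\<close>, so \<open>T\<close>
  is quasinilpotent there; on its kernel \<open>T\<close> is bijective, which is more than both semi-Weyl
  conditions ask for. Off the spectrum ascent and descent are \<open>0\<close>.

  Conversely, let \<open>(M, N)\<close> be a decomposition as in the second or third condition. The operator \<open>S\<close>
  that is \<open>T\<close> on \<open>M\<close> and the identity on \<open>N\<close> lives on the whole space. It suffices that \<open>S - z\<close> is
  bijective for all small \<open>z \<noteq> 0\<close>, since \<open>T - z\<close> is bijective on \<open>N\<close> whenever \<open>z \<noteq> 0\<close>. The sign of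
  the index gives a finite-rank \<open>F\<close> such that \<open>B = S + F\<close> is bounded below (upper semi-Weyl) or onto
  (lower semi-Weyl), and then so is \<open>B - z\<close> for small \<open>z\<close>.

  Arbitrarily close to \<open>0\<close> there are points \<open>w\<close> at which \<open>S - w\<close> has finite descent (or is left Drazin
  invertible), and moving \<open>w\<close> slightly makes \<open>S - w\<close> onto (or injective). At such a point one of \<open>S - w\<close>
  and \<open>B - w\<close> is onto, the other one is injective, and they differ by an operator of finite rank. Hence
  both are bijective (\<open>surj_inj_finite_rank_difference_imp_bij\<close>), and \<open>B - z\<close> is bijective for all
  small \<open>z\<close>.

  It remains to pass from these points \<open>w\<close> to a full punctured disc (\<open>punctured_disc_bij\<close>). As a
  finite-rank perturbation of a bijective operator, \<open>S - z\<close> is bijective as soon as it is injective.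
  Its eigenvectors for \<open>z \<noteq> 0\<close> lie in the core \<open>K\<close>, the intersection of the ranges of the powers of
  \<open>S\<close>. The core is closed and \<open>S\<close> maps it onto itself, and for such an operator injectivity of one
  shift near \<open>0\<close> implies injectivity of all shifts near \<open>0\<close>.

  The functional-analytic tools are the open mapping theorem and the existence of bounded linear
  functionals that separate a point from \<open>0\<close>.
\<close>

section \<open>The open mapping theorem and perturbation of surjections\<close>

text \<open>Each approximate preimage at least halves the residual, so the successive corrections form
  an absolutely convergent series.\<close>

lemma approximate_preimages_imp_preimages:
  fixes A :: "'b::banach \<Rightarrow> 'c::real_normed_vector"
  assumes A: "bounded_linear A" and W: "subspace W" "closed W" and V: "subspace V"
    and AW: "A ` W \<subseteq> V" and C: "0 \<le> C"
    and approx: "\<And>y. y \<in> V \<Longrightarrow> \<exists>x\<in>W. norm x \<le> C * norm y \<and> norm (y - A x) \<le> norm y / 2"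
    and y: "y \<in> V"
  shows "\<exists>x\<in>W. A x = y \<and> norm x \<le> 2 * C * norm y"
proof -
  interpret A: bounded_linear A by fact
  \<comment> \<open>\<open>r k\<close> below is the residual after \<open>k\<close> corrections \<open>g (r 0), \<dots>, g (r (k - 1))\<close>.\<close>
  obtain g where g: "\<And>y. y \<in> V \<Longrightarrow> g y \<in> W \<and> norm (g y) \<le> C * norm y \<and> norm (y - A (g y)) \<le> norm y / 2"
    using approx by metis
  define r where "r k = ((\<lambda>y. y - A (g y)) ^^ k) y" for k
  have r_Suc: "r (Suc k) = r k - A (g (r k))" and r_0: "r 0 = y" for k
    by (simp_all add: r_def)
  have r: "r k \<in> V \<and> norm (r k) \<le> norm y * (1/2) ^ k" for k
  proof (induction k)
    case 0 then show ?case using y by (simp add: r_0)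
  next
    case (Suc k)
    then have "g (r k) \<in> W" using g by blast
    then have "r (Suc k) \<in> V"
      unfolding r_Suc using Suc AW V by (blast intro: subspace_diff)
    moreover have "norm (r (Suc k)) \<le> norm (r k) / 2"
      unfolding r_Suc using g Suc by blast
    ultimately show ?case using Suc by simp
  qed
  have bound: "norm (g (r k)) \<le> C * norm y * (1/2) ^ k" for k
    using g[of "r k"] r[of k] C mult_left_mono[of "norm (r k)" "norm y * (1/2)^k" C] by (simp add: mult.assoc)
  have geo: "summable (\<lambda>k. C * norm y * (1/2::real) ^ k)"
    by (intro summable_mult summable_geometric) simp
  have sn: "summable (\<lambda>k. norm (g (r k)))"
    by (rule summable_comparison_test'[OF geo, of 0]) (use bound in simp)
  then have s: "summable (\<lambda>k. g (r k))" by (rule summable_norm_cancel)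
  define x where "x = (\<Sum>k. g (r k))"
  have part: "(\<lambda>n. \<Sum>k<n. g (r k)) \<longlonglongrightarrow> x"
    unfolding x_def using s by (rule summable_LIMSEQ)
  have "(\<Sum>k<n. g (r k)) \<in> W" for n
    using W(1) g r by (intro subspace_sum) auto
  then have xW: "x \<in> W"
    using closed_sequentially[OF W(2) _ part] by blast
  have "norm x \<le> (\<Sum>k. norm (g (r k)))"
    unfolding x_def by (rule summable_norm[OF sn])
  also have "\<dots> \<le> (\<Sum>k. C * norm y * (1/2) ^ k)"
    by (rule suminf_le[OF bound sn geo])
  also have "\<dots> = 2 * C * norm y"
    by (subst suminf_mult) (auto simp: suminf_geometric)
  finally have nx: "norm x \<le> 2 * C * norm y" .
  have "A (\<Sum>k<n. g (r k)) = y - r n" for n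
    by (induction n) (simp_all add: r_0 r_Suc A.add A.zero)
  moreover have "(\<lambda>n. A (\<Sum>k<n. g (r k))) \<longlonglongrightarrow> A x"
    by (rule A.tendsto[OF part])
  moreover have "(\<lambda>n. y - r n) \<longlonglongrightarrow> y - 0"
  proof (intro tendsto_intros)
    have "(\<lambda>n. norm y * (1/2) ^ n) \<longlonglongrightarrow> norm y * 0"
      by (intro tendsto_intros LIMSEQ_power_zero) simp
    then have "(\<lambda>n. norm y * (1/2) ^ n) \<longlonglongrightarrow> 0" by simp
    then show "r \<longlonglongrightarrow> 0"
      by (rule Lim_null_comparison[rotated]) (use r in simp)
  qed
  ultimately have "A x = y" using LIMSEQ_unique by force
  with xW nx show ?thesis by blast
qed

text \<open>Baire's theorem yields a point of \<open>V\<close> near which images of a fixed ball are dense; differences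
  of such images approximate all small vectors of \<open>V\<close>, and the preceding iteration makes the
  approximation exact. Allowing subspaces \<open>W\<close> and \<open>V\<close> covers restrictions, operators with closed
  range, and the addition map of a direct sum.\<close>

lemma open_mapping:
  fixes A :: "'b::banach \<Rightarrow> 'c::banach"
  assumes A: "bounded_linear A" and W: "subspace W" "closed W" and V: "subspace V" "closed V"
    and AW: "A ` W = V"
  shows "\<exists>C>0. \<forall>y\<in>V. \<exists>x\<in>W. A x = y \<and> norm x \<le> C * norm y"
proof -
  interpret A: bounded_linear A by fact
  let ?V = "subtopology euclidean V"
  define D where "D n = closure (A ` (W \<inter> cball 0 (real n)))" for n
  have DV: "D n \<subseteq> V" for n
    unfolding D_def using AW V(2) by (intro closure_minimal) auto
  have VD: "V = (\<Union>n. D n)"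
  proof
    show "V \<subseteq> (\<Union>n. D n)"
    proof
      fix y assume "y \<in> V"
      then obtain x where x: "x \<in> W" "y = A x" using AW by blast
      obtain n where "norm x \<le> real n" using real_arch_simple by blast
      then have "y \<in> A ` (W \<inter> cball 0 (real n))" using x by auto
      then have "y \<in> D n" unfolding D_def by (rule subsetD[OF closure_subset])
      then show "y \<in> (\<Union>n. D n)" by blast
    qed
  qed (use DV in blast)
  have cm: "completely_metrizable_space ?V"
    by (intro completely_metrizable_space_closedin completely_metrizable_space_euclidean)
      (use V(2) in simp)
  have "\<exists>n. ?V interior_of (D n) \<noteq> {}"
  proof (rule ccontr)
    assume *: "\<not> ?thesis"
    have "?V interior_of \<Union>(range D) = {}"
    proof (rule Baire_category_alt)
      fix S assume "S \<in> range D"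
      then obtain n where n: "S = D n" by blast
      have "closedin ?V (D n)"
        using DV by (auto simp: closedin_closed D_def)
      then show "closedin ?V S \<and> ?V interior_of S = {}" using * n by blast
    qed (use cm in auto)
    moreover have "?V interior_of V = V"
      by (simp add: interior_of_openin)
    ultimately show False using VD subspace_0[OF V(1)] by auto
  qed
  then obtain n y0 where "y0 \<in> ?V interior_of (D n)" by blast
  then obtain T where T: "open T" "y0 \<in> T" "y0 \<in> V" "T \<inter> V \<subseteq> D n"
    by (auto simp: interior_of_def openin_open)
  then obtain e where e: "e > 0" "ball y0 e \<subseteq> T" using open_contains_ball by blast
  have small: "\<exists>x\<in>W. norm x \<le> 2 * real n \<and> norm (y - A x) < e / 4" if y: "y \<in> V" "norm y < e" for y
  proof -
    have "y0 \<in> D n" "y0 + y \<in> D n"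
      using T e y subspace_add[OF V(1)] by (auto simp: dist_norm subset_iff)
    moreover have "\<exists>x\<in>W. norm x \<le> n \<and> norm (A x - z) < e / 8" if "z \<in> D n" for z
    proof -
      have "\<exists>w\<in>A ` (W \<inter> cball 0 (real n)). dist w z < e / 8"
        using that e(1) unfolding D_def closure_approachable by (meson divide_pos_pos zero_less_numeral)
      then show ?thesis by (auto simp: dist_norm)
    qed
    ultimately obtain x1 x2 where
      x: "x1 \<in> W" "norm x1 \<le> n" "norm (A x1 - (y0 + y)) < e / 8"
        "x2 \<in> W" "norm x2 \<le> n" "norm (A x2 - y0) < e / 8" by blast
    \<comment> \<open>The centre \<open>y0\<close> of the ball cancels.\<close>
    have "norm (y - A (x1 - x2)) = norm ((A x2 - y0) - (A x1 - (y0 + y)))"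
      by (simp add: A.diff algebra_simps)
    also have "\<dots> < e / 4" using x norm_triangle_ineq4[of "A x2 - y0" "A x1 - (y0 + y)"] by linarith
    finally have "norm (y - A (x1 - x2)) < e / 4" .
    moreover have "norm (x1 - x2) \<le> 2 * real n" using x norm_triangle_ineq4[of x1 x2] by linarith
    ultimately show ?thesis using x subspace_diff[OF W(1)] by blast
  qed
  define C where "C = 4 * real n / e"
  have C: "C \<ge> 0" using \<open>e > 0\<close> by (simp add: C_def)
  have approx: "\<exists>x\<in>W. norm x \<le> C * norm y \<and> norm (y - A x) \<le> norm y / 2" if y: "y \<in> V" for y
  proof (cases "y = 0")
    case True
    then show ?thesis using subspace_0[OF W(1)] by (intro bexI[of _ 0]) (auto simp: A.zero)
  next
    case False
    define t where "t = (e / 2) / norm y"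
    have t: "t > 0" using False e by (simp add: t_def)
    have "norm (t *\<^sub>R y) = e / 2" using False e(1) by (simp add: t_def)
    then obtain x where x: "x \<in> W" "norm x \<le> 2 * real n" "norm (t *\<^sub>R y - A x) < e / 4"
      using small[of "t *\<^sub>R y"] y subspace_scale[OF V(1)] e(1) by auto
    have "norm (y - A ((1/t) *\<^sub>R x)) = norm ((1/t) *\<^sub>R (t *\<^sub>R y - A x))"
      using t by (simp add: A.scaleR algebra_simps)
    also have "\<dots> = (1/t) * norm (t *\<^sub>R y - A x)" using t by simp
    also have "\<dots> \<le> (1/t) * (e/4)" using x t by (intro mult_left_mono) auto
    also have "\<dots> = norm y / 2" using e(1) False by (simp add: t_def field_simps)
    finally have "norm (y - A ((1/t) *\<^sub>R x)) \<le> norm y / 2" .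
    moreover have "norm ((1/t) *\<^sub>R x) \<le> (1/t) * (2 * real n)" using x t by (simp add: divide_right_mono)
    then have "norm ((1/t) *\<^sub>R x) \<le> C * norm y" using e(1) False by (simp add: t_def C_def field_simps)
    ultimately show ?thesis using x(1) subspace_scale[OF W(1)] by blast
  qed
  have "\<forall>y\<in>V. \<exists>x\<in>W. A x = y \<and> norm x \<le> (2 * C + 1) * norm y"
  proof
    fix y assume "y \<in> V"
    then obtain x where x: "x \<in> W" "A x = y" "norm x \<le> 2 * C * norm y"
      using approximate_preimages_imp_preimages[OF A W V(1) _ C approx] AW by blast
    then have "norm x \<le> (2 * C + 1) * norm y"
      using norm_ge_zero[of y] by (auto simp: distrib_right intro: add_increasing2)
    with x show "\<exists>x\<in>W. A x = y \<and> norm x \<le> (2 * C + 1) * norm y" by blast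
  qed
  then show ?thesis using C by (intro exI[of _ "2 * C + 1"]) auto
qed

text \<open>A preimage under \<open>A\<close> is an approximate preimage under \<open>A + E\<close>. For \<open>A\<close> a multiple of the
  identity this is the Neumann series on a closed subspace.\<close>

lemma surjective_perturbation:
  fixes A E :: "'b::banach \<Rightarrow> 'c::real_normed_vector"
  assumes A: "bounded_linear A" and E: "bounded_linear E"
    and W: "subspace W" "closed W" and V: "subspace V"
    and AW: "A ` W \<subseteq> V" and EW: "E ` W \<subseteq> V" and C: "0 \<le> C"
    and onto: "\<And>y. y \<in> V \<Longrightarrow> \<exists>x\<in>W. A x = y \<and> norm x \<le> C * norm y"
    and small: "\<And>x. x \<in> W \<Longrightarrow> norm (E x) \<le> \<epsilon> * norm x" and e: "0 \<le> \<epsilon>" "C * \<epsilon> \<le> 1 / 2"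
    and y: "y \<in> V"
  shows "\<exists>x\<in>W. A x + E x = y \<and> norm x \<le> 2 * C * norm y"
proof (rule approximate_preimages_imp_preimages[OF bounded_linear_add[OF A E] W V _ C _ y])
  show "(\<lambda>x. A x + E x) ` W \<subseteq> V" using AW EW subspace_add[OF V] by blast
  fix y assume "y \<in> V"
  then obtain x where x: "x \<in> W" "A x = y" "norm x \<le> C * norm y" using onto by blast
  have "norm (E x) \<le> \<epsilon> * (C * norm y)"
    using small[OF x(1)] x(3) e(1) mult_left_mono order_trans by blast
  also have "\<dots> \<le> norm y / 2" using mult_right_mono[OF e(2) norm_ge_zero[of y]] by (simp add: ac_simps)
  finally show "\<exists>x\<in>W. norm x \<le> C * norm y \<and> norm (y - (A x + E x)) \<le> norm y / 2"
    using x by (intro bexI[of _ x]) auto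
qed

section \<open>Bounded complex-linear operators\<close>

instance complex_banach \<subseteq> banach by standard

interpretation cpair: vector_space_pair
  "scaleC :: complex \<Rightarrow> 'a \<Rightarrow> 'a::complex_normed_vector"
  "scaleC :: complex \<Rightarrow> 'b \<Rightarrow> 'b::complex_normed_vector"
  by unfold_locales

lemma bounded_clinearI:
  assumes "\<And>x y. f (x + y) = f x + f y" and "\<And>c x. f (c *\<^sub>C x) = c *\<^sub>C f x"
    and "\<And>x. norm (f x) \<le> K * norm x"
  shows "bounded_clinear f"
  unfolding bounded_clinear_def
  using assms by (auto simp: Vector_Spaces.linear_iff cvec.vector_space_axioms mult.commute)

context
  fixes T :: "'a::complex_normed_vector \<Rightarrow> 'a"
  assumes T: "bounded_clinear T"
begin

lemma clinear_linear: "Vector_Spaces.linear scaleC scaleC T"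
  using T by (simp add: bounded_clinear_def)

lemma clinear_add: "T (x + y) = T x + T y"
  and clinear_scale: "T (c *\<^sub>C x) = c *\<^sub>C T x"
  and clinear_diff: "T (x - y) = T x - T y"
  and clinear_minus: "T (- x) = - T x"
  and clinear_0: "T 0 = 0"
  and clinear_sum: "T (\<Sum>i\<in>I. h i) = (\<Sum>i\<in>I. T (h i))"
  using clinear_linear
  by (simp_all add: cpair.linear_add cpair.linear_scale cpair.linear_diff cpair.linear_neg
      cpair.linear_0 cpair.linear_sum)

lemma clinear_bounded: "\<exists>K>0. \<forall>x. norm (T x) \<le> K * norm x"
proof -
  obtain K where K: "\<And>x. norm (T x) \<le> norm x * K" using T by (auto simp: bounded_clinear_def)
  have "norm (T x) \<le> (\<bar>K\<bar> + 1) * norm x" for x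
  proof -
    have "norm x * K \<le> norm x * (\<bar>K\<bar> + 1)" by (intro mult_left_mono) auto
    then show ?thesis using K[of x] by (simp add: mult.commute)
  qed
  then show ?thesis by (intro exI[of _ "\<bar>K\<bar> + 1"]) auto
qed

lemma clinear_imp_bounded_linear: "bounded_linear T"
proof -
  obtain K where "\<And>x. norm (T x) \<le> K * norm x" using clinear_bounded by blast
  then show ?thesis
    by (intro bounded_linear_intro[of _ K])
       (simp_all add: clinear_add mult.commute flip: scaleC_of_real clinear_scale)
qed

end

lemma csubspace_imp_subspace: "cvec.subspace V \<Longrightarrow> subspace V"
  unfolding cvec.subspace_def subspace_def by (metis scaleC_of_real)

lemma clinear_id [simp]: "bounded_clinear (\<lambda>x. x)" "bounded_clinear id"
  by (rule bounded_clinearI[of _ 1]; simp)+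

lemma clinear_compose:
  assumes "bounded_clinear S" "bounded_clinear T"
  shows "bounded_clinear (\<lambda>x. S (T x))"
proof -
  obtain K L where "K > 0" "\<And>x. norm (S x) \<le> K * norm x" "\<And>x. norm (T x) \<le> L * norm x"
    using assms clinear_bounded by meson
  then have "norm (S (T x)) \<le> (K * L) * norm x" for x
    by (smt (verit, best) mult.assoc mult_left_mono)
  then show ?thesis
    by (intro bounded_clinearI[of _ "K * L"])
       (auto simp: clinear_add[OF assms(1)] clinear_add[OF assms(2)]
         clinear_scale[OF assms(1)] clinear_scale[OF assms(2)])
qed

lemma clinear_plus:
  assumes "bounded_clinear S" "bounded_clinear T"
  shows "bounded_clinear (\<lambda>x. S x + T x)"
proof -
  obtain K L where "\<And>x. norm (S x) \<le> K * norm x" "\<And>x. norm (T x) \<le> L * norm x"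
    using assms clinear_bounded by meson
  then have "norm (S x + T x) \<le> (K + L) * norm x" for x
    by (smt (verit, best) distrib_right norm_triangle_ineq)
  then show ?thesis
    by (intro bounded_clinearI[of _ "K + L"])
       (auto simp: clinear_add[OF assms(1)] clinear_add[OF assms(2)]
         clinear_scale[OF assms(1)] clinear_scale[OF assms(2)] scaleC_add_right)
qed

lemma clinear_scaleC: "bounded_clinear T \<Longrightarrow> bounded_clinear (\<lambda>x. c *\<^sub>C T x)"
proof -
  assume T: "bounded_clinear T"
  obtain K where "\<And>x. norm (T x) \<le> K * norm x"
    using T clinear_bounded by meson
  then have "norm (c *\<^sub>C T x) \<le> (cmod c * K) * norm x" for x
    by (metis mult.assoc mult_left_mono norm_ge_zero norm_scaleC)
  then show ?thesis
    by (intro bounded_clinearI[of _ "cmod c * K"])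
       (auto simp: clinear_add[OF T] clinear_scale[OF T] scaleC_add_right
         cvec.scale_left_commute)
qed

lemma clinear_minus_op:
  assumes "bounded_clinear S" "bounded_clinear T"
  shows "bounded_clinear (\<lambda>x. S x - T x)"
proof -
  have "(\<lambda>x. S x - T x) = (\<lambda>x. S x + (- 1) *\<^sub>C T x)"
    by (simp add: fun_eq_iff)
  then show ?thesis
    using clinear_plus[OF assms(1) clinear_scaleC[OF assms(2), of "- 1"]] by simp
qed

lemma clinear_zero [simp]: "bounded_clinear (\<lambda>x. 0)"
  by (rule bounded_clinearI[of _ 0]) auto

lemma clinear_sum_op:
  assumes "\<And>i. i \<in> I \<Longrightarrow> bounded_clinear (f i)"
  shows "bounded_clinear (\<lambda>x. \<Sum>i\<in>I. f i x)"
  using assms by (induction I rule: infinite_finite_induct) (auto intro: clinear_plus)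

lemma clinear_power: "bounded_clinear T \<Longrightarrow> bounded_clinear (T ^^ n)"
  by (induction n) (auto simp: comp_def intro: clinear_compose)

lemma clinear_shift: "bounded_clinear T \<Longrightarrow> bounded_clinear (shift T z)"
  unfolding shift_def by (intro clinear_minus_op clinear_scaleC clinear_id)

section \<open>Bounded functionals\<close>

definition bounded_functional :: "('a::complex_normed_vector \<Rightarrow> complex) \<Rightarrow> bool" where
  "bounded_functional f \<longleftrightarrow> (\<forall>x y. f (x + y) = f x + f y) \<and> (\<forall>c x. f (c *\<^sub>C x) = c * f x) \<and>
     (\<exists>K\<ge>0. \<forall>x. norm (f x) \<le> K * norm x)"

text \<open>The real Hahn-Banach theorem, phrased with the kernel \<open>H\<close> of the functional instead of the
  functional: the inequality says that the coordinate along \<open>e\<close> is bounded. If a maximal \<open>H\<close> with this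
  inequality together with \<open>e\<close> missed a vector \<open>x\<close>, some \<open>x - t e\<close> could be added to \<open>H\<close>; the values of
  \<open>t\<close> that are admissible form a nonempty interval.\<close>

lemma maximal_subspace_off_line:
  fixes e :: "'a::real_normed_vector"
  assumes "e \<noteq> 0"
  obtains H where "subspace H" "\<And>h r. h \<in> H \<Longrightarrow> \<bar>r\<bar> * norm e \<le> norm (r *\<^sub>R e + h)"
    "\<And>x. \<exists>r. \<exists>h\<in>H. x = r *\<^sub>R e + h"
proof -
  let ?A = "{H. subspace H \<and> (\<forall>h\<in>H. \<forall>r. \<bar>r\<bar> * norm e \<le> norm (r *\<^sub>R e + h))}"
  have "\<exists>H\<in>?A. \<forall>X\<in>?A. H \<subseteq> X \<longrightarrow> X = H"
  proof (rule subset_Zorn_nonempty)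
    have "{0} \<in> ?A" by (auto simp: subspace_0)
    then show "?A \<noteq> {}" by blast
  next
    fix C assume C: "C \<noteq> {}" "subset.chain ?A C"
    then have sub: "\<And>H. H \<in> C \<Longrightarrow> H \<in> ?A" by (auto simp: subset.chain_def)
    have "subspace (\<Union>C)"
    proof (rule subspaceI)
      show "0 \<in> \<Union>C" using C sub subspace_0 by fastforce
      fix x y assume "x \<in> \<Union>C" "y \<in> \<Union>C"
      then obtain H K where HK: "H \<in> C" "K \<in> C" "x \<in> H" "y \<in> K" by blast
      then have "H \<subseteq> K \<or> K \<subseteq> H" using C(2) by (auto simp: subset_chain_def)
      then show "x + y \<in> \<Union>C"
      proof
        assume "H \<subseteq> K"
        then have "x + y \<in> K" using HK sub[of K] by (auto intro: subspace_add)
        then show ?thesis using HK by blast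
      next
        assume "K \<subseteq> H"
        then have "x + y \<in> H" using HK sub[of H] by (auto intro: subspace_add)
        then show ?thesis using HK by blast
      qed
    next
      fix c x assume "x \<in> \<Union>C"
      then obtain H where H: "H \<in> C" "x \<in> H" by (rule UnionE)
      have "subspace H" using sub[OF H(1)] by simp
      then have "c *\<^sub>R x \<in> H" using H(2) by (rule subspace_scale)
      then show "c *\<^sub>R x \<in> \<Union>C" using H(1) by (rule UnionI[rotated])
    qed
    moreover have "\<bar>r\<bar> * norm e \<le> norm (r *\<^sub>R e + h)" if h: "h \<in> \<Union>C" for h r
    proof -
      obtain H where H: "H \<in> C" "h \<in> H" using h by (rule UnionE)
      show ?thesis using sub[OF H(1)] H(2) by simp
    qed
    ultimately show "\<Union>C \<in> ?A" by simp
  qed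
  then obtain H where HA: "H \<in> ?A" and max': "\<forall>X\<in>?A. H \<subseteq> X \<longrightarrow> X = H" by (rule bexE)
  from HA have H: "subspace H" "\<And>h r. h \<in> H \<Longrightarrow> \<bar>r\<bar> * norm e \<le> norm (r *\<^sub>R e + h)"
    by simp_all
  have max: "\<And>X. X \<in> ?A \<Longrightarrow> H \<subseteq> X \<Longrightarrow> X = H" using max' by simp
  have "\<exists>r. \<exists>h\<in>H. x = r *\<^sub>R e + h" for x
  proof (rule ccontr)
    assume no: "\<not> ?thesis"
    \<comment> \<open>Every element of \<open>L\<close> is a lower bound that \<open>t\<close> has to respect; \<open>ub\<close> says that these lower
      bounds lie below all upper bounds for \<open>t\<close>.\<close>
    define L where "L = {- (norm (x + h + r *\<^sub>R e) / norm e) - r | h r. h \<in> H}"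
    have ub: "l \<le> norm (x + h + r *\<^sub>R e) / norm e - r" if lL: "l \<in> L" and hH: "h \<in> H" for l h r
    proof -
      obtain h' r' where l: "l = - (norm (x + h' + r' *\<^sub>R e) / norm e) - r'" "h' \<in> H"
        using lL by (auto simp: L_def)
      have "\<bar>r - r'\<bar> * norm e \<le> norm ((r - r') *\<^sub>R e + (h - h'))"
        using H(2) subspace_diff[OF H(1)] hH l(2) by blast
      also have "\<dots> = norm ((x + h + r *\<^sub>R e) - (x + h' + r' *\<^sub>R e))"
        by (simp add: algebra_simps)
      also have "\<dots> \<le> norm (x + h + r *\<^sub>R e) + norm (x + h' + r' *\<^sub>R e)"
        by (rule norm_triangle_ineq4)
      finally have "(r - r') * norm e \<le> norm (x + h + r *\<^sub>R e) + norm (x + h' + r' *\<^sub>R e)"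
        using assms by (smt (verit, best) mult_right_mono norm_ge_zero)
      then have "r - r' \<le> (norm (x + h + r *\<^sub>R e) + norm (x + h' + r' *\<^sub>R e)) / norm e"
        using assms by (simp add: pos_le_divide_eq)
      then show ?thesis by (simp add: l add_divide_distrib)
    qed
    have H0: "0 \<in> H" using subspace_0[OF H(1)] .
    have L0: "L \<noteq> {}" using H0 by (auto simp: L_def)
    define t where "t = Sup L"
    have tu: "t \<le> norm (x + h + r *\<^sub>R e) / norm e - r" if "h \<in> H" for h r
      unfolding t_def by (rule cSup_least[OF L0]) (rule ub[OF _ that])
    have bdd: "bdd_above L" using ub H0 by (meson bdd_above.I)
    have tl: "- (norm (x + h + r *\<^sub>R e) / norm e) - r \<le> t" if "h \<in> H" for h r
      unfolding t_def by (rule cSup_upper[OF _ bdd]) (use that in \<open>auto simp: L_def\<close>)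
    have t: "\<bar>r + t\<bar> * norm e \<le> norm (x + h + r *\<^sub>R e)" if "h \<in> H" for h r
    proof -
      have "\<bar>r + t\<bar> \<le> norm (x + h + r *\<^sub>R e) / norm e" using tu[OF that, of r] tl[OF that, of r] by linarith
      then show ?thesis using assms by (simp add: pos_le_divide_eq)
    qed
    define X where "X = (\<lambda>(h, s). h + s *\<^sub>R (x - t *\<^sub>R e)) ` (H \<times> UNIV)"
    have X: "y \<in> X \<longleftrightarrow> (\<exists>h\<in>H. \<exists>s. y = h + s *\<^sub>R (x - t *\<^sub>R e))" for y
      by (auto simp: X_def)
    have "subspace X"
    proof (rule subspaceI)
      show "0 \<in> X" using H0 by (auto simp: X intro!: bexI[of _ 0] exI[of _ 0])
      fix y z assume "y \<in> X" "z \<in> X"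
      then obtain h s h' s' where hs: "h \<in> H" "h' \<in> H"
        "y = h + s *\<^sub>R (x - t *\<^sub>R e)" "z = h' + s' *\<^sub>R (x - t *\<^sub>R e)"
        unfolding X by blast
      have "y + z = (h + h') + (s + s') *\<^sub>R (x - t *\<^sub>R e)"
        unfolding hs by (simp only: scaleR_add_left ac_simps)
      then show "y + z \<in> X" unfolding X using subspace_add[OF H(1) hs(1,2)] by blast
    next
      fix c y assume "y \<in> X"
      then obtain h s where hs: "h \<in> H" "y = h + s *\<^sub>R (x - t *\<^sub>R e)" unfolding X by blast
      have "c *\<^sub>R y = c *\<^sub>R h + (c * s) *\<^sub>R (x - t *\<^sub>R e)"
        unfolding hs by (simp only: scaleR_add_right scaleR_scaleR)
      then show "c *\<^sub>R y \<in> X" unfolding X using subspace_scale[OF H(1) hs(1)] by blast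
    qed
    moreover have "\<bar>r\<bar> * norm e \<le> norm (r *\<^sub>R e + y)" if y: "y \<in> X" for y r
    proof -
      obtain h s where hs: "h \<in> H" "y = h + s *\<^sub>R (x - t *\<^sub>R e)" using y by (auto simp: X)
      show ?thesis
      proof (cases "s = 0")
        case True
        then show ?thesis using H hs by simp
      next
        case False
        have "\<bar>r / s - t + t\<bar> * norm e \<le> norm (x + (1/s) *\<^sub>R h + (r / s - t) *\<^sub>R e)"
          by (rule t) (use hs subspace_scale[OF H(1)] in blast)
        then have "\<bar>s\<bar> * (\<bar>r / s\<bar> * norm e) \<le> \<bar>s\<bar> * norm (x + (1/s) *\<^sub>R h + (r / s - t) *\<^sub>R e)"
          by (intro mult_left_mono) auto
        also have "\<dots> = norm (s *\<^sub>R (x + (1/s) *\<^sub>R h + (r / s - t) *\<^sub>R e))" by simp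
        also have "s *\<^sub>R (x + (1/s) *\<^sub>R h + (r / s - t) *\<^sub>R e) = r *\<^sub>R e + y"
          using False by (simp add: hs algebra_simps)
        finally show ?thesis using False by simp
      qed
    qed
    ultimately have "X \<in> ?A" by simp
    moreover have "H \<subseteq> X" unfolding X subset_iff by (force intro: exI[of _ 0])
    ultimately have "X = H" by (rule max)
    moreover have "x - t *\<^sub>R e \<in> X" using H0 by (auto simp: X intro!: bexI[of _ 0] exI[of _ 1])
    ultimately have "\<exists>h\<in>H. x = t *\<^sub>R e + h"
      by (metis add.commute diff_add_cancel)
    then show False using no by blast
  qed
  with H show ?thesis using that by blast
qed

text \<open>If \<open>f\<close> is the real-linear coordinate along \<open>e\<close>, then \<open>x \<mapsto> f x - \<i> f (\<i> x)\<close> is complex-linear and has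
  real part \<open>1\<close> at \<open>e\<close>.\<close>

lemma exists_bounded_functional:
  fixes e :: "'a::complex_normed_vector"
  assumes "e \<noteq> 0"
  obtains \<phi> where "bounded_functional \<phi>" "\<phi> e = 1"
proof -
  obtain H where H: "subspace H" "\<And>h r. h \<in> H \<Longrightarrow> \<bar>r\<bar> * norm e \<le> norm (r *\<^sub>R e + h)"
    and "\<And>x. \<exists>r. \<exists>h\<in>H. x = r *\<^sub>R e + h"
    using maximal_subspace_off_line[OF assms] by metis
  then obtain f where f: "\<And>x. x - f x *\<^sub>R e \<in> H"
    by (metis add_diff_cancel_left')
  have ne: "norm e > 0" using assms by simp
  have uniq: "f x = r" if "x - r *\<^sub>R e \<in> H" for x r
  proof -
    have "(f x - r) *\<^sub>R e = - ((x - f x *\<^sub>R e) - (x - r *\<^sub>R e))" by (simp add: algebra_simps)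
    have "\<bar>f x - r\<bar> * norm e \<le> norm ((f x - r) *\<^sub>R e + ((x - f x *\<^sub>R e) - (x - r *\<^sub>R e)))"
      using H(2) subspace_diff[OF H(1) f that] by blast
    also have "\<dots> = 0" by (simp add: algebra_simps)
    finally show ?thesis using ne by (simp add: mult_le_0_iff)
  qed
  have add: "f (x + y) = f x + f y" for x y
    by (rule uniq) (use subspace_add[OF H(1) f[of x] f[of y]] in \<open>simp add: algebra_simps\<close>)
  have scale: "f (c *\<^sub>R x) = c * f x" for c x
    by (rule uniq) (use subspace_scale[OF H(1) f[of x], of c] in \<open>simp add: algebra_simps\<close>)
  have "f e = 1" by (rule uniq) (simp add: subspace_0[OF H(1)])
  have bound: "\<bar>f x\<bar> \<le> norm x / norm e" for x
    using H(2)[OF f[of x], of "f x"] ne by (simp add: pos_le_divide_eq)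
  define \<psi> where "\<psi> x = Complex (f x) (- f (\<i> *\<^sub>C x))" for x
  have \<psi>_add: "\<psi> (x + y) = \<psi> x + \<psi> y" for x y
    by (simp add: \<psi>_def complex_eq_iff add scaleC_add_right)
  have comm: "\<i> *\<^sub>C r *\<^sub>R x = r *\<^sub>R \<i> *\<^sub>C x" for r and x :: 'a
    by (metis scaleC_of_real cvec.scale_left_commute)
  have \<psi>_R: "\<psi> (complex_of_real r *\<^sub>C x) = r * \<psi> x" for r x
    by (simp add: \<psi>_def complex_eq_iff scaleC_of_real scale comm)
  have neg: "f (- x) = - f x" for x using scale[of "-1" x] by simp
  have \<psi>_i: "\<psi> (\<i> *\<^sub>C x) = \<i> * \<psi> x" for x
    by (simp add: \<psi>_def complex_eq_iff neg)
  have \<psi>_scale: "\<psi> (c *\<^sub>C x) = c * \<psi> x" for c x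
  proof -
    have "c *\<^sub>C x = complex_of_real (Re c) *\<^sub>C x + complex_of_real (Im c) *\<^sub>C \<i> *\<^sub>C x"
      using complex_eq[of c] by (metis mult.commute scaleC_add_left scaleC_scaleC)
    then have "\<psi> (c *\<^sub>C x) = Re c * \<psi> x + Im c * (\<i> * \<psi> x)"
      by (simp only: \<psi>_add \<psi>_R \<psi>_i)
    also have "\<dots> = c * \<psi> x" by (simp add: complex_eq_iff)
    finally show ?thesis .
  qed
  have \<psi>_bound: "norm (\<psi> x) \<le> (2 / norm e) * norm x" for x
    using cmod_le[of "\<psi> x"] bound[of x] bound[of "\<i> *\<^sub>C x"] by (simp add: \<psi>_def norm_scaleC)
  have "Re (\<psi> e) = 1" using \<open>f e = 1\<close> by (simp add: \<psi>_def)
  then have \<psi>e: "\<psi> e \<noteq> 0" by auto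
  show ?thesis
  proof
    show "bounded_functional (\<lambda>x. \<psi> x / \<psi> e)"
      unfolding bounded_functional_def
    proof (intro conjI allI exI[of _ "2 / norm e / norm (\<psi> e)"])
      fix x show "norm (\<psi> x / \<psi> e) \<le> 2 / norm e / norm (\<psi> e) * norm x"
        using divide_right_mono[OF \<psi>_bound[of x], of "norm (\<psi> e)"] by (simp add: norm_divide)
    qed (simp_all add: \<psi>_add \<psi>_scale add_divide_distrib)
  qed (use \<psi>e in simp)
qed

context
  fixes f :: "'a::complex_normed_vector \<Rightarrow> complex"
  assumes f: "bounded_functional f"
begin

lemma functional_add: "f (x + y) = f x + f y"
  and functional_scale: "f (c *\<^sub>C x) = c * f x"
  using f by (auto simp: bounded_functional_def)

lemma functional_0: "f 0 = 0"
  using functional_add[of 0 0] by simp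

lemma functional_minus: "f (- x) = - f x"
  using functional_scale[of "-1" x] by simp

lemma functional_diff: "f (x - y) = f x - f y"
  using functional_add[of x "- y"] by (simp add: functional_minus)

lemma functional_sum: "f (\<Sum>i\<in>I. h i) = (\<Sum>i\<in>I. f (h i))"
  by (induction I rule: infinite_finite_induct) (auto simp: functional_0 functional_add)

lemma clinear_rank_one: "bounded_clinear (\<lambda>x. f x *\<^sub>C b)"
proof -
  obtain K where "\<And>x. norm (f x) \<le> K * norm x" using f by (auto simp: bounded_functional_def)
  then have "norm (f x *\<^sub>C b) \<le> (K * norm b) * norm x" for x
    using mult_right_mono[OF _ norm_ge_zero[of b]] by (fastforce simp: norm_scaleC ac_simps)
  then show ?thesis
    by (intro bounded_clinearI[of _ "K * norm b"])
      (auto simp: functional_add functional_scale scaleC_add_left scaleC_scaleC)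
qed

lemma closed_kernel_bounded_functional: "closed {x. f x = 0}"
proof -
  obtain K where K: "\<And>x. norm (f x) \<le> K * norm x" using f by (auto simp: bounded_functional_def)
  have "bounded_linear f"
    by (rule bounded_linear_intro[of _ K])
      (use K in \<open>auto simp: functional_add functional_scale mult.commute scaleR_conv_of_real
        simp flip: scaleC_of_real\<close>)
  then have "closed (f -` {0})"
    by (intro closed_vimage) (auto intro: linear_continuous_on)
  then show ?thesis by (simp add: vimage_def)
qed

end

lemma functional_compose:
  assumes "bounded_functional \<kappa>" "bounded_clinear R"
  shows "bounded_functional (\<lambda>x. \<kappa> (R x))"
proof -
  obtain K where K: "K \<ge> 0" "\<And>x. norm (\<kappa> x) \<le> K * norm x"
    using assms(1) by (auto simp: bounded_functional_def)
  obtain L where L: "L > 0" "\<And>x. norm (R x) \<le> L * norm x"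
    using clinear_bounded[OF assms(2)] by blast
  have "norm (\<kappa> (R x)) \<le> (K * L) * norm x" for x
    using K(2)[of "R x"] mult_left_mono[OF L(2)[of x] K(1)] by (simp add: mult.assoc)
  moreover have "K * L \<ge> 0" using K(1) L(1) by simp
  ultimately have "\<exists>K\<ge>0. \<forall>x. cmod (\<kappa> (R x)) \<le> K * norm x" by blast
  then show ?thesis
    by (simp add: bounded_functional_def clinear_add[OF assms(2)] clinear_scale[OF assms(2)]
        functional_add[OF assms(1)] functional_scale[OF assms(1)])
qed

lemma functional_diff_scaled:
  assumes "bounded_functional f" "bounded_functional g"
  shows "bounded_functional (\<lambda>x. f x - c * g x)"
proof -
  obtain K where K: "K \<ge> 0" "\<And>x. norm (f x) \<le> K * norm x"
    using assms(1) by (auto simp: bounded_functional_def)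
  obtain L where L: "L \<ge> 0" "\<And>x. norm (g x) \<le> L * norm x"
    using assms(2) by (auto simp: bounded_functional_def)
  have "norm (f x - c * g x) \<le> (K + norm c * L) * norm x" for x
  proof -
    have "norm (f x - c * g x) \<le> norm (f x) + norm c * norm (g x)"
      by (metis norm_mult norm_triangle_ineq4)
    also have "\<dots> \<le> K * norm x + norm c * (L * norm x)"
      by (intro add_mono mult_left_mono K L) auto
    finally show ?thesis by (simp add: distrib_right mult.assoc)
  qed
  moreover have "K + norm c * L \<ge> 0" using K(1) L(1) by simp
  ultimately have "\<exists>K\<ge>0. \<forall>x. cmod (f x - c * g x) \<le> K * norm x" by blast
  then show ?thesis
    using assms by (simp add: bounded_functional_def algebra_simps)
qed

text \<open>To add a vector \<open>v\<close>, take a functional that does not vanish on the part \<open>R v\<close> of \<open>v\<close> that the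
  coordinates along \<open>E\<close> do not see, and precompose it with \<open>R\<close>, which kills \<open>E\<close>.\<close>

lemma biorthogonal_functionals:
  fixes E :: "'a::complex_normed_vector set"
  assumes "finite E" "cvec.independent E"
  shows "\<exists>\<phi>. (\<forall>e\<in>E. bounded_functional (\<phi> e)) \<and> (\<forall>e\<in>E. \<forall>e'\<in>E. \<phi> e e' = (if e = e' then 1 else 0))"
  using assms
proof (induction E)
  case empty
  then show ?case by simp
next
  case (insert v E)
  have ind: "cvec.independent E" "v \<notin> cvec.span E"
    using insert by (auto simp: cvec.independent_insert)
  then obtain \<phi> where \<phi>: "\<And>e. e \<in> E \<Longrightarrow> bounded_functional (\<phi> e)"
    "\<And>e e'. e \<in> E \<Longrightarrow> e' \<in> E \<Longrightarrow> \<phi> e e' = (if e = e' then 1 else 0)"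
    using insert by blast
  define R where "R x = x - (\<Sum>e\<in>E. \<phi> e x *\<^sub>C e)" for x
  have R: "bounded_clinear R"
    unfolding R_def using \<phi>(1)
    by (intro clinear_minus_op clinear_id clinear_sum_op clinear_rank_one)
  have Re: "R e = 0" if "e \<in> E" for e
  proof -
    have "(\<Sum>e'\<in>E. \<phi> e' e *\<^sub>C e') = (\<Sum>e'\<in>E. if e' = e then e' else 0)"
      by (rule sum.cong) (use \<phi>(2) that in auto)
    then show ?thesis using that insert by (simp add: R_def)
  qed
  have "(\<Sum>e\<in>E. \<phi> e v *\<^sub>C e) \<in> cvec.span E"
    by (intro cvec.span_sum cvec.span_scale cvec.span_base)
  then have "R v \<noteq> 0" using ind(2) by (auto simp: R_def)
  then obtain \<kappa> where \<kappa>: "bounded_functional \<kappa>" "\<kappa> (R v) = 1" using exists_bounded_functional by blast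
  define \<psi> where "\<psi> x = \<kappa> (R x)" for x
  have \<psi>: "bounded_functional \<psi>" "\<psi> v = 1" "\<And>e. e \<in> E \<Longrightarrow> \<psi> e = 0"
    unfolding \<psi>_def using functional_compose[OF \<kappa>(1) R] \<kappa>(2) Re functional_0[OF \<kappa>(1)] by auto
  define \<phi>' where "\<phi>' e = (if e = v then \<psi> else (\<lambda>x. \<phi> e x - \<phi> e v * \<psi> x))" for e
  have "bounded_functional (\<phi>' e)" if "e \<in> insert v E" for e
    using that \<phi>(1) \<psi>(1) by (auto simp: \<phi>'_def intro: functional_diff_scaled)
  moreover have "\<phi>' e e' = (if e = e' then 1 else 0)" if "e \<in> insert v E" "e' \<in> insert v E" for e e'
    using that \<phi>(2) \<psi> insert.hyps by (auto simp: \<phi>'_def)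
  ultimately show ?case by blast
qed

text \<open>If \<open>v\<close> has distance \<open>d\<close> from \<open>W\<close>, then \<open>d |c| \<le> \<parallel>w + c v\<parallel>\<close>, so the coefficients of a convergent
  sequence converge.\<close>

lemma closed_plus_line:
  fixes W :: "'a::complex_normed_vector set"
  assumes W: "cvec.subspace W" "closed W"
  shows "closed {w + c *\<^sub>C v |w c. w \<in> W}"
proof (cases "v \<in> W")
  case True
  have "{w + c *\<^sub>C v |w c. w \<in> W} = W"
  proof
    show "W \<subseteq> {w + c *\<^sub>C v |w c. w \<in> W}" by (force intro: exI[of _ 0])
  qed (use True W(1) in \<open>auto intro!: cvec.subspace_add cvec.subspace_scale\<close>)
  then show ?thesis using W by simp
next
  case False
  then obtain d where d: "d > 0" "ball v d \<subseteq> - W"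
    using W(2) open_contains_ball[of "- W"] by auto
  have lower: "d * cmod c \<le> norm (w + c *\<^sub>C v)" if w: "w \<in> W" for w c
  proof (cases "c = 0")
    case True
    then show ?thesis by simp
  next
    case False
    have "- (inverse c *\<^sub>C w) \<in> W" using W(1) w by (intro cvec.subspace_neg cvec.subspace_scale)
    then have "d \<le> dist v (- (inverse c *\<^sub>C w))" using d(2) by force
    then have "d \<le> norm (v + inverse c *\<^sub>C w)" by (simp add: dist_norm)
    then have "d * cmod c \<le> norm (v + inverse c *\<^sub>C w) * cmod c" by (intro mult_right_mono) auto
    also have "\<dots> = norm (c *\<^sub>C (v + inverse c *\<^sub>C w))" by (simp add: norm_scaleC mult.commute)
    also have "c *\<^sub>C (v + inverse c *\<^sub>C w) = w + c *\<^sub>C v"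
      using False by (simp add: scaleC_add_right scaleC_scaleC add.commute)
    finally show ?thesis .
  qed
  show ?thesis
    unfolding closed_sequential_limits
  proof (intro allI impI)
    fix x l assume "(\<forall>n. x n \<in> {w + c *\<^sub>C v |w c. w \<in> W}) \<and> x \<longlonglongrightarrow> l"
    then have x: "\<And>n. \<exists>w c. w \<in> W \<and> x n = w + c *\<^sub>C v" and l: "x \<longlonglongrightarrow> l" by blast+
    from x obtain w c where wc: "\<And>n. w n \<in> W" "\<And>n. x n = w n + c n *\<^sub>C v"
      by metis
    have "Cauchy c"
    proof (rule metric_CauchyI)
      fix e :: real assume "e > 0"
      then obtain M where M: "\<And>m n. m \<ge> M \<Longrightarrow> n \<ge> M \<Longrightarrow> dist (x m) (x n) < e * d"
        using metric_CauchyD[OF LIMSEQ_imp_Cauchy[OF l], of "e * d"] d(1) by auto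
      show "\<exists>M. \<forall>m\<ge>M. \<forall>n\<ge>M. dist (c m) (c n) < e"
      proof (intro exI allI impI)
        fix m n assume mn: "m \<ge> M" "n \<ge> M"
        have "d * cmod (c m - c n) \<le> norm ((w m - w n) + (c m - c n) *\<^sub>C v)"
          by (rule lower) (use W wc in \<open>auto intro: cvec.subspace_diff\<close>)
        also have "(w m - w n) + (c m - c n) *\<^sub>C v = x m - x n"
          by (simp add: wc(2) cvec.scale_left_diff_distrib)
        finally have "d * cmod (c m - c n) < e * d" using M[OF mn] by (simp add: dist_norm)
        then show "dist (c m) (c n) < e" using d(1) by (simp add: dist_norm mult.commute)
      qed
    qed
    then obtain c0 where c0: "c \<longlonglongrightarrow> c0" using Cauchy_convergent convergentD by blast
    have "(\<lambda>n. c n *\<^sub>C v) \<longlonglongrightarrow> c0 *\<^sub>C v"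
    proof (rule LIM_zero_cancel, rule Lim_null_comparison)
      show "\<forall>\<^sub>F n in sequentially. norm (c n *\<^sub>C v - c0 *\<^sub>C v) \<le> cmod (c n - c0) * norm v"
        by (intro always_eventually allI) (metis cvec.scale_left_diff_distrib norm_scaleC order_refl)
      show "(\<lambda>n. cmod (c n - c0) * norm v) \<longlonglongrightarrow> 0"
        using tendsto_mult_left_zero[OF tendsto_norm_zero[OF LIM_zero[OF c0]]] by simp
    qed
    then have "(\<lambda>n. x n - c n *\<^sub>C v) \<longlonglongrightarrow> l - c0 *\<^sub>C v" by (intro tendsto_diff l)
    moreover have "x n - c n *\<^sub>C v \<in> W" for n using wc by simp
    ultimately have "l - c0 *\<^sub>C v \<in> W" by (rule closed_sequentially[OF W(2), rotated])
    moreover have "l = (l - c0 *\<^sub>C v) + c0 *\<^sub>C v" by simp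
    ultimately show "l \<in> {w + c *\<^sub>C v |w c. w \<in> W}" by blast
  qed
qed

lemma closed_plus_span:
  fixes W :: "'a::complex_normed_vector set"
  assumes W: "cvec.subspace W" "closed W" and "finite B"
  shows "closed {w + g |w g. w \<in> W \<and> g \<in> cvec.span B}"
  using \<open>finite B\<close>
proof (induction B)
  case empty
  then show ?case using W by simp
next
  case (insert v B)
  have "{w + g |w g. w \<in> W \<and> g \<in> cvec.span (insert v B)} =
    {u + c *\<^sub>C v |u c. u \<in> {w + g |w g. w \<in> W \<and> g \<in> cvec.span B}}" (is "?L = ?R")
  proof
    show "?L \<subseteq> ?R"
    proof
      fix x assume "x \<in> ?L"
      then obtain w g where wg: "w \<in> W" "g \<in> cvec.span (insert v B)" "x = w + g" by blast
      then obtain k where "g - k *\<^sub>C v \<in> cvec.span B" by (auto simp: cvec.span_breakdown_eq)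
      moreover have "x = (w + (g - k *\<^sub>C v)) + k *\<^sub>C v" using wg by simp
      ultimately show "x \<in> ?R" using wg(1) by blast
    qed
    show "?R \<subseteq> ?L"
    proof
      fix x assume "x \<in> ?R"
      then obtain w g c where wg: "w \<in> W" "g \<in> cvec.span B" "x = w + g + c *\<^sub>C v" by blast
      then have "g + c *\<^sub>C v \<in> cvec.span (insert v B)"
        by (auto simp: cvec.span_breakdown_eq intro!: exI[of _ c])
      moreover have "x = w + (g + c *\<^sub>C v)" using wg by simp
      ultimately show "x \<in> ?L" using wg(1) by blast
    qed
  qed
  moreover have "cvec.subspace {w + g |w g. w \<in> W \<and> g \<in> cvec.span B}"
    by (rule cvec.subspace_sums[OF W(1) cvec.subspace_span])
  ultimately show ?case using closed_plus_line[of "{w + g |w g. w \<in> W \<and> g \<in> cvec.span B}" v] insert.IH by (simp only:)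
qed

lemma closed_image_bounded_below:
  fixes A :: "'a::banach \<Rightarrow> 'b::real_normed_vector"
  assumes A: "bounded_linear A" and W: "subspace W" "closed W"
    and below: "\<And>x. x \<in> W \<Longrightarrow> norm x \<le> C * norm (A x)"
  shows "closed (A ` W)"
proof -
  interpret A: bounded_linear A by fact
  have below': "norm x \<le> (\<bar>C\<bar> + 1) * norm (A x)" if "x \<in> W" for x
    using below[OF that] mult_right_mono[of C "\<bar>C\<bar> + 1" "norm (A x)"] by (smt (verit) norm_ge_zero)
  have "complete (A ` W)"
  proof (rule complete_isometric_image[OF _ W(1) A])
    show "0 < inverse (\<bar>C\<bar> + 1)" by simp
    show "\<forall>x\<in>W. inverse (\<bar>C\<bar> + 1) * norm x \<le> norm (A x)"
      using below' by (auto simp: field_simps)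
    show "complete W" using W(2) by (simp add: complete_eq_closed)
  qed
  then show ?thesis by (rule complete_imp_closed)
qed

text \<open>Dropping the functionals one at a time enlarges the image by at most a line at each step, and
  adding a line keeps a closed subspace closed. Iterated, this shows that the ranges of the powers of
  such an operator are closed.\<close>

lemma closed_image_if_bounded_below_on_kernels:
  fixes A :: "'a::complex_banach \<Rightarrow> 'a"
  assumes A: "bounded_clinear A" and W: "cvec.subspace W" "closed W"
    and E: "finite E" "\<And>e. e \<in> E \<Longrightarrow> bounded_functional (\<phi> e)"
    and below: "\<And>x. \<forall>e\<in>E. \<phi> e x = 0 \<Longrightarrow> norm x \<le> C * norm (A x)"
  shows "closed (A ` W)"
proof -
  let ?K = "\<lambda>E'. W \<inter> {x. \<forall>e\<in>E'. \<phi> e x = 0}"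
  have sub: "cvec.subspace (?K E') \<and> closed (?K E')" if "E' \<subseteq> E" for E'
  proof
    show "cvec.subspace (?K E')"
      using E(2) that W(1)
      by (auto simp: cvec.subspace_def subset_iff functional_add functional_scale functional_0)
    have "?K E' = W \<inter> (\<Inter>e\<in>E'. {x. \<phi> e x = 0})" by auto
    moreover have "closed (\<Inter>e\<in>E'. {x. \<phi> e x = 0})"
      using E(2) that by (intro closed_INT ballI closed_kernel_bounded_functional) auto
    ultimately show "closed (?K E')" using W(2) by auto
  qed
  have "closed (A ` ?K E') \<Longrightarrow> closed (A ` W)" if "finite E'" "E' \<subseteq> E" for E'
    using that
  proof (induction E')
    case empty
    then show ?case by simp
  next
    case (insert e E')
    have e: "bounded_functional (\<phi> e)" using insert E by blast
    have "closed (A ` ?K E')"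
    proof (cases "?K (insert e E') = ?K E'")
      case True
      then show ?thesis using insert by simp
    next
      case False
      then obtain g where g: "g \<in> ?K E'" "\<phi> e g \<noteq> 0" by auto
      have "A ` ?K E' = {u + c *\<^sub>C A g |u c. u \<in> A ` ?K (insert e E')}"
      proof (intro equalityI subsetI)
        fix y assume "y \<in> A ` ?K E'"
        then obtain x where x: "x \<in> ?K E'" "y = A x" by blast
        define c where "c = \<phi> e x / \<phi> e g"
        have "x - c *\<^sub>C g \<in> ?K E'"
          using sub[of E'] insert.prems x(1) g(1) by (intro cvec.subspace_diff cvec.subspace_scale) auto
        moreover have "\<phi> e (x - c *\<^sub>C g) = 0"
          using g(2) by (simp add: functional_diff[OF e] functional_scale[OF e] c_def)
        ultimately have "x - c *\<^sub>C g \<in> ?K (insert e E')" by auto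
        moreover have "y = A (x - c *\<^sub>C g) + c *\<^sub>C A g"
          by (simp add: x(2) clinear_diff[OF A] clinear_scale[OF A])
        ultimately show "y \<in> {u + c *\<^sub>C A g |u c. u \<in> A ` ?K (insert e E')}" by blast
      next
        fix y assume "y \<in> {u + c *\<^sub>C A g |u c. u \<in> A ` ?K (insert e E')}"
        then obtain x c where x: "x \<in> ?K (insert e E')" "y = A x + c *\<^sub>C A g" by blast
        have "x + c *\<^sub>C g \<in> ?K E'"
          using sub[of E'] insert.prems x(1) g(1) by (intro cvec.subspace_add cvec.subspace_scale) auto
        moreover have "y = A (x + c *\<^sub>C g)"
          by (simp add: x(2) clinear_add[OF A] clinear_scale[OF A])
        ultimately show "y \<in> A ` ?K E'" by blast
      qed
      moreover have "cvec.subspace (A ` ?K (insert e E'))"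
        by (rule cpair.linear_subspace_image[OF clinear_linear[OF A]])
          (use sub[of "insert e E'"] insert.prems in auto)
      ultimately show ?thesis using closed_plus_line insert.prems(1) by simp
    qed
    then show ?case using insert by blast
  qed
  moreover have "closed (A ` ?K E)"
    by (rule closed_image_bounded_below[OF clinear_imp_bounded_linear[OF A], of _ C])
      (use sub[of E] below csubspace_imp_subspace in auto)
  ultimately show ?thesis using E(1) by blast
qed

section \<open>Finite-rank perturbations\<close>

lemma injective_on_span_imp_onto:
  fixes L :: "'a::complex_normed_vector \<Rightarrow> 'a"
  assumes L: "Vector_Spaces.linear scaleC scaleC L" and inj: "inj_on L (cvec.span B)"
    and B: "finite B" and sub: "L ` cvec.span B \<subseteq> cvec.span B"
  shows "L ` cvec.span B = cvec.span B"
proof -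
  obtain C where C: "C \<subseteq> B" "cvec.independent C" "cvec.span C = cvec.span B"
    using cvec.maximal_independent_subset[of B]
    by (metis cvec.span_eq cvec.span_superset order_trans)
  have finC: "finite C" using C(1) B finite_subset by blast
  have injC: "inj_on L (cvec.span C)" using inj C(3) by simp
  have ind: "cvec.independent (L ` C)"
    by (rule cpair.linear_independent_injective_image[OF L C(2) injC])
  have card: "card (L ` C) = card C"
    using injC cvec.span_superset by (metis card_image inj_on_subset)
  have LC: "L ` C \<subseteq> cvec.span C"
    using sub C(3) cvec.span_superset[of C] by blast
  have "cvec.span C \<subseteq> cvec.span (L ` C)"
  proof (rule ccontr)
    assume "\<not> ?thesis"
    then obtain x where x: "x \<in> cvec.span C" "x \<notin> cvec.span (L ` C)" by blast
    then have "x \<notin> L ` C" using cvec.span_base[of x "L ` C"] by metis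
    moreover have "cvec.independent (insert x (L ` C))" using x ind by (simp add: cvec.independent_insert)
    then have "card (insert x (L ` C)) \<le> card C"
      using cvec.independent_span_bound[OF finC] x(1) LC by blast
    ultimately show False using finC card by simp
  qed
  also have "\<dots> = L ` cvec.span C" using cpair.linear_span_image[OF L] by simp
  finally show ?thesis using sub C(3) by simp
qed

text \<open>Modulo the span of \<open>B\<close> the operator is the identity, and on that finite-dimensional span
  injectivity gives surjectivity.\<close>

lemma injective_identity_plus_finite_rank_imp_surj:
  fixes L :: "'a::complex_normed_vector \<Rightarrow> 'a"
  assumes L: "Vector_Spaces.linear scaleC scaleC L" and inj: "inj L"
    and B: "finite B" and fr: "\<And>x. L x - x \<in> cvec.span B"
  shows "surj L"
proof -
  have sub: "L ` cvec.span B \<subseteq> cvec.span B"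
  proof
    fix y assume "y \<in> L ` cvec.span B"
    then obtain x where x: "x \<in> cvec.span B" "y = L x" by blast
    have "(L x - x) + x \<in> cvec.span B" by (rule cvec.span_add[OF fr x(1)])
    then show "y \<in> cvec.span B" using x by simp
  qed
  have onto: "L ` cvec.span B = cvec.span B"
    by (rule injective_on_span_imp_onto[OF L inj_on_subset[OF inj] B sub]) simp
  have "\<exists>x. y = L x" for y
  proof -
    obtain z where z: "L y - y = L z" using fr[of y] onto by (metis imageE)
    have "L (y - z) = y" using z by (simp add: cpair.linear_diff[OF L] algebra_simps)
    then show ?thesis by metis
  qed
  then show ?thesis by auto
qed

text \<open>This takes the place of the stability of the index under finite-rank perturbations: if \<open>H\<close>
  is a right inverse of \<open>U\<close>, then \<open>V \<circ> H\<close> is injective and of the form identity plus finite rank.\<close>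

lemma surj_inj_finite_rank_difference_imp_bij:
  fixes U V :: "'a::complex_normed_vector \<Rightarrow> 'a"
  assumes U: "Vector_Spaces.linear scaleC scaleC U" and V: "Vector_Spaces.linear scaleC scaleC V"
    and "surj U" and "inj V" and B: "finite B" and fr: "\<And>x. V x - U x \<in> cvec.span B"
  shows "bij U \<and> bij V"
proof -
  obtain H where H: "Vector_Spaces.linear scaleC scaleC H" "U \<circ> H = id"
    using cpair.linear_surjective_right_inverse[OF U \<open>surj U\<close>] by blast
  have UH: "U (H x) = x" for x using H(2) by (metis comp_apply id_apply)
  have "inj H" by (metis UH injI)
  have VH: "Vector_Spaces.linear scaleC scaleC (V \<circ> H)"
    by (rule Vector_Spaces.linear_compose[OF H(1) V])
  have "inj (V \<circ> H)" using \<open>inj V\<close> \<open>inj H\<close> by (rule inj_compose)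
  moreover have "(V \<circ> H) x - x \<in> cvec.span B" for x using fr[of "H x"] by (simp add: UH)
  ultimately have "surj (V \<circ> H)"
    using injective_identity_plus_finite_rank_imp_surj[OF VH _ B] by blast
  then have "surj V" by (metis comp_surj fun.set_map surj_def comp_apply)
  then have "bij V" using \<open>inj V\<close> by (simp add: bij_def)
  have "surj H"
  proof (rule surjI)
    fix x
    obtain z where "V x = V (H z)" using \<open>surj (V \<circ> H)\<close> by (metis comp_apply surjD)
    then show "H (U x) = x" using \<open>inj V\<close> UH by (metis injD)
  qed
  then have "inj U" by (metis UH injI surjD)
  then show ?thesis using \<open>bij V\<close> \<open>surj U\<close> by (simp add: bij_def)
qed

section \<open>Shifts of an operator that is onto a closed subspace\<close>

lemma shift_shift: "shift (shift T z) w = shift T (z + w)"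
  by (simp add: shift_def fun_eq_iff scaleC_add_left)

lemma shift_0 [simp]: "shift T 0 = T"
  by (simp add: shift_def fun_eq_iff)

lemma power_eigenvector:
  assumes U: "bounded_clinear U" and "U x = m *\<^sub>C x"
  shows "(U ^^ n) x = m ^ n *\<^sub>C x"
  by (induction n) (simp_all add: clinear_scale[OF U] assms(2) scaleC_scaleC mult.commute)

text \<open>\<open>Q\<close> is a polynomial in \<open>U\<close> and therefore preserves the invariant subspaces of \<open>U\<close>.\<close>

lemma power_minus_scalar_factor:
  assumes U: "bounded_clinear U"
  shows "\<exists>Q. (\<forall>x. (U ^^ n) x - m ^ n *\<^sub>C x = shift U m (Q x)) \<and>
    (\<forall>W. cvec.subspace W \<longrightarrow> U ` W \<subseteq> W \<longrightarrow> Q ` W \<subseteq> W)"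
proof (induction n)
  case 0
  show ?case
    by (rule exI[of _ "\<lambda>x. 0"]) (auto simp: shift_def clinear_0[OF U] cvec.subspace_0)
next
  case (Suc n)
  then obtain Q where Q: "\<And>x. (U ^^ n) x - m ^ n *\<^sub>C x = shift U m (Q x)"
    "\<And>W. cvec.subspace W \<Longrightarrow> U ` W \<subseteq> W \<Longrightarrow> Q ` W \<subseteq> W" by blast
  have pow: "(U ^^ k) ` W \<subseteq> W" if "U ` W \<subseteq> W" for W k
    using that by (induction k) auto
  show ?case
  proof (intro exI[of _ "\<lambda>x. (U ^^ n) x + m *\<^sub>C Q x"] conjI allI impI)
    fix x
    have "shift U m (m *\<^sub>C Q x) = m *\<^sub>C ((U ^^ n) x - m ^ n *\<^sub>C x)"
      by (simp add: Q(1) shift_def clinear_scale[OF U] cvec.scale_right_diff_distrib)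
    moreover have "shift U m ((U ^^ n) x) = (U ^^ Suc n) x - m *\<^sub>C (U ^^ n) x" by (simp add: shift_def)
    ultimately show "(U ^^ Suc n) x - m ^ Suc n *\<^sub>C x = shift U m ((U ^^ n) x + m *\<^sub>C Q x)"
      by (simp add: clinear_add[OF clinear_shift[OF U]] cvec.scale_right_diff_distrib scaleC_scaleC)
  next
    fix W assume W: "cvec.subspace W" "U ` W \<subseteq> W"
    show "(\<lambda>x. (U ^^ n) x + m *\<^sub>C Q x) ` W \<subseteq> W"
      using pow[OF W(2), of n] Q(2)[OF W] W(1)
      by (auto simp: image_subset_iff intro!: cvec.subspace_add cvec.subspace_scale)
  qed
qed

lemma onto_shift_uniform:
  fixes U :: "'a::complex_banach \<Rightarrow> 'a"
  assumes U: "bounded_clinear U" and W: "cvec.subspace W" "closed W" and onto: "U ` W = W"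
  shows "\<exists>C>0. \<exists>d>0. \<forall>m. norm m < d \<longrightarrow> (\<forall>y\<in>W. \<exists>x\<in>W. shift U m x = y \<and> norm x \<le> C * norm y)"
proof -
  have rU: "bounded_linear U" by (rule clinear_imp_bounded_linear[OF U])
  have rW: "subspace W" by (rule csubspace_imp_subspace[OF W(1)])
  obtain C where C: "C > 0" "\<And>y. y \<in> W \<Longrightarrow> \<exists>x\<in>W. U x = y \<and> norm x \<le> C * norm y"
    using open_mapping[OF rU rW W(2) rW W(2) onto] by blast
  have "\<exists>x\<in>W. shift U m x = y \<and> norm x \<le> (2 * C) * norm y" if m: "norm m < 1 / (2 * C)" and y: "y \<in> W" for m y
  proof -
    have "\<exists>x\<in>W. U x + (- m) *\<^sub>C x = y \<and> norm x \<le> 2 * C * norm y"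
    proof (rule surjective_perturbation[OF rU _ rW W(2) rW _ _ _ C(2) _ _ _ y, of _ "norm m"])
      show "bounded_linear (\<lambda>x::'a. (- m) *\<^sub>C x)"
        by (intro clinear_imp_bounded_linear clinear_scaleC clinear_id)
      show "(\<lambda>x. (- m) *\<^sub>C x) ` W \<subseteq> W" using W(1) by (auto intro: cvec.subspace_scale cvec.subspace_neg)
      show "C * norm m \<le> 1 / 2" using m C(1) by (simp add: field_simps)
    qed (use onto C(1) in \<open>auto simp: norm_scaleC simp del: cvec.scale_minus_left\<close>)
    then show ?thesis by (simp add: shift_def)
  qed
  then show ?thesis using C(1) by (intro exI[of _ "2 * C"] conjI exI[of _ "1 / (2 * C)"]) auto
qed

text \<open>Solutions of \<open>(U - m) x = y\<close> can be chosen with \<open>\<parallel>x\<parallel> \<le> C \<parallel>y\<parallel>\<close> and the same \<open>C\<close> for all small \<open>m\<close>.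
  If \<open>U - m\<close> is injective this bounds its inverse, and then \<open>U - w\<close> has no kernel for \<open>|w - m| C < 1\<close>.\<close>

lemma onto_shift_injective_somewhere_imp_near:
  fixes U :: "'a::complex_banach \<Rightarrow> 'a"
  assumes U: "bounded_clinear U" and W: "cvec.subspace W" "closed W" and onto: "U ` W = W"
  shows "\<exists>d>0. \<forall>m. norm m < d \<longrightarrow> (\<forall>x\<in>W. shift U m x = 0 \<longrightarrow> x = 0) \<longrightarrow>
    (\<forall>w. norm w < d \<longrightarrow> (\<forall>y\<in>W. \<exists>x\<in>W. shift U w x = y) \<and> (\<forall>x\<in>W. shift U w x = 0 \<longrightarrow> x = 0))"
proof -
  obtain C d where C: "C > 0" "d > 0"
    and on: "\<And>m y. norm m < d \<Longrightarrow> y \<in> W \<Longrightarrow> \<exists>x\<in>W. shift U m x = y \<and> norm x \<le> C * norm y"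
    using onto_shift_uniform[OF assms] by blast
  define r where "r = min d (1 / (2 * C))"
  have r: "r > 0" "r \<le> d" "C * (2 * r) \<le> 1"
  proof -
    show "r > 0" "r \<le> d" using C by (auto simp: r_def)
    have "2 * r \<le> 1 / C" by (simp add: r_def min_def)
    then show "C * (2 * r) \<le> 1" using C(1) by (simp add: field_simps)
  qed
  show ?thesis
  proof (intro exI[of _ r] conjI allI impI ballI)
    show "r > 0" by fact
    fix m w :: complex assume m: "norm m < r" and inj: "\<forall>x\<in>W. shift U m x = 0 \<longrightarrow> x = 0" and w: "norm w < r"
    show "\<exists>x\<in>W. shift U w x = y" if "y \<in> W" for y using on[of w y] w r(2) that by auto
    fix x assume x: "x \<in> W" "shift U w x = 0"
    have eq: "shift U m x = (w - m) *\<^sub>C x"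
      using x(2) by (simp add: shift_def cvec.scale_left_diff_distrib)
    then have "shift U m x \<in> W" using W(1) x(1) cvec.subspace_scale by metis
    then obtain x' where x': "x' \<in> W" "shift U m x' = shift U m x" "norm x' \<le> C * norm (shift U m x)"
      using on[of m "shift U m x"] m r(2) by auto
    have "shift U m (x' - x) = 0"
      using x'(2) by (simp add: clinear_diff[OF clinear_shift[OF U]])
    then have "x' = x" using inj W(1) x(1) x'(1) by (metis cvec.subspace_diff eq_iff_diff_eq_0)
    then have le: "norm x \<le> (C * norm (w - m)) * norm x" using x'(3) by (simp add: eq norm_scaleC)
    have "norm (w - m) < 2 * r" using m w norm_triangle_ineq4[of w m] by linarith
    then have "C * norm (w - m) < 1" using C(1) r(3) by (smt (verit, best) mult_strict_left_mono)
    with le show "x = 0"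
      by (metis linorder_not_less mult_less_cancel_right2 norm_le_zero_iff)
  qed
qed

lemma decreasing_subspaces_stabilise:
  fixes D :: "nat \<Rightarrow> 'a::complex_normed_vector set"
  assumes sub: "\<And>n. cvec.subspace (D n)" and dec: "\<And>n m. n \<le> m \<Longrightarrow> D m \<subseteq> D n"
    and fin: "D 0 \<subseteq> cvec.span B" "finite B"
  shows "\<exists>m. \<forall>n\<ge>m. D n = D m"
proof -
  obtain m where m: "\<And>n. cvec.dim (D m) \<le> cvec.dim (D n)"
    using ex_has_least_nat[of "\<lambda>_. True" 0 "\<lambda>n. cvec.dim (D n)"] by auto
  have basis: "\<exists>A. finite A \<and> A \<subseteq> D n \<and> cvec.independent A \<and> D n \<subseteq> cvec.span A \<and> card A = cvec.dim (D n)" for n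
  proof -
    obtain A where A: "A \<subseteq> D n" "cvec.independent A" "D n \<subseteq> cvec.span A" "card A = cvec.dim (D n)"
      using cvec.basis_exists[of "D n"] by blast
    have "A \<subseteq> cvec.span B" using A(1) dec[of 0 n] fin(1) by auto
    then have "finite A" using cvec.independent_span_bound[OF fin(2) A(2)] by simp
    then show ?thesis using A by blast
  qed
  have "D m \<subseteq> D n" if n: "m \<le> n" for n
  proof (rule ccontr)
    assume "\<not> ?thesis"
    then obtain x where x: "x \<in> D m" "x \<notin> D n" by blast
    obtain A where A: "finite A" "A \<subseteq> D n" "cvec.independent A" "card A = cvec.dim (D n)"
      using basis by metis
    obtain A' where A': "finite A'" "D m \<subseteq> cvec.span A'" "card A' = cvec.dim (D m)"
      using basis by metis
    have xA: "x \<notin> cvec.span A" using subsetD[OF cvec.span_minimal[OF A(2) sub]] x(2) by metis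
    then have "x \<notin> A" using cvec.span_base[of x A] by metis
    have "cvec.independent (insert x A)" using A(3) xA by (simp add: cvec.independent_insert)
    moreover have "insert x A \<subseteq> D m" using A(2) dec[OF n] x(1) by blast
    ultimately have "card (insert x A) \<le> card A'"
      using cvec.independent_span_bound[OF A'(1)] order_trans[OF _ A'(2)] by metis
    then show False using A(1,4) A'(3) m[of n] \<open>x \<notin> A\<close> by simp
  qed
  then show ?thesis using dec by (intro exI[of _ m]) blast
qed

lemma range_power_antimono:
  fixes S :: "'a \<Rightarrow> 'a"
  assumes "n \<le> m"
  shows "range (S ^^ m) \<subseteq> range (S ^^ n)"
proof
  obtain k where k: "m = n + k" using assms le_Suc_ex by blast
  fix y assume "y \<in> range (S ^^ m)"
  then obtain x where "y = (S ^^ n) ((S ^^ k) x)" by (auto simp: k funpow_add)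
  then show "y \<in> range (S ^^ n)" by simp
qed

lemma csubspace_range_power:
  "bounded_clinear S \<Longrightarrow> cvec.subspace (range (S ^^ n))"
  by (rule cpair.linear_subspace_image[OF clinear_linear[OF clinear_power]])
    (auto simp: cvec.subspace_UNIV)

lemma csubspace_null_space: "bounded_clinear S \<Longrightarrow> cvec.subspace (null_space S)"
  unfolding null_space_def
  by (rule cpair.linear_subspace_kernel[OF clinear_linear])

text \<open>For \<open>y\<close> in the core, the solutions of \<open>S x = y\<close> in the range of \<open>S ^ n\<close> form a translate of the
  intersection of that range with the null space. These intersections stabilise because the null space
  is finite-dimensional, so some solution belongs to all ranges at once.\<close>

lemma image_core:
  fixes S :: "'a::complex_normed_vector \<Rightarrow> 'a"
  assumes S: "bounded_clinear S" and fin: "null_space S \<subseteq> cvec.span B" "finite B"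
  shows "S ` (\<Inter>n. range (S ^^ n)) = (\<Inter>n. range (S ^^ n))"
proof
  show "S ` (\<Inter>n. range (S ^^ n)) \<subseteq> (\<Inter>n. range (S ^^ n))"
  proof clarify
    fix x n assume "x \<in> (\<Inter>n. range (S ^^ n))"
    then obtain u where "x = (S ^^ n) u" by blast
    then have "S x = (S ^^ n) (S u)" by (simp add: funpow_swap1)
    then show "S x \<in> range (S ^^ n)" by simp
  qed
next
  define D where "D n = null_space S \<inter> range (S ^^ n)" for n
  obtain m where m: "\<And>n. n \<ge> m \<Longrightarrow> D n = D m"
  proof -
    have "\<exists>m. \<forall>n\<ge>m. D n = D m"
    proof (rule decreasing_subspaces_stabilise[OF _ _ _ fin(2)])
      show "cvec.subspace (D n)" for n
        unfolding D_def by (intro cvec.subspace_inter csubspace_null_space csubspace_range_power S)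
      show "D k \<subseteq> D n" if "n \<le> k" for n k
        unfolding D_def using range_power_antimono[OF that, of S] by (rule Int_mono[OF order_refl])
      show "D 0 \<subseteq> cvec.span B" using fin(1) by (auto simp: D_def)
    qed
    then show ?thesis using that by blast
  qed
  show "(\<Inter>n. range (S ^^ n)) \<subseteq> S ` (\<Inter>n. range (S ^^ n))"
  proof
    fix y assume y: "y \<in> (\<Inter>n. range (S ^^ n))"
    have "\<exists>u\<in>range (S ^^ n). S u = y" for n
    proof -
      have "y \<in> range (S ^^ Suc n)" using y by blast
      then show ?thesis by auto
    qed
    then obtain u where u: "\<And>n. u n \<in> range (S ^^ n)" "\<And>n. S (u n) = y" by metis
    have "u m \<in> range (S ^^ n)" for n
    proof (cases "n \<le> m")
      case True
      then show ?thesis using u(1)[of m] range_power_antimono[of n m S] by blast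
    next
      case False
      have "u n \<in> range (S ^^ m)" using u(1)[of n] range_power_antimono[of m n S] False by auto
      then have "u m - u n \<in> D m"
        using u csubspace_range_power[OF S]
        by (auto simp: D_def null_space_def clinear_diff[OF S] intro!: cvec.subspace_diff)
      then have "u m - u n \<in> range (S ^^ n)" using m[of n] False by (auto simp: D_def)
      then have "(u m - u n) + u n \<in> range (S ^^ n)"
        by (rule cvec.subspace_add[OF csubspace_range_power[OF S] _ u(1)])
      then show ?thesis by simp
    qed
    then show "y \<in> S ` (\<Inter>n. range (S ^^ n))" using u(2)[of m] by (intro image_eqI[of _ _ "u m"]) auto
  qed
qed

lemma injective_closed_range_imp_bounded_below:
  fixes A :: "'a::complex_banach \<Rightarrow> 'a"
  assumes A: "bounded_clinear A" and inj: "inj A" and cl: "closed (range A)"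
  shows "\<exists>C>0. \<forall>x. norm x \<le> C * norm (A x)"
proof -
  have "\<exists>C>0. \<forall>y\<in>range A. \<exists>x\<in>UNIV. A x = y \<and> norm x \<le> C * norm y"
    using csubspace_range_power[OF A, of 1] cl
    by (intro open_mapping clinear_imp_bounded_linear A csubspace_imp_subspace) auto
  then obtain C where "C > 0" "\<And>y. y \<in> range A \<Longrightarrow> \<exists>x. A x = y \<and> norm x \<le> C * norm y" by auto
  then show ?thesis using inj by (metis injD rangeI)
qed

lemma closed_range_power:
  fixes A :: "'a::complex_banach \<Rightarrow> 'a"
  assumes A: "bounded_clinear A"
    and E: "finite E" "\<And>e. e \<in> E \<Longrightarrow> bounded_functional (\<phi> e)"
    and below: "\<And>x. \<forall>e\<in>E. \<phi> e x = 0 \<Longrightarrow> norm x \<le> C * norm (A x)"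
  shows "closed (range (A ^^ n))"
proof (induction n)
  case 0
  then show ?case by simp
next
  case (Suc n)
  have "closed (A ` range (A ^^ n))"
    by (rule closed_image_if_bounded_below_on_kernels[OF A csubspace_range_power[OF A] Suc E below])
  then show ?case by (simp add: image_comp)
qed

section \<open>Correcting kernel and range by a finite-rank operator\<close>

lemma biorthogonal_sum:
  assumes "finite E" "\<And>e. e \<in> E \<Longrightarrow> bounded_functional (\<phi> e)"
    and "\<And>e e'. e \<in> E \<Longrightarrow> e' \<in> E \<Longrightarrow> \<phi> e e' = (if e = e' then 1 else 0)" and "e \<in> E"
  shows "\<phi> e (\<Sum>e'\<in>E. c e' *\<^sub>C e') = c e"
proof -
  have "\<phi> e (\<Sum>e'\<in>E. c e' *\<^sub>C e') = (\<Sum>e'\<in>E. c e' * \<phi> e e')"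
    using assms(2,4) by (simp add: functional_sum functional_scale)
  also have "\<dots> = (\<Sum>e'\<in>E. if e' = e then c e' else 0)"
    by (rule sum.cong) (use assms(3,4) in auto)
  also have "\<dots> = c e" using assms(1,4) by simp
  finally show ?thesis .
qed

lemma span_image_sum:
  assumes "finite E" "y \<in> cvec.span (b ` E)"
  obtains c where "y = (\<Sum>e\<in>E. c e *\<^sub>C b e)"
proof -
  have "\<exists>c. y = (\<Sum>e\<in>E. c e *\<^sub>C b e)"
    using assms(2)
  proof (induction rule: cvec.span_induct_alt)
    case base
    show ?case by (rule exI[of _ "\<lambda>_. 0"]) simp
  next
    case (step k x y)
    then obtain e c where e: "e \<in> E" "x = b e" "y = (\<Sum>e\<in>E. c e *\<^sub>C b e)" by blast
    have "(\<Sum>e'\<in>E. (if e' = e then k else 0) *\<^sub>C b e') = (\<Sum>e'\<in>E. if e' = e then k *\<^sub>C b e' else 0)"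
      by (rule sum.cong) auto
    also have "\<dots> = k *\<^sub>C b e" using e(1) assms(1) by simp
    finally have "k *\<^sub>C x + y = (\<Sum>e'\<in>E. ((if e' = e then k else 0) + c e') *\<^sub>C b e')"
      by (simp add: e scaleC_add_left sum.distrib)
    then show ?case by (intro exI[of _ "\<lambda>e'. (if e' = e then k else 0) + c e'"])
  qed
  then show ?thesis using that by blast
qed

text \<open>The intended use: \<open>E\<close> consists of independent vectors of the null space of \<open>S\<close>, \<open>\<phi>\<close> is
  biorthogonal to \<open>E\<close>, and \<open>b\<close> maps \<open>E\<close> to vectors that are independent modulo the range of \<open>S\<close> or span
  the whole space together with it. Then \<open>B = S + F\<close> uses up kernel in order to fill the missing range.\<close>

locale finite_rank_correction =
  fixes S :: "'a::complex_banach \<Rightarrow> 'a" and E :: "'a set" and \<phi> :: "'a \<Rightarrow> 'a \<Rightarrow> complex" and b :: "'a \<Rightarrow> 'a"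
  assumes S: "bounded_clinear S" and finE: "finite E"
    and \<phi>: "\<And>e. e \<in> E \<Longrightarrow> bounded_functional (\<phi> e)"
begin

definition F :: "'a \<Rightarrow> 'a" where "F x = (\<Sum>e\<in>E. \<phi> e x *\<^sub>C b e)"

definition B :: "'a \<Rightarrow> 'a" where "B x = S x + F x"

lemma F_in_span: "F x \<in> cvec.span (b ` E)"
  unfolding F_def by (intro cvec.span_sum cvec.span_scale cvec.span_base) auto

lemma B_clinear: "bounded_clinear B"
  unfolding B_def F_def
  by (intro clinear_plus S clinear_sum_op clinear_rank_one \<phi>)

lemma B_eq_S: "\<forall>e\<in>E. \<phi> e x = 0 \<Longrightarrow> B x = S x"
  by (simp add: B_def F_def)

lemma shift_linear:
  "Vector_Spaces.linear scaleC scaleC (shift S z)" "Vector_Spaces.linear scaleC scaleC (shift B z)"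
  by (intro clinear_linear clinear_shift S B_clinear)+

lemma shift_difference:
  "shift B z x - shift S z x \<in> cvec.span (b ` E)" "shift S z x - shift B z x \<in> cvec.span (b ` E)"
  using F_in_span[of x] cvec.span_neg[OF F_in_span[of x]] by (simp_all add: shift_def B_def)

lemma bij_if_surj_shift_S: "surj (shift S z) \<Longrightarrow> inj (shift B z) \<Longrightarrow> bij (shift S z) \<and> bij (shift B z)"
  by (rule surj_inj_finite_rank_difference_imp_bij[OF shift_linear _ _ finite_imageI[OF finE] shift_difference(1)])

lemma bij_if_inj_shift_S: "inj (shift S z) \<Longrightarrow> surj (shift B z) \<Longrightarrow> bij (shift B z) \<and> bij (shift S z)"
  by (rule surj_inj_finite_rank_difference_imp_bij[OF shift_linear(2,1) _ _ finite_imageI[OF finE] shift_difference(2)])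

text \<open>Adding a combination of \<open>E\<close> to \<open>x\<close> leaves \<open>S x\<close> unchanged but gives the coordinates \<open>\<phi> e x\<close>
  arbitrary values.\<close>

lemma range_B:
  assumes E: "E \<subseteq> null_space S"
    and bi: "\<And>e e'. e \<in> E \<Longrightarrow> e' \<in> E \<Longrightarrow> \<phi> e e' = (if e = e' then 1 else 0)"
  shows "range B = {w + g |w g. w \<in> range S \<and> g \<in> cvec.span (b ` E)}"
proof (intro equalityI subsetI)
  fix y assume "y \<in> range B"
  then show "y \<in> {w + g |w g. w \<in> range S \<and> g \<in> cvec.span (b ` E)}"
    using F_in_span unfolding B_def by blast
next
  fix y assume "y \<in> {w + g |w g. w \<in> range S \<and> g \<in> cvec.span (b ` E)}"
  then obtain x g where y: "y = S x + g" "g \<in> cvec.span (b ` E)" by blast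
  then obtain c where c: "g = (\<Sum>e\<in>E. c e *\<^sub>C b e)" using span_image_sum[OF finE] by metis
  define x' where "x' = x + (\<Sum>e\<in>E. (c e - \<phi> e x) *\<^sub>C e)"
  have "S (\<Sum>e\<in>E. (c e - \<phi> e x) *\<^sub>C e) = (\<Sum>e\<in>E. 0)"
    unfolding clinear_sum[OF S] clinear_scale[OF S]
    by (rule sum.cong) (use E in \<open>auto simp: null_space_def\<close>)
  then have "S x' = S x" by (simp add: x'_def clinear_add[OF S])
  moreover have "\<phi> e x' = c e" if "e \<in> E" for e
    using biorthogonal_sum[OF finE \<phi> bi that, where c = "\<lambda>e. c e - \<phi> e x"] that
    by (simp add: x'_def functional_add[OF \<phi>])
  ultimately have "B x' = y" by (simp add: B_def F_def y(1) c)
  then show "y \<in> range B" by blast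
qed

text \<open>Since \<open>B - z\<close> is bijective, \<open>S - z\<close> is bijective as soon as it is injective. For \<open>z \<noteq> 0\<close> this is
  decided on the core of \<open>S\<close>, which contains all eigenvectors for nonzero eigenvalues, and on the core
  injectivity spreads from a single point \<open>w\<close> close to \<open>0\<close> to all small \<open>z\<close>.\<close>

lemma punctured_disc_bij:
  assumes r: "r > 0" and bijB: "\<And>z. norm z < r \<Longrightarrow> bij (shift B z)"
    and near: "\<And>d. d > 0 \<Longrightarrow> \<exists>w. norm w < d \<and> bij (shift S w)"
  shows "\<exists>d>0. \<forall>z. 0 < norm z \<and> norm z < d \<longrightarrow> bij (shift S z)"
proof -
  have bij0: "bij B" using bijB[of 0] r by simp
  then obtain C where C: "\<And>x. norm x \<le> C * norm (B x)"
    using injective_closed_range_imp_bounded_below[OF B_clinear] by (auto simp: bij_def)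
  define K where "K = (\<Inter>n. range (S ^^ n))"
  have "closed (range (S ^^ n))" for n
  proof (rule closed_range_power[OF S finE])
    show "bounded_functional (\<phi> e)" if "e \<in> E" for e using that by (rule \<phi>)
    show "norm x \<le> C * norm (S x)" if "\<forall>e\<in>E. \<phi> e x = 0" for x using C[of x] B_eq_S[OF that] by simp
  qed
  then have K: "cvec.subspace K" "closed K"
    unfolding K_def using csubspace_range_power[OF S] by (auto intro!: cvec.subspace_Inter)
  obtain G where G: "Vector_Spaces.linear scaleC scaleC G" "G \<circ> B = id"
    using cpair.linear_injective_left_inverse[OF clinear_linear[OF B_clinear]] bij0 by (auto simp: bij_def)
  have GB: "G (B x) = x" for x using G(2) by (metis comp_apply id_apply)
  have SK: "S ` K = K" unfolding K_def
  proof (rule image_core[OF S])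
    show "finite (G ` b ` E)" using finE by simp
    show "null_space S \<subseteq> cvec.span (G ` b ` E)"
    proof
      fix x assume "x \<in> null_space S"
      then have "x = G (F x)" using GB[of x] by (simp add: null_space_def B_def)
      also have "\<dots> \<in> cvec.span (G ` b ` E)" using F_in_span by (simp add: cpair.linear_span_image[OF G(1)])
      finally show "x \<in> cvec.span (G ` b ` E)" .
    qed
  qed
  obtain d where d: "d > 0" and spread: "\<And>w z. norm w < d \<Longrightarrow> \<forall>x\<in>K. shift S w x = 0 \<longrightarrow> x = 0 \<Longrightarrow> norm z < d \<Longrightarrow>
      \<forall>x\<in>K. shift S z x = 0 \<longrightarrow> x = 0"
    using onto_shift_injective_somewhere_imp_near[OF S K SK] by blast
  obtain w where w: "norm w < d" "inj (shift S w)" using near[OF d] by (auto simp: bij_def)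
  have w0: "\<forall>x\<in>K. shift S w x = 0 \<longrightarrow> x = 0"
    using w(2) clinear_0[OF clinear_shift[OF S]] by (metis injD)
  have "bij (shift S z)" if z: "0 < norm z" "norm z < min d r" for z
  proof -
    have "x = 0" if x: "shift S z x = 0" for x
    proof -
      have Sx: "S x = z *\<^sub>C x" using x by (simp add: shift_def)
      have "x \<in> range (S ^^ n)" for n
      proof -
        have "(S ^^ n) (inverse (z ^ n) *\<^sub>C x) = x"
          using z(1) by (simp add: clinear_scale[OF clinear_power[OF S]]
              power_eigenvector[OF S Sx] scaleC_scaleC)
        then show ?thesis by (metis rangeI)
      qed
      then have "x \<in> K" by (auto simp: K_def)
      then show ?thesis using spread[OF w(1) w0, of z] z x by auto
    qed
    then have inj: "inj (shift S z)"
      by (simp add: cpair.linear_inj_iff_eq_0[OF clinear_linear[OF clinear_shift[OF S]]])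
    have "surj (shift B z)" using bijB z(2) by (auto simp: bij_def)
    with inj show ?thesis using bij_if_inj_shift_S by blast
  qed
  then show ?thesis using d r by (intro exI[of _ "min d r"]) auto
qed

end

section \<open>Finite descent or ascent near zero\<close>

text \<open>Here \<open>B\<close> is bounded below. Finite descent \<open>n\<close> of \<open>U = S - w\<close> means that \<open>U\<close> maps the closed range
  \<open>R\<close> of \<open>U ^ n\<close> onto itself; then so does \<open>U - m\<close> for small \<open>m\<close>. For \<open>m \<noteq> 0\<close> the operator \<open>U - m\<close> is even
  onto the whole space, because \<open>U ^ n - m ^ n\<close> factors through it.\<close>

lemma punctured_disc_bij_if_descent:
  fixes S :: "'a::complex_banach \<Rightarrow> 'a"
  assumes S: "bounded_clinear S" and cl: "closed (range S)"
    and E: "finite E" "cvec.independent E" "null_space S = cvec.span E"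
    and b: "inj_on b E" "indep_mod (range S) (b ` E)"
    and near: "\<And>d. d > 0 \<Longrightarrow> \<exists>w n. norm w < d \<and> range (shift S w ^^ n) = range (shift S w ^^ Suc n)"
  shows "\<exists>d>0. \<forall>z. 0 < norm z \<and> norm z < d \<longrightarrow> bij (shift S z)"
proof -
  obtain \<phi> where \<phi>s: "\<And>e. e \<in> E \<Longrightarrow> bounded_functional (\<phi> e)"
      "\<And>e e'. e \<in> E \<Longrightarrow> e' \<in> E \<Longrightarrow> \<phi> e e' = (if e = e' then 1 else 0)"
    using biorthogonal_functionals[OF E(1,2)] by blast
  interpret finite_rank_correction S E \<phi> b by unfold_locales (use S E(1) \<phi>s(1) in auto)
  have EN: "E \<subseteq> null_space S" using E(3) cvec.span_superset by metis
  have rB: "range B = {w + g |w g. w \<in> range S \<and> g \<in> cvec.span (b ` E)}"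
    by (rule range_B[OF EN \<phi>s(2)])
  have clB: "closed (range B)" unfolding rB
    using csubspace_range_power[OF S, of 1] cl E(1) by (intro closed_plus_span) auto
  have "x = 0" if x: "B x = 0" for x
  proof -
    have "(\<Sum>y\<in>b ` E. \<phi> (inv_into E b y) x *\<^sub>C y) = F x"
      using b(1) by (simp add: sum.reindex F_def)
    also have "\<dots> = S (- x)" using x by (simp add: B_def clinear_minus[OF S] eq_neg_iff_add_eq_0 add.commute)
    finally have "(\<Sum>y\<in>b ` E. \<phi> (inv_into E b y) x *\<^sub>C y) \<in> range S" by simp
    then have "\<forall>y\<in>b ` E. \<phi> (inv_into E b y) x = 0"
      using b(2) E(1) unfolding indep_mod_def
      by (elim allE[of _ "b ` E"] allE[of _ "\<lambda>y. \<phi> (inv_into E b y) x"]) blast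
    then have \<phi>0: "\<phi> e x = 0" if "e \<in> E" for e using that b(1) by simp
    then have "S x = 0" using x by (simp add: B_def F_def)
    then have "x \<in> null_space S" by (simp add: null_space_def)
    then have "x \<in> cvec.span ((\<lambda>e. e) ` E)" using E(3) by simp
    then obtain c where c: "x = (\<Sum>e\<in>E. c e *\<^sub>C e)" by (rule span_image_sum[OF E(1)])
    have "c e = 0" if "e \<in> E" for e
      using biorthogonal_sum[OF E(1) \<phi>s that, where c = c] \<phi>0[OF that] c by simp
    then show "x = 0" by (simp add: c)
  qed
  then have "inj B" by (simp add: cpair.linear_inj_iff_eq_0[OF clinear_linear[OF B_clinear]])
  then obtain C where C: "C > 0" "\<And>x. norm x \<le> C * norm (B x)"
    using injective_closed_range_imp_bounded_below[OF B_clinear _ clB] by blast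
  have below: "norm x \<le> (2 * C) * norm (shift B z x)" if z: "norm z < 1 / (2 * C)" for z x
  proof -
    have "norm x \<le> C * norm (shift B z x + z *\<^sub>C x)" using C(2) by (simp add: shift_def)
    also have "\<dots> \<le> C * (norm (shift B z x) + norm z * norm x)"
      using C(1) by (intro mult_left_mono norm_triangle_le) (auto simp: norm_scaleC)
    also have "\<dots> = C * norm (shift B z x) + (C * norm z) * norm x" by (simp add: algebra_simps)
    also have "\<dots> \<le> C * norm (shift B z x) + (1/2) * norm x"
      using z C(1) by (intro add_left_mono mult_right_mono) (auto simp: field_simps)
    finally show ?thesis by simp
  qed
  then have injB: "inj (shift B z)" if z: "norm z < 1 / (2 * C)" for z
    unfolding cpair.linear_inj_iff_eq_0[OF shift_linear(2)]
    using below[OF z] by (metis mult_zero_right norm_le_zero_iff norm_zero)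
  have points: "\<exists>w. norm w < d \<and> bij (shift S w) \<and> bij (shift B w)" if d: "d > 0" for d
  proof -
    define r where "r = min d (1 / (2 * C))"
    have r: "r > 0" using d C(1) by (simp add: r_def)
    obtain w n where w: "norm w < r / 2" "range (shift S w ^^ n) = range (shift S w ^^ Suc n)"
      using near[of "r / 2"] r by auto
    define U where "U = shift S w"
    have U: "bounded_clinear U" unfolding U_def by (rule clinear_shift[OF S])
    define R where "R = range (U ^^ n)"
    have R: "cvec.subspace R" unfolding R_def by (rule csubspace_range_power[OF U])
    have clR: "closed R" unfolding R_def
    proof (rule closed_range_power[OF U E(1)])
      show "bounded_functional (\<phi> e)" if "e \<in> E" for e using that by (rule \<phi>s(1))
      show "norm x \<le> (2 * C) * norm (U x)" if "\<forall>e\<in>E. \<phi> e x = 0" for x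
      proof -
        have "norm w < 1 / (2 * C)" using w(1) r min.cobounded2[of d "1 / (2 * C)", folded r_def] by linarith
        from below[OF this, of x] show ?thesis using that by (simp add: U_def shift_def B_def F_def)
      qed
    qed
    have "U ` R = range (U ^^ Suc n)" by (simp add: R_def image_comp)
    then have UR: "U ` R = R" using w(2) by (simp add: R_def U_def)
    obtain d' where d': "d' > 0" "\<And>m y. norm m < d' \<Longrightarrow> y \<in> R \<Longrightarrow> \<exists>x\<in>R. shift U m x = y"
      using onto_shift_uniform[OF U R clR UR] by metis
    \<comment> \<open>Any small nonzero \<open>m\<close> would do: \<open>d'\<close> keeps \<open>U - m\<close> onto \<open>R\<close>, and \<open>r\<close> keeps \<open>B - (w + m)\<close>
      injective.\<close>
    define m where "m = complex_of_real (min (d' / 2) (r / 2))"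
    have m: "m \<noteq> 0" "norm m < d'" "norm m \<le> r / 2" using d'(1) r by (auto simp: m_def)
    obtain Q where Q: "\<And>x. (U ^^ n) x - m ^ n *\<^sub>C x = shift U m (Q x)"
      using power_minus_scalar_factor[OF U] by metis
    have "\<exists>x. y = shift U m x" for y
    proof -
      obtain x where x: "shift U m x = (U ^^ n) y" using d'(2)[OF m(2), of "(U ^^ n) y"] by (auto simp: R_def)
      have "m ^ n *\<^sub>C y = shift U m (x - Q y)"
        by (simp add: clinear_diff[OF clinear_shift[OF U]] x flip: Q)
      then have "y = shift U m (inverse (m ^ n) *\<^sub>C (x - Q y))"
        using m(1) by (simp add: clinear_scale[OF clinear_shift[OF U]] scaleC_scaleC
            flip: \<open>m ^ n *\<^sub>C y = shift U m (x - Q y)\<close>)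
      then show ?thesis by blast
    qed
    then have surjS: "surj (shift S (w + m))" by (auto simp: U_def shift_shift surj_def)
    have wm: "norm (w + m) < r" using norm_triangle_ineq[of w m] w(1) m(3) by linarith
    then have injB': "inj (shift B (w + m))" by (intro injB) (simp add: r_def)
    from bij_if_surj_shift_S[OF surjS injB'] show ?thesis using wm by (intro exI[of _ "w + m"]) (simp add: r_def)
  qed
  define r where "r = 1 / (8 * C)"
  have r: "r > 0" using C(1) by (simp add: r_def)
  obtain w where w: "norm w < r" "bij (shift B w)" using points[OF r] by blast
  have small: "norm z < 1 / (2 * C)" if "norm z < r" for z :: complex
  proof -
    have "r \<le> 1 / (2 * C)" using C(1) by (simp add: r_def field_simps)
    then show ?thesis using that by simp
  qed
  have bijB: "bij (shift B z)" if z: "norm z < r" for z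
  proof -
    have "\<exists>x. y = shift B z x" for y
    proof -
      have "\<exists>x\<in>UNIV. shift B w x + (w - z) *\<^sub>C x = y \<and> norm x \<le> 2 * (2 * C) * norm y"
      proof (rule surjective_perturbation[where V = UNIV and \<epsilon> = "norm (w - z)"])
        show "bounded_linear (shift B w)"
          by (intro clinear_imp_bounded_linear clinear_shift B_clinear)
        show "bounded_linear (\<lambda>x::'a. (w - z) *\<^sub>C x)"
          by (intro clinear_imp_bounded_linear clinear_scaleC clinear_id)
        show "\<exists>x\<in>UNIV. shift B w x = u \<and> norm x \<le> 2 * C * norm u" for u
        proof -
          obtain x where "shift B w x = u" using w(2) by (metis bij_pointE)
          then show ?thesis using below[OF small[OF w(1)], of x] by blast
        qed
        have "norm (w - z) < 2 * r" using w(1) z norm_triangle_ineq4[of w z] by linarith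
        then have "2 * C * norm (w - z) \<le> 2 * C * (2 * r)" using C(1) by (intro mult_left_mono) auto
        also have "\<dots> \<le> 1 / 2" using C(1) by (simp add: r_def)
        finally show "2 * C * norm (w - z) \<le> 1 / 2" .
      qed (use C(1) in \<open>auto simp: norm_scaleC\<close>)
      then show ?thesis by (auto simp: shift_def cvec.scale_left_diff_distrib)
    qed
    then show ?thesis using injB[OF small[OF z]] by (auto simp: bij_def surj_def)
  qed
  show ?thesis
    by (rule punctured_disc_bij[OF r bijB]) (use points in blast)+
qed

text \<open>Here \<open>B\<close> is onto. If \<open>U = S - w\<close> has ascent at most \<open>n\<close> and \<open>U ^ (n + 1)\<close> has closed range, then \<open>U\<close> is
  bounded below on the range of \<open>U ^ n\<close>. An eigenvector of \<open>U\<close> for \<open>m \<noteq> 0\<close> belongs to that range, so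
  \<open>U - m\<close> is injective for small \<open>m \<noteq> 0\<close>.\<close>

lemma punctured_disc_bij_if_ascent:
  fixes S :: "'a::complex_banach \<Rightarrow> 'a"
  assumes S: "bounded_clinear S"
    and E: "finite E" "cvec.independent E" "E \<subseteq> null_space S"
    and b: "{w + g |w g. w \<in> range S \<and> g \<in> cvec.span (b ` E)} = UNIV"
    and near: "\<And>d. d > 0 \<Longrightarrow> \<exists>w n. norm w < d \<and>
      null_space (shift S w ^^ n) = null_space (shift S w ^^ Suc n) \<and> closed (range (shift S w ^^ Suc n))"
  shows "\<exists>d>0. \<forall>z. 0 < norm z \<and> norm z < d \<longrightarrow> bij (shift S z)"
proof -
  obtain \<phi> where \<phi>s: "\<And>e. e \<in> E \<Longrightarrow> bounded_functional (\<phi> e)"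
      "\<And>e e'. e \<in> E \<Longrightarrow> e' \<in> E \<Longrightarrow> \<phi> e e' = (if e = e' then 1 else 0)"
    using biorthogonal_functionals[OF E(1,2)] by blast
  interpret finite_rank_correction S E \<phi> b by unfold_locales (use S E(1) \<phi>s(1) in auto)
  have "range B = {w + g |w g. w \<in> range S \<and> g \<in> cvec.span (b ` E)}"
    by (rule range_B[OF E(3) \<phi>s(2)])
  then have surjB: "B ` UNIV = UNIV" using b by simp
  obtain r where r: "r > 0" and spread: "\<And>m w. norm m < r \<Longrightarrow> inj (shift B m) \<Longrightarrow> norm w < r \<Longrightarrow> bij (shift B w)"
  proof -
    obtain r where r: "r > 0" and spread: "\<forall>m. norm m < r \<longrightarrow> (\<forall>x\<in>UNIV. shift B m x = 0 \<longrightarrow> x = 0) \<longrightarrow>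
        (\<forall>w. norm w < r \<longrightarrow>
          (\<forall>y\<in>UNIV. \<exists>x\<in>UNIV. shift B w x = y) \<and> (\<forall>x\<in>UNIV. shift B w x = 0 \<longrightarrow> x = 0))"
      using onto_shift_injective_somewhere_imp_near[OF B_clinear cvec.subspace_UNIV closed_UNIV surjB] by (elim exE conjE)
    have "bij (shift B w)" if m: "norm m < r" "inj (shift B m)" and w: "norm w < r" for m w
    proof -
      have "\<forall>x\<in>UNIV. shift B m x = 0 \<longrightarrow> x = 0"
        using m(2) unfolding cpair.linear_inj_iff_eq_0[OF shift_linear(2)] by simp
      from spread[THEN spec, THEN mp, OF m(1), THEN mp, OF this, THEN spec, THEN mp, OF w]
      have "inj (shift B w)" and "\<forall>y. \<exists>x. shift B w x = y"
        unfolding cpair.linear_inj_iff_eq_0[OF shift_linear(2)] by simp_all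
      then show ?thesis unfolding bij_def surj_def by metis
    qed
    with r show ?thesis by (rule that)
  qed
  obtain d0 where d0: "d0 > 0" "\<And>w. norm w < d0 \<Longrightarrow> surj (shift B w)"
  proof -
    obtain d where "d > 0" and d: "\<And>m y. norm m < d \<Longrightarrow> \<exists>x. shift B m x = y"
      using onto_shift_uniform[OF B_clinear cvec.subspace_UNIV closed_UNIV surjB] by (meson UNIV_I)
    have "surj (shift B w)" if "norm w < d" for w using d[OF that] by (metis surj_def)
    with \<open>d > 0\<close> show ?thesis by (rule that)
  qed
  have points: "\<exists>w. norm w < d \<and> bij (shift S w) \<and> bij (shift B w)" if d: "d > 0" for d
  proof -
    define e where "e = min d d0"
    have e: "e > 0" using d d0(1) by (simp add: e_def)
    obtain w n where w: "norm w < e / 2" "null_space (shift S w ^^ n) = null_space (shift S w ^^ Suc n)"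
        "closed (range (shift S w ^^ Suc n))"
      using near[of "e / 2"] e by auto
    define U where "U = shift S w"
    have U: "bounded_clinear U" unfolding U_def by (rule clinear_shift[OF S])
    have Un: "bounded_clinear (U ^^ k)" for k by (rule clinear_power[OF U])
    have "\<exists>C>0. \<forall>y\<in>range (U ^^ Suc n). \<exists>x\<in>UNIV. (U ^^ Suc n) x = y \<and> norm x \<le> C * norm y"
      using csubspace_range_power[OF U, of "Suc n"] w(3) unfolding U_def[symmetric]
      by (intro open_mapping clinear_imp_bounded_linear Un csubspace_imp_subspace cvec.subspace_UNIV) auto
    then obtain C where C: "C > 0" "\<And>x. \<exists>x'. (U ^^ Suc n) x' = (U ^^ Suc n) x \<and> norm x' \<le> C * norm ((U ^^ Suc n) x)"
      by (metis rangeI)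
    obtain K where K: "K > 0" "\<And>x. norm ((U ^^ n) x) \<le> K * norm x"
      using clinear_bounded[OF Un] by blast
    \<comment> \<open>The preimage \<open>x'\<close> of \<open>U ^ (n + 1) x\<close> with a norm bound has the same image under \<open>U ^ n\<close> as \<open>x\<close>,
      because the null spaces of \<open>U ^ n\<close> and \<open>U ^ (n + 1)\<close> agree.\<close>
    have below: "norm ((U ^^ n) x) \<le> (K * C) * norm ((U ^^ Suc n) x)" for x
    proof -
      obtain x' where x': "(U ^^ Suc n) x' = (U ^^ Suc n) x" "norm x' \<le> C * norm ((U ^^ Suc n) x)"
        using C(2) by blast
      have "x - x' \<in> null_space (U ^^ Suc n)"
        unfolding null_space_def mem_Collect_eq clinear_diff[OF Un] x'(1) by simp
      then have "x - x' \<in> null_space (U ^^ n)" using w(2) by (simp only: U_def)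
      then have "(U ^^ n) x = (U ^^ n) x'"
        by (simp add: null_space_def clinear_diff[OF Un])
      then have "norm ((U ^^ n) x) \<le> K * norm x'" using K(2) by simp
      also have "\<dots> \<le> K * (C * norm ((U ^^ Suc n) x))" using x'(2) K(1) by (intro mult_left_mono) auto
      finally show ?thesis by (simp add: mult.assoc)
    qed
    define m where "m = complex_of_real (min (1 / (2 * (K * C))) (e / 2))"
    have KC: "K * C > 0" using K(1) C(1) by simp
    have m: "m \<noteq> 0" "K * C * norm m < 1" "norm m \<le> e / 2"
    proof -
      have t: "0 < min (1 / (2 * (K * C))) (e / 2)"
        using divide_pos_pos[OF zero_less_one, of "2 * (K * C)"] KC e by simp
      then have nm: "norm m = min (1 / (2 * (K * C))) (e / 2)" by (simp only: m_def norm_of_real abs_of_pos)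
      show "m \<noteq> 0" using nm t by (metis norm_zero less_irrefl)
      show "norm m \<le> e / 2" unfolding nm by simp
      have "K * C * norm m \<le> K * C * (1 / (2 * (K * C)))"
        unfolding nm using KC by (intro mult_left_mono) auto
      also have "\<dots> = 1 / 2" using K(1) C(1) by simp
      finally show "K * C * norm m < 1" by simp
    qed
    have "x = 0" if x: "shift U m x = 0" for x
    proof -
      have Ux: "U x = m *\<^sub>C x" using x by (simp add: shift_def)
      note pw = power_eigenvector[OF U Ux]
      have "norm ((U ^^ n) x) \<le> (K * C * norm m) * norm ((U ^^ n) x)"
        using below[of x] by (simp add: pw norm_scaleC norm_mult mult.assoc del: funpow.simps)
      then have "(U ^^ n) x = 0" using m(2)
        by (metis linorder_not_less mult_less_cancel_right2 norm_le_zero_iff)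
      then show "x = 0" using m(1) by (simp add: pw)
    qed
    then have injS: "inj (shift S (w + m))"
      unfolding cpair.linear_inj_iff_eq_0[OF shift_linear(1)]
      by (simp add: U_def shift_shift)
    have wm: "norm (w + m) < e" using norm_triangle_ineq[of w m] w(1) m(3) by linarith
    then have surjB': "surj (shift B (w + m))" by (intro d0) (simp add: e_def)
    from bij_if_inj_shift_S[OF injS surjB'] show ?thesis using wm by (intro exI[of _ "w + m"]) (simp add: e_def)
  qed
  obtain w where w: "norm w < r" "inj (shift B w)" using points[OF r] by (auto simp: bij_def)
  show ?thesis
    by (rule punctured_disc_bij[OF r spread[OF w]]) (use points in blast)+
qed

section \<open>The Riesz projection at an isolated spectral point\<close>

lemma bij_imp_bounded_clinear_inv:
  fixes A :: "'a::complex_banach \<Rightarrow> 'a"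
  assumes A: "bounded_clinear A" and bij: "bij A"
  shows "bounded_clinear (inv A)"
proof -
  obtain C where C: "\<And>x. norm x \<le> C * norm (A x)"
    using injective_closed_range_imp_bounded_below[OF A] bij by (auto simp: bij_def)
  have A_inv: "A (inv A x) = x" and inv_A: "inv A (A x) = x" for x
    using bij by (simp_all add: bij_is_surj surj_f_inv_f bij_is_inj)
  show ?thesis
  proof (rule bounded_clinearI)
    show "inv A (x + y) = inv A x + inv A y" for x y
      by (metis A_inv inv_A clinear_add[OF A])
    show "inv A (c *\<^sub>C x) = c *\<^sub>C inv A x" for c x
      by (metis A_inv inv_A clinear_scale[OF A])
    show "norm (inv A x) \<le> C * norm x" for x using C[of "inv A x"] by (simp add: A_inv)
  qed
qed

lemma spectrum_iff_not_bij:
  fixes T :: "'a::complex_banach \<Rightarrow> 'a"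
  assumes T: "bounded_clinear T"
  shows "z \<in> spectrum T \<longleftrightarrow> \<not> bij (shift T z)"
proof -
  have "\<exists>S. bounded_clinear S \<and> S \<circ> shift T z = id \<and> shift T z \<circ> S = id" if "bij (shift T z)"
  proof (intro exI conjI)
    show "bounded_clinear (inv (shift T z))"
      using bij_imp_bounded_clinear_inv[OF clinear_shift[OF T] that] .
    show "inv (shift T z) \<circ> shift T z = id" using that by (simp add: bij_is_inj)
    show "shift T z \<circ> inv (shift T z) = id" using that by (metis bij_is_surj surj_iff)
  qed
  moreover have "bij (shift T z)" if "S \<circ> shift T z = id" "shift T z \<circ> S = id" for S
    using that by (rule o_bij)
  ultimately show ?thesis by (auto simp: spectrum_def)
qed

lemma cmod_cis_diff_le: "cmod (cis s - cis t) \<le> \<bar>s - t\<bar>"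
proof -
  have "cis s - cis t = cis ((s + t) / 2) * (2 * \<i> * sin ((s - t) / 2))"
  proof -
    have "s = (s + t) / 2 + (s - t) / 2" "t = (s + t) / 2 - (s - t) / 2" by (simp_all add: field_simps)
    then have "cis s = cis ((s + t) / 2) * cis ((s - t) / 2)" "cis t = cis ((s + t) / 2) * cis (- ((s - t) / 2))"
      by (metis cis_mult, metis cis_mult diff_conv_add_uminus)
    then show ?thesis by (simp add: complex_eq_iff algebra_simps)
  qed
  then have "cmod (cis s - cis t) = 2 * \<bar>sin ((s - t) / 2)\<bar>" by (simp add: norm_mult)
  also have "\<dots> \<le> 2 * \<bar>(s - t) / 2\<bar>" by (intro mult_left_mono abs_sin_x_le_abs_x) auto
  finally show ?thesis by simp
qed

lemma sum_roots_of_unity_powers: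
  assumes "0 < i" "i < n"
  shows "(\<Sum>k<n. cis (2 * pi * real k / real n) ^ i) = 0"
proof -
  define w where "w = cis (2 * pi * real i / real n)"
  have w: "w = exp (2 * of_real pi * \<i> * of_nat i / of_nat n)"
    by (simp add: w_def cis_conv_exp mult.commute mult.left_commute)
  have "w \<noteq> 1" unfolding w using assms by (subst complex_root_unity_eq_1) (auto dest: dvd_imp_le)
  moreover have "w ^ n = 1"
    unfolding w using complex_root_unity[of n i] assms by auto
  moreover have "cis (2 * pi * real k / real n) ^ i = w ^ k" for k
    by (simp add: w_def Complex.DeMoivre mult.commute mult.left_commute)
  ultimately show ?thesis by (simp add: geometric_sum)
qed

text \<open>The factorization of \<open>T ^ n - z ^ n\<close>, multiplied by \<open>z\<close> so that the averages over roots of unity below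
  involve only the powers \<open>z ^ i\<close> with \<open>0 < i \<le> n\<close>.\<close>

lemma power_minus_scalar_sum:
  assumes T: "bounded_clinear T"
  shows "shift T z (\<Sum>j<n. z ^ (n - j) *\<^sub>C (T ^^ j) x) = z *\<^sub>C ((T ^^ n) x - z ^ n *\<^sub>C x)"
proof (induction n)
  case 0
  then show ?case by (simp add: clinear_0[OF clinear_shift[OF T]])
next
  case (Suc n)
  have "(\<Sum>j<Suc n. z ^ (Suc n - j) *\<^sub>C (T ^^ j) x) =
      z *\<^sub>C (\<Sum>j<n. z ^ (n - j) *\<^sub>C (T ^^ j) x) + z *\<^sub>C (T ^^ n) x"
    by (auto simp: cvec.scale_sum_right scaleC_scaleC Suc_diff_le intro!: sum.cong)
  then have "shift T z (\<Sum>j<Suc n. z ^ (Suc n - j) *\<^sub>C (T ^^ j) x) =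
      z *\<^sub>C (z *\<^sub>C ((T ^^ n) x - z ^ n *\<^sub>C x)) + z *\<^sub>C shift T z ((T ^^ n) x)"
    using Suc by (simp add: clinear_add[OF clinear_shift[OF T]]
        clinear_scale[OF clinear_shift[OF T]])
  also have "\<dots> = z *\<^sub>C ((T ^^ Suc n) x - z ^ Suc n *\<^sub>C x)"
    by (simp add: shift_def cvec.scale_right_diff_distrib scaleC_scaleC mult.assoc)
  finally show ?case .
qed

text \<open>The point \<open>0\<close> may also lie outside the spectrum; the Riesz projection is then zero.\<close>

locale isolated_spectral_point =
  fixes T :: "'a::complex_banach \<Rightarrow> 'a" and \<rho> :: real
  assumes T: "bounded_clinear T" and \<rho>: "\<rho> > 0"
    and bij_shift: "\<And>z. 0 < norm z \<Longrightarrow> norm z < \<rho> \<Longrightarrow> bij (shift T z)"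
begin

definition resolvent :: "complex \<Rightarrow> 'a \<Rightarrow> 'a" where "resolvent z = inv (shift T z)"

text \<open>This is \<open>z (z - T)\<^sup>-\<^sup>1 = (I - T / z)\<^sup>-\<^sup>1\<close>; the sign is due to \<open>shift T z = T - z\<close>.\<close>

definition scaled_res :: "complex \<Rightarrow> 'a \<Rightarrow> 'a" where "scaled_res z x = - (z *\<^sub>C resolvent z x)"

text \<open>A Riemann sum for the contour integral of the resolvent over the circle of radius \<open>r\<close>.\<close>

definition mean :: "real \<Rightarrow> nat \<Rightarrow> 'a \<Rightarrow> 'a" where
  "mean r n x = (1 / real n) *\<^sub>R (\<Sum>k<n. scaled_res (of_real r * cis (2 * pi * real k / real n)) x)"

text \<open>The Riesz projection. The index \<open>Suc n\<close> skips the empty mean.\<close>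

definition proj :: "real \<Rightarrow> 'a \<Rightarrow> 'a" where "proj r x = lim (\<lambda>n. mean r (Suc n) x)"

definition disc :: "complex set" where "disc = {z. 0 < norm z \<and> norm z < \<rho>}"

lemma resolvent: assumes "z \<in> disc"
  shows "bounded_clinear (resolvent z)" "resolvent z (shift T z x) = x" "shift T z (resolvent z x) = x"
  using bij_shift[of z] assms bij_imp_bounded_clinear_inv[OF clinear_shift[OF T], of z]
  by (auto simp: disc_def resolvent_def bij_is_surj surj_f_inv_f bij_is_inj)

lemma Res_commute:
  assumes A: "bounded_clinear A" "\<And>x. A (T x) = T (A x)" and z: "z \<in> disc"
  shows "A (resolvent z x) = resolvent z (A x)"
proof -
  have "shift T z (A (resolvent z x)) = A (shift T z (resolvent z x))"
    by (simp add: shift_def A(2) clinear_diff[OF A(1)] clinear_scale[OF A(1)])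
  then show ?thesis by (metis resolvent(2,3) z)
qed

lemma T_Res: "z \<in> disc \<Longrightarrow> T (resolvent z x) = resolvent z (T x)"
  by (rule Res_commute[OF T]) auto

lemma resolvent_identity:
  assumes z: "z \<in> disc" and w: "w \<in> disc"
  shows "resolvent z x - resolvent w x = (z - w) *\<^sub>C resolvent w (resolvent z x)"
proof -
  let ?y = "resolvent z x"
  have "shift T w ?y = x + (z - w) *\<^sub>C ?y"
    using resolvent(3)[OF z, of x] by (simp add: shift_def cvec.scale_left_diff_distrib algebra_simps)
  then have "resolvent w (shift T w ?y) = resolvent w (x + (z - w) *\<^sub>C ?y)" by simp
  then have "?y = resolvent w x + (z - w) *\<^sub>C resolvent w ?y"
    using resolvent(2)[OF w, of ?y] by (simp add: clinear_add[OF resolvent(1)[OF w]] clinear_scale[OF resolvent(1)[OF w]])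
  then show ?thesis by (simp add: algebra_simps)
qed

lemma F_clinear: "z \<in> disc \<Longrightarrow> bounded_clinear (scaled_res z)"
proof -
  assume "z \<in> disc"
  then have "bounded_clinear (\<lambda>x. (- z) *\<^sub>C resolvent z x)" by (intro clinear_scaleC resolvent)
  then show ?thesis by (simp add: scaled_res_def[abs_def])
qed

text \<open>In the resolvent identity \<open>R(z) = R(w) + (z - w) R(w) R(z)\<close> the last term is at most half of \<open>R(z)\<close>
  for \<open>z\<close> close to \<open>w\<close>.\<close>

lemma Res_bounded_near:
  assumes w: "w \<in> disc"
  shows "\<exists>C d. d > 0 \<and> (\<forall>z\<in>disc. norm (z - w) < d \<longrightarrow> (\<forall>x. norm (resolvent z x) \<le> C * norm x))"
proof -
  obtain K where K: "K > 0" "\<And>x. norm (resolvent w x) \<le> K * norm x"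
    using clinear_bounded[OF resolvent(1)[OF w]] by blast
  have "norm (resolvent z x) \<le> (2 * K) * norm x" if z: "z \<in> disc" "norm (z - w) < 1 / (2 * K)" for z x
  proof -
    have "resolvent z x = resolvent w x + (z - w) *\<^sub>C resolvent w (resolvent z x)"
      using resolvent_identity[OF z(1) w, of x] by (simp add: algebra_simps)
    then have "norm (resolvent z x) \<le> norm (resolvent w x) + norm (z - w) * norm (resolvent w (resolvent z x))"
      by (metis norm_scaleC norm_triangle_ineq)
    also have "\<dots> \<le> K * norm x + (1 / (2 * K)) * (K * norm (resolvent z x))"
      using z(2) K by (intro add_mono mult_mono) auto
    also have "\<dots> = K * norm x + norm (resolvent z x) / 2" using K(1) by simp
    finally show ?thesis by simp
  qed
  then show ?thesis using K(1) by (intro exI[of _ "2 * K"] exI[of _ "1 / (2 * K)"]) auto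
qed

lemma Res_bounded:
  assumes a: "0 < a" "b < \<rho>"
  shows "\<exists>C>0. \<forall>z. a \<le> norm z \<and> norm z \<le> b \<longrightarrow> (\<forall>x. norm (resolvent z x) \<le> C * norm x)"
proof -
  define K :: "complex set" where "K = cball 0 b - ball 0 a"
  have "compact K" unfolding K_def by (intro compact_diff) auto
  have K: "z \<in> K \<longleftrightarrow> a \<le> norm z \<and> norm z \<le> b" for z by (auto simp: K_def dist_norm)
  have Kann: "K \<subseteq> disc" using a by (auto simp: K disc_def)
  obtain C d where Cd: "\<And>w. w \<in> disc \<Longrightarrow> d w > 0"
    "\<And>w z x. w \<in> disc \<Longrightarrow> z \<in> disc \<Longrightarrow> norm (z - w) < d w \<Longrightarrow> norm (resolvent z x) \<le> C w * norm x"
    using Res_bounded_near by metis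
  have "K \<subseteq> (\<Union>w\<in>K. ball w (d w))"
  proof
    fix w assume "w \<in> K"
    then show "w \<in> (\<Union>w\<in>K. ball w (d w))" using Kann Cd(1)[of w] by (intro UN_I[of w]) auto
  qed
  then obtain D where D: "D \<subseteq> K" "finite D" "K \<subseteq> (\<Union>w\<in>D. ball w (d w))"
    using compactE_image[OF \<open>compact K\<close>, of K "\<lambda>w. ball w (d w)"] by auto
  define M where "M = (\<Sum>w\<in>D. \<bar>C w\<bar>) + 1"
  have "norm (resolvent z x) \<le> M * norm x" if z: "z \<in> K" for z x
  proof -
    obtain w where w: "w \<in> D" "norm (z - w) < d w" using D(3) z by (auto simp: dist_norm norm_minus_commute)
    have "norm (resolvent z x) \<le> C w * norm x" using Cd(2)[of w z x] w D(1) Kann z by auto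
    also have "C w \<le> M"
      using member_le_sum[OF w(1), of "\<lambda>w. \<bar>C w\<bar>"] D(2) unfolding M_def by fastforce
    then have "C w * norm x \<le> M * norm x" by (rule mult_right_mono) simp
    finally show ?thesis .
  qed
  moreover have "M > 0" unfolding M_def by (intro add_nonneg_pos sum_nonneg) auto
  ultimately show ?thesis using K by blast
qed

lemma F_bounds:
  assumes a: "0 < a" "b < \<rho>"
  obtains C L where "C > 0" "L > 0"
    "\<And>z x. a \<le> norm z \<Longrightarrow> norm z \<le> b \<Longrightarrow> norm (scaled_res z x) \<le> C * norm x"
    "\<And>z w x. a \<le> norm z \<Longrightarrow> norm z \<le> b \<Longrightarrow> a \<le> norm w \<Longrightarrow> norm w \<le> b \<Longrightarrow>
      norm (scaled_res z x - scaled_res w x) \<le> L * norm (z - w) * norm x"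
proof -
  obtain C where C: "C > 0" "\<And>z x. a \<le> norm z \<Longrightarrow> norm z \<le> b \<Longrightarrow> norm (resolvent z x) \<le> C * norm x"
    using Res_bounded[OF a] by blast
  have disc: "z \<in> disc" if "a \<le> norm z" "norm z \<le> b" for z using that a by (auto simp: disc_def)
  have 1: "norm (scaled_res z x) \<le> \<rho> * C * norm x" if z: "a \<le> norm z" "norm z \<le> b" for z x
  proof -
    have "norm (scaled_res z x) = norm z * norm (resolvent z x)" by (simp add: scaled_res_def norm_scaleC)
    also have "\<dots> \<le> \<rho> * (C * norm x)" using z a C by (intro mult_mono) auto
    finally show ?thesis by (simp add: mult.assoc)
  qed
  have 2: "norm (scaled_res z x - scaled_res w x) \<le> (C + \<rho> * C * C) * norm (z - w) * norm x"
    if z: "a \<le> norm z" "norm z \<le> b" and w: "a \<le> norm w" "norm w \<le> b" for z w x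
  proof -
    have "scaled_res w x - scaled_res z x = (z - w) *\<^sub>C resolvent z x + w *\<^sub>C (resolvent z x - resolvent w x)"
      by (simp add: scaled_res_def cvec.scale_left_diff_distrib cvec.scale_right_diff_distrib)
    also have "\<dots> = (z - w) *\<^sub>C resolvent z x + w *\<^sub>C (z - w) *\<^sub>C resolvent w (resolvent z x)"
      using resolvent_identity[OF disc[OF z] disc[OF w]] by simp
    finally have "norm (scaled_res w x - scaled_res z x) \<le> norm (z - w) * norm (resolvent z x) + norm w * (norm (z - w) * norm (resolvent w (resolvent z x)))"
      by (metis norm_scaleC norm_triangle_ineq)
    also have "\<dots> \<le> norm (z - w) * (C * norm x) + \<rho> * (norm (z - w) * (C * (C * norm x)))"
    proof (intro add_mono mult_mono mult_left_mono)
      show "norm (resolvent w (resolvent z x)) \<le> C * (C * norm x)"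
        using C(2)[OF w, of "resolvent z x"] mult_left_mono[OF C(2)[OF z, of x] less_imp_le[OF C(1)]] by (rule order_trans)
    qed (use C z w a \<rho> in auto)
    finally show ?thesis by (simp add: norm_minus_commute algebra_simps)
  qed
  show ?thesis
    by (rule that[OF _ _ 1 2]) (use C(1) \<rho> in \<open>auto intro: add_pos_pos\<close>)
qed

lemma F_commute: "z \<in> disc \<Longrightarrow> w \<in> disc \<Longrightarrow> scaled_res z (scaled_res w x) = scaled_res w (scaled_res z x)"
  and T_F: "z \<in> disc \<Longrightarrow> T (scaled_res z x) = scaled_res z (T x)"
  and F_scale: "z \<in> disc \<Longrightarrow> scaled_res z (c *\<^sub>C x) = c *\<^sub>C scaled_res z x"
proof -
  show TF: "z \<in> disc \<Longrightarrow> T (scaled_res z x) = scaled_res z (T x)" for z x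
    by (simp add: scaled_res_def clinear_minus[OF T] clinear_scale[OF T] T_Res)
  show "z \<in> disc \<Longrightarrow> scaled_res z (c *\<^sub>C x) = c *\<^sub>C scaled_res z x" by (rule clinear_scale[OF F_clinear])
  assume z: "z \<in> disc" and w: "w \<in> disc"
  have "scaled_res z (resolvent w x) = resolvent w (scaled_res z x)"
    by (rule Res_commute[OF F_clinear[OF z] _ w]) (simp add: TF z)
  then show "scaled_res z (scaled_res w x) = scaled_res w (scaled_res z x)"
    by (simp add: scaled_res_def[of w] clinear_minus[OF F_clinear[OF z]] clinear_scale[OF F_clinear[OF z]])
qed

lemma circle_ann: "0 < r \<Longrightarrow> r < \<rho> \<Longrightarrow> of_real r * cis t \<in> disc"
  by (simp add: disc_def norm_mult)

lemma mean_clinear: "0 < r \<Longrightarrow> r < \<rho> \<Longrightarrow> bounded_clinear (mean r n)"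
proof -
  assume r: "0 < r" "r < \<rho>"
  have "bounded_clinear (\<lambda>x. of_real (1 / real n) *\<^sub>C (\<Sum>k<n. scaled_res (of_real r * cis (2 * pi * real k / real n)) x))"
    by (intro clinear_scaleC clinear_sum_op F_clinear circle_ann r)
  then show ?thesis unfolding scaleC_of_real by (simp add: mean_def[abs_def])
qed

lemma commute_mean:
  assumes r: "0 < r" "r < \<rho>" and A: "bounded_clinear A" "\<And>x z. z \<in> disc \<Longrightarrow> A (scaled_res z x) = scaled_res z (A x)"
  shows "A (mean r n x) = mean r n (A x)"
proof -
  have "A (of_real (1 / real n) *\<^sub>C (\<Sum>k<n. scaled_res (of_real r * cis (2 * pi * real k / real n)) x)) =
     of_real (1 / real n) *\<^sub>C (\<Sum>k<n. scaled_res (of_real r * cis (2 * pi * real k / real n)) (A x))"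
    by (simp add: clinear_scale[OF A(1)] clinear_sum[OF A(1)] A(2) circle_ann[OF r] del: of_real_divide)
  then show ?thesis unfolding scaleC_of_real by (simp add: mean_def)
qed

lemma T_mean: "0 < r \<Longrightarrow> r < \<rho> \<Longrightarrow> T (mean r n x) = mean r n (T x)"
  by (rule commute_mean) (auto simp: T T_F)

lemma Tpow_mean: "0 < r \<Longrightarrow> r < \<rho> \<Longrightarrow> (T ^^ k) (mean r n x) = mean r n ((T ^^ k) x)"
  by (induction k) (auto simp: T_mean)

lemma mean_commute:
  assumes "0 < r" "r < \<rho>" "0 < s" "s < \<rho>"
  shows "mean r n (mean s m x) = mean s m (mean r n x)"
proof -
  have "scaled_res z (mean r n x) = mean r n (scaled_res z x)" if "z \<in> disc" for z x
    by (rule commute_mean) (use assms that in \<open>auto simp: F_clinear F_commute\<close>)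
  then show ?thesis using assms by (intro commute_mean) (auto simp: mean_clinear)
qed

lemma norm_average_le:
  assumes n: "n > 0" and le: "\<And>k. k < n \<Longrightarrow> norm (h k) \<le> B"
  shows "norm ((1 / real n) *\<^sub>R (\<Sum>k<n. h k)) \<le> B"
proof -
  have "norm (\<Sum>k<n. h k) \<le> real n * B"
    using sum_norm_le[of "{..<n}" h "\<lambda>_. B"] le by simp
  then show ?thesis using n by (simp add: field_simps)
qed

text \<open>The last estimate compares the Riemann sums for \<open>n\<close> and \<open>n m\<close> points. It shows that the means
  form a Cauchy sequence, since \<open>n\<close> and \<open>m\<close> have the common refinement \<open>n m\<close>.\<close>

lemma mean_bounds:
  assumes a: "0 < a" "b < \<rho>"
  obtains C L where "C > 0" "L > 0"
    "\<And>r n x. a \<le> r \<Longrightarrow> r \<le> b \<Longrightarrow> n > 0 \<Longrightarrow> norm (mean r n x) \<le> C * norm x"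
    "\<And>r s n x. a \<le> r \<Longrightarrow> r \<le> b \<Longrightarrow> a \<le> s \<Longrightarrow> s \<le> b \<Longrightarrow> n > 0 \<Longrightarrow>
      norm (mean r n x - mean s n x) \<le> L * \<bar>r - s\<bar> * norm x"
    "\<And>r n m x. a \<le> r \<Longrightarrow> r \<le> b \<Longrightarrow> n > 0 \<Longrightarrow> m > 0 \<Longrightarrow>
      norm (mean r (n * m) x - mean r n x) \<le> L / real n * norm x"
proof -
  obtain C L where CL: "C > 0" "L > 0"
    "\<And>z x. a \<le> norm z \<Longrightarrow> norm z \<le> b \<Longrightarrow> norm (scaled_res z x) \<le> C * norm x"
    "\<And>z w x. a \<le> norm z \<Longrightarrow> norm z \<le> b \<Longrightarrow> a \<le> norm w \<Longrightarrow> norm w \<le> b \<Longrightarrow>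
      norm (scaled_res z x - scaled_res w x) \<le> L * norm (z - w) * norm x"
    using F_bounds[OF a] by metis
  \<comment> \<open>One constant for all estimates: \<open>L\<close> suffices for moving the radius, and \<open>2 pi \<rho> L\<close> for moving along
    the circle.\<close>
  define L' where "L' = L * (1 + 2 * pi * \<rho>)"
  have L': "L \<le> L'" "L * (2 * pi * \<rho>) \<le> L'" "L' > 0"
  proof -
    have "2 * pi * \<rho> > 0" using \<rho> by simp
    then show "L \<le> L'" "L * (2 * pi * \<rho>) \<le> L'" "L' > 0"
      using CL(2) by (auto simp: L'_def algebra_simps intro: add_pos_pos)
  qed
  have 1: "norm (mean r n x) \<le> C * norm x" if "a \<le> r" "r \<le> b" "n > 0" for r n x
    unfolding mean_def by (rule norm_average_le) (use that CL(3) a in \<open>auto simp: norm_mult\<close>)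
  have 2: "norm (mean r n x - mean s n x) \<le> L' * \<bar>r - s\<bar> * norm x"
    if rs: "a \<le> r" "r \<le> b" "a \<le> s" "s \<le> b" "n > 0" for r s n x
  proof -
    let ?z = "\<lambda>r k. of_real r * cis (2 * pi * real k / real n)"
    have "mean r n x - mean s n x = (1 / real n) *\<^sub>R (\<Sum>k<n. scaled_res (?z r k) x - scaled_res (?z s k) x)"
      by (simp add: mean_def sum_subtractf scaleR_diff_right)
    also have "norm \<dots> \<le> L * \<bar>r - s\<bar> * norm x"
    proof (rule norm_average_le[OF rs(5)])
      fix k
      have "norm (?z r k - ?z s k) = \<bar>r - s\<bar>"
        by (simp add: norm_mult flip: left_diff_distrib of_real_diff)
      then show "norm (scaled_res (?z r k) x - scaled_res (?z s k) x) \<le> L * \<bar>r - s\<bar> * norm x"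
        using CL(4)[of "?z r k" "?z s k" x] rs a by (simp add: norm_mult)
    qed
    also have "\<dots> \<le> L' * \<bar>r - s\<bar> * norm x" using L' by (intro mult_right_mono) auto
    finally show ?thesis .
  qed
  have 3: "norm (mean r (n * m) x - mean r n x) \<le> L' / real n * norm x"
    if r: "a \<le> r" "r \<le> b" and nm: "n > 0" "m > 0" for r n m x
  proof -
    let ?z = "\<lambda>n k. of_real r * cis (2 * pi * real k / real n)"
    \<comment> \<open>The coarse mean is written as a sum over the fine partition, in which the point with index \<open>k\<close>
      is replaced by the last coarse point \<open>k div m\<close> before it.\<close>
    have "(\<Sum>k<n * m. scaled_res (?z n (k div m)) x) = (\<Sum>k<n. \<Sum>i = k * m..<k * m + m. scaled_res (?z n (i div m)) x)"
      by (rule sum.nat_group[symmetric])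
    also have "\<dots> = (\<Sum>k<n. \<Sum>i = k * m..<k * m + m. scaled_res (?z n k) x)"
    proof (intro sum.cong refl)
      fix k i assume "i \<in> {k * m..<k * m + m}"
      then have "i div m = k" by (intro div_nat_eqI) (auto simp: mult.commute)
      then show "scaled_res (?z n (i div m)) x = scaled_res (?z n k) x" by simp
    qed
    also have "\<dots> = real m *\<^sub>R (\<Sum>k<n. scaled_res (?z n k) x)"
      by (simp add: sum_constant_scaleR scaleR_sum_right)
    finally have "mean r n x = (1 / real (n * m)) *\<^sub>R (\<Sum>k<n * m. scaled_res (?z n (k div m)) x)"
      using nm by (simp add: mean_def)
    then have "mean r (n * m) x - mean r n x =
        (1 / real (n * m)) *\<^sub>R (\<Sum>k<n * m. scaled_res (?z (n * m) k) x - scaled_res (?z n (k div m)) x)"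
      by (simp only: mean_def[of r "n * m"] sum_subtractf scaleR_diff_right)
    also have "norm \<dots> \<le> L * (\<rho> * (2 * pi / real n)) * norm x"
    proof (rule norm_average_le)
      fix k assume "k < n * m"
      have "real k / real (n * m) - real (k div m) / real n = real (k mod m) / real (n * m)"
      proof -
        have "real k = real (k div m) * real m + real (k mod m)"
          by (metis div_mult_mod_eq of_nat_add of_nat_mult)
        then show ?thesis using nm by (simp add: field_simps)
      qed
      also have "\<dots> \<le> 1 / real n"
        using nm mod_less_divisor[OF nm(2), of k] by (simp add: field_simps)
      finally have "real k / real (n * m) - real (k div m) / real n \<le> 1 / real n" .
      moreover have "0 \<le> real k / real (n * m) - real (k div m) / real n"
        using \<open>_ = real (k mod m) / real (n * m)\<close> by simp
      ultimately have "\<bar>real k / real (n * m) - real (k div m) / real n\<bar> \<le> 1 / real n" by simp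
      then have "2 * pi * \<bar>real k / real (n * m) - real (k div m) / real n\<bar> \<le> 2 * pi * (1 / real n)"
        by (intro mult_left_mono) auto
      moreover have "\<bar>2 * pi * real k / real (n * m) - 2 * pi * real (k div m) / real n\<bar> =
          2 * pi * \<bar>real k / real (n * m) - real (k div m) / real n\<bar>"
        by (simp add: abs_mult flip: right_diff_distrib times_divide_eq_right)
      ultimately have "cmod (cis (2 * pi * real k / real (n * m)) - cis (2 * pi * real (k div m) / real n)) \<le> 2 * pi / real n"
        using cmod_cis_diff_le[of "2 * pi * real k / real (n * m)" "2 * pi * real (k div m) / real n"] by simp
      then have "norm (?z (n * m) k - ?z n (k div m)) \<le> \<rho> * (2 * pi / real n)"
        unfolding right_diff_distrib[symmetric] norm_mult using r a by (intro mult_mono) auto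
      then have le: "L * norm (?z (n * m) k - ?z n (k div m)) * norm x \<le> L * (\<rho> * (2 * pi / real n)) * norm x"
        using CL(2) by (intro mult_right_mono mult_left_mono) auto
      have "norm (scaled_res (?z (n * m) k) x - scaled_res (?z n (k div m)) x) \<le> L * norm (?z (n * m) k - ?z n (k div m)) * norm x"
        using r a by (intro CL(4)) (auto simp: norm_mult)
      then show "norm (scaled_res (?z (n * m) k) x - scaled_res (?z n (k div m)) x) \<le> L * (\<rho> * (2 * pi / real n)) * norm x"
        using le by (rule order_trans)
    qed (use nm in simp)
    also have "\<dots> \<le> L' / real n * norm x"
      using L'(2) by (intro mult_right_mono) (simp_all add: divide_right_mono mult_ac)
    finally show ?thesis .
  qed
  show ?thesis by (rule that[OF CL(1) L'(3) 1 2 3])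
qed

text \<open>In other words, the mean is the inverse of \<open>I - (T / r) ^ n\<close>. At each of the \<open>n\<close> points \<open>z ^ n = r ^ n\<close>, so
  \<open>z (z - T)\<^sup>-\<^sup>1 (r ^ n - T ^ n)\<close> is the sum of the \<open>z ^ (n - j) T ^ j\<close> for \<open>j < n\<close>, and averaging over
  the points leaves only the term with \<open>j = 0\<close>.\<close>

lemma mean_inverse:
  assumes r: "0 < r" "r < \<rho>" and n: "n > 0"
  shows "(T ^^ n) (mean r n x) = r ^ n *\<^sub>R (mean r n x - x)"
proof -
  define z where "z k = of_real r * cis (2 * pi * real k / real n)" for k
  have z: "z k \<in> disc" "z k \<noteq> 0" for k using circle_ann[OF r] by (auto simp: z_def r less_imp_neq[OF r(1), symmetric])
  have cyc: "cis (2 * pi * real k / real n) ^ n = 1" for k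
  proof -
    have "cis (2 * pi * real k / real n) ^ n = cis (2 * pi * real k)"
      using n by (simp add: Complex.DeMoivre)
    also have "\<dots> = 1" by (rule cis_multiple_2pi) auto
    finally show ?thesis .
  qed
  have zn: "z k ^ n = complex_of_real (r ^ n)" for k
    by (simp add: z_def power_mult_distrib cyc)
  have q: "scaled_res (z k) ((T ^^ n) x) - r ^ n *\<^sub>R scaled_res (z k) x = - (\<Sum>j<n. z k ^ (n - j) *\<^sub>C (T ^^ j) x)" for k
  proof -
    let ?q = "\<Sum>j<n. z k ^ (n - j) *\<^sub>C (T ^^ j) x"
    have "scaled_res (z k) ((T ^^ n) x) - r ^ n *\<^sub>R scaled_res (z k) x = scaled_res (z k) ((T ^^ n) x - z k ^ n *\<^sub>C x)"
      unfolding clinear_diff[OF F_clinear[OF z(1)]] F_scale[OF z(1)]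
      unfolding zn scaleC_of_real ..
    also have "\<dots> = - resolvent (z k) (z k *\<^sub>C ((T ^^ n) x - z k ^ n *\<^sub>C x))"
      by (simp add: scaled_res_def clinear_scale[OF resolvent(1)[OF z(1)]])
    also have "\<dots> = - ?q"
      unfolding power_minus_scalar_sum[OF T, symmetric] by (simp only: resolvent(2)[OF z(1)])
    finally show ?thesis .
  qed
  have "(\<Sum>k<n. \<Sum>j<n. z k ^ (n - j) *\<^sub>C (T ^^ j) x) = (\<Sum>j<n. (\<Sum>k<n. z k ^ (n - j)) *\<^sub>C (T ^^ j) x)"
    by (subst sum.swap) (simp add: cvec.scale_sum_left)
  also have "\<dots> = (\<Sum>j<n. if j = 0 then complex_of_real (real n * r ^ n) *\<^sub>C x else 0)"
  proof (intro sum.cong refl)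
    fix j assume j: "j \<in> {..<n}"
    show "(\<Sum>k<n. z k ^ (n - j)) *\<^sub>C (T ^^ j) x = (if j = 0 then complex_of_real (real n * r ^ n) *\<^sub>C x else 0)"
    proof (cases "j = 0")
      case True
      then show ?thesis by (simp add: zn)
    next
      case False
      have "(\<Sum>k<n. z k ^ (n - j)) = of_real r ^ (n - j) * (\<Sum>k<n. cis (2 * pi * real k / real n) ^ (n - j))"
        by (simp add: z_def power_mult_distrib sum_distrib_left)
      also have "\<dots> = 0" using sum_roots_of_unity_powers[of "n - j" n] False j by simp
      finally show ?thesis using False by simp
    qed
  qed
  also have "\<dots> = (real n * r ^ n) *\<^sub>R x" using n by (simp add: scaleC_of_real del: of_real_mult)
  finally have s: "(\<Sum>k<n. \<Sum>j<n. z k ^ (n - j) *\<^sub>C (T ^^ j) x) = (real n * r ^ n) *\<^sub>R x" .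
  have "mean r n ((T ^^ n) x) - r ^ n *\<^sub>R mean r n x = (1 / real n) *\<^sub>R (\<Sum>k<n. scaled_res (z k) ((T ^^ n) x) - r ^ n *\<^sub>R scaled_res (z k) x)"
    by (simp add: mean_def z_def sum_subtractf scaleR_diff_right scaleR_sum_right)
  also have "\<dots> = - (r ^ n *\<^sub>R x)"
    unfolding q sum_negf s using n by simp
  finally show ?thesis using Tpow_mean[OF r, of n n x] by (simp add: algebra_simps)
qed

end

context isolated_spectral_point
begin

lemma mean_proj_bounds:
  assumes a: "0 < a" "b < \<rho>"
  obtains C L where "C > 0" "L > 0"
    "\<And>r n x. a \<le> r \<Longrightarrow> r \<le> b \<Longrightarrow> norm (mean r (Suc n) x) \<le> C * norm x"
    "\<And>r n x. a \<le> r \<Longrightarrow> r \<le> b \<Longrightarrow> norm (mean r (Suc n) x - proj r x) \<le> L / real (Suc n) * norm x"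
    "\<And>r s x. a \<le> r \<Longrightarrow> r \<le> b \<Longrightarrow> a \<le> s \<Longrightarrow> s \<le> b \<Longrightarrow> norm (proj r x - proj s x) \<le> L * \<bar>r - s\<bar> * norm x"
    "\<And>r x. a \<le> r \<Longrightarrow> r \<le> b \<Longrightarrow> (\<lambda>n. mean r (Suc n) x) \<longlonglongrightarrow> proj r x"
proof -
  obtain C L where CL: "C > 0" "L > 0"
    "\<And>r n x. a \<le> r \<Longrightarrow> r \<le> b \<Longrightarrow> n > 0 \<Longrightarrow> norm (mean r n x) \<le> C * norm x"
    "\<And>r s n x. a \<le> r \<Longrightarrow> r \<le> b \<Longrightarrow> a \<le> s \<Longrightarrow> s \<le> b \<Longrightarrow> n > 0 \<Longrightarrow>
      norm (mean r n x - mean s n x) \<le> L * \<bar>r - s\<bar> * norm x"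
    "\<And>r n m x. a \<le> r \<Longrightarrow> r \<le> b \<Longrightarrow> n > 0 \<Longrightarrow> m > 0 \<Longrightarrow>
      norm (mean r (n * m) x - mean r n x) \<le> L / real n * norm x"
    by (rule mean_bounds[OF a]) (rule that; assumption)
  have diff: "norm (mean r n x - mean r m x) \<le> (L / real n + L / real m) * norm x"
    if r: "a \<le> r" "r \<le> b" and nm: "n > 0" "m > 0" for r n m x
  proof -
    have "mean r n x - mean r m x = (mean r (m * n) x - mean r m x) - (mean r (n * m) x - mean r n x)"
      by (simp add: mult.commute)
    also have "norm \<dots> \<le> norm (mean r (m * n) x - mean r m x) + norm (mean r (n * m) x - mean r n x)"
      by (rule norm_triangle_ineq4)
    also have "\<dots> \<le> L / real m * norm x + L / real n * norm x"
      by (intro add_mono CL(5) r nm)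
    finally show ?thesis by (simp add: distrib_right add.commute)
  qed
  have inv0: "(\<lambda>n. K / real (Suc n)) \<longlonglongrightarrow> 0" for K :: real
    using tendsto_mult_right_zero[OF LIMSEQ_inverse_real_of_nat, of K] by (simp add: divide_inverse)
  have lim: "(\<lambda>n. mean r (Suc n) x) \<longlonglongrightarrow> proj r x" if r: "a \<le> r" "r \<le> b" for r x
  proof -
    have "Cauchy (\<lambda>n. mean r (Suc n) x)"
    proof (rule metric_CauchyI)
      fix e :: real assume "e > 0"
      have "(\<lambda>n. 2 * L * norm x / real (Suc n)) \<longlonglongrightarrow> 0" by (rule inv0)
      then obtain N where N: "2 * L * norm x / real (Suc N) < e"
        using order_tendstoD(2)[OF _ \<open>e > 0\<close>] eventually_happens'[OF sequentially_bot] by metis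
      show "\<exists>M. \<forall>m\<ge>M. \<forall>n\<ge>M. dist (mean r (Suc m) x) (mean r (Suc n) x) < e"
      proof (intro exI allI impI)
        fix m n assume "N \<le> m" "N \<le> n"
        then have "L / real (Suc m) \<le> L / real (Suc N)" "L / real (Suc n) \<le> L / real (Suc N)"
          using CL(2) by (auto intro!: divide_left_mono)
        then have "(L / real (Suc m) + L / real (Suc n)) * norm x \<le> (L / real (Suc N) + L / real (Suc N)) * norm x"
          by (intro mult_right_mono add_mono) auto
        also have "\<dots> = 2 * L * norm x / real (Suc N)" by (simp add: field_simps del: of_nat_Suc)
        finally show "dist (mean r (Suc m) x) (mean r (Suc n) x) < e"
          using diff[OF r, of "Suc m" "Suc n" x] N by (simp add: dist_norm del: of_nat_Suc)
      qed
    qed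
    then show ?thesis unfolding proj_def using Cauchy_convergent convergent_LIMSEQ_iff by blast
  qed
  have 2: "norm (mean r (Suc n) x - proj r x) \<le> L / real (Suc n) * norm x" if r: "a \<le> r" "r \<le> b" for r n x
  proof (rule LIMSEQ_le)
    show "(\<lambda>m. norm (mean r (Suc n) x - mean r (Suc m) x)) \<longlonglongrightarrow> norm (mean r (Suc n) x - proj r x)"
      by (intro tendsto_intros lim r)
    have "(\<lambda>m. (L / real (Suc n) + L / real (Suc m)) * norm x) \<longlonglongrightarrow> (L / real (Suc n) + 0) * norm x"
      by (intro tendsto_intros inv0)
    then show "(\<lambda>m. (L / real (Suc n) + L / real (Suc m)) * norm x) \<longlonglongrightarrow> L / real (Suc n) * norm x" by simp
    show "\<exists>N. \<forall>m\<ge>N. norm (mean r (Suc n) x - mean r (Suc m) x) \<le> (L / real (Suc n) + L / real (Suc m)) * norm x"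
      using diff[OF r] by blast
  qed
  have 3: "norm (proj r x - proj s x) \<le> L * \<bar>r - s\<bar> * norm x" if rs: "a \<le> r" "r \<le> b" "a \<le> s" "s \<le> b" for r s x
  proof (rule LIMSEQ_le_const2)
    show "(\<lambda>n. norm (mean r (Suc n) x - mean s (Suc n) x)) \<longlonglongrightarrow> norm (proj r x - proj s x)"
      by (intro tendsto_intros lim rs)
    show "\<exists>N. \<forall>n\<ge>N. norm (mean r (Suc n) x - mean s (Suc n) x) \<le> L * \<bar>r - s\<bar> * norm x"
      using CL(4)[OF rs] by blast
  qed
  show ?thesis by (rule that[OF CL(1,2) CL(3) 2 3 lim]) simp_all
qed

lemma mean_bounded:
  assumes "0 < a" "b < \<rho>"
  shows "\<exists>C>0. \<forall>r n x. a \<le> r \<longrightarrow> r \<le> b \<longrightarrow> norm (mean r (Suc n) x) \<le> C * norm x"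
  by (rule mean_proj_bounds[OF assms]) blast

lemma proj_lipschitz:
  assumes "0 < a" "b < \<rho>"
  shows "\<exists>L>0. \<forall>r s x. a \<le> r \<longrightarrow> r \<le> b \<longrightarrow> a \<le> s \<longrightarrow> s \<le> b \<longrightarrow>
    norm (proj r x - proj s x) \<le> L * \<bar>r - s\<bar> * norm x"
  by (rule mean_proj_bounds[OF assms]) blast

lemma mean_near_proj:
  assumes "0 < r" "r < \<rho>"
  shows "\<exists>L>0. \<forall>n x. norm (mean r (Suc n) x - proj r x) \<le> L / real (Suc n) * norm x"
  by (rule mean_proj_bounds[OF assms]) blast

lemma mean_tendsto_proj:
  assumes "0 < r" "r < \<rho>"
  shows "(\<lambda>n. mean r (Suc n) x) \<longlonglongrightarrow> proj r x"
  by (rule mean_proj_bounds[OF assms]) blast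

lemma proj_clinear:
  assumes r: "0 < r" "r < \<rho>"
  shows "bounded_clinear (proj r)"
proof -
  obtain C where C: "\<And>n x. norm (mean r (Suc n) x) \<le> C * norm x"
    using mean_bounded[OF r] by auto
  note M = mean_clinear[OF r]
  show ?thesis
  proof (rule bounded_clinearI)
    show "proj r (x + y) = proj r x + proj r y" for x y
    proof (rule LIMSEQ_unique[OF mean_tendsto_proj[OF r]])
      show "(\<lambda>n. mean r (Suc n) (x + y)) \<longlonglongrightarrow> proj r x + proj r y"
        unfolding clinear_add[OF M] by (intro tendsto_add mean_tendsto_proj r)
    qed
    show "proj r (c *\<^sub>C x) = c *\<^sub>C proj r x" for c x
    proof (rule LIMSEQ_unique[OF mean_tendsto_proj[OF r]])
      have "bounded_linear (\<lambda>x::'a. c *\<^sub>C x)"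
        by (intro clinear_imp_bounded_linear clinear_scaleC clinear_id)
      then show "(\<lambda>n. mean r (Suc n) (c *\<^sub>C x)) \<longlonglongrightarrow> c *\<^sub>C proj r x"
        unfolding clinear_scale[OF M] by (rule bounded_linear.tendsto) (rule mean_tendsto_proj[OF r])
    qed
    show "norm (proj r x) \<le> C * norm x" for x
      by (rule LIMSEQ_le_const2[OF tendsto_norm[OF mean_tendsto_proj[OF r]]]) (use C in blast)
  qed
qed

lemma commute_proj:
  assumes r: "0 < r" "r < \<rho>" and A: "bounded_clinear A" "\<And>n x. A (mean r n x) = mean r n (A x)"
  shows "A (proj r x) = proj r (A x)"
proof (rule LIMSEQ_unique[OF _ mean_tendsto_proj[OF r]])
  show "(\<lambda>n. mean r (Suc n) (A x)) \<longlonglongrightarrow> A (proj r x)"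
    unfolding A(2)[symmetric]
    by (rule bounded_linear.tendsto[OF clinear_imp_bounded_linear[OF A(1)] mean_tendsto_proj[OF r]])
qed

lemma mean_proj: "0 < r \<Longrightarrow> r < \<rho> \<Longrightarrow> 0 < s \<Longrightarrow> s < \<rho> \<Longrightarrow> mean s n (proj r x) = proj r (mean s n x)"
  by (intro commute_proj) (auto simp: mean_clinear intro: mean_commute)

lemma T_proj: "0 < r \<Longrightarrow> r < \<rho> \<Longrightarrow> T (proj r x) = proj r (T x)"
  by (intro commute_proj) (auto simp: T T_mean)

text \<open>Applying the inverse formula for both radii gives
  \<open>mean s n \<circ> mean r n - mean r n = (r / s) ^ n (mean s n \<circ> (mean r n - I))\<close>, which tends to \<open>0\<close>.\<close>

lemma proj_proj_less:
  assumes r: "0 < r" "r < s" "s < \<rho>"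
  shows "proj s (proj r x) = proj r x"
proof -
  obtain C where CL: "C > 0"
    "\<And>t n x. r \<le> t \<Longrightarrow> t \<le> s \<Longrightarrow> norm (mean t (Suc n) x) \<le> C * norm x"
    using mean_bounded[OF r(1,3)] by auto
  have r': "0 < r" "r < \<rho>" "0 < s" "s < \<rho>" using r by auto
  have eq: "mean s (Suc n) (mean r (Suc n) x) - mean r (Suc n) x =
      (r / s) ^ Suc n *\<^sub>R mean s (Suc n) (mean r (Suc n) x - x)" for n
  proof -
    let ?n = "Suc n"
    have "s ^ ?n *\<^sub>R (mean s ?n (mean r ?n x) - mean r ?n x) = mean s ?n ((T ^^ ?n) (mean r ?n x))"
      unfolding Tpow_mean[OF r'(3,4), symmetric] by (rule mean_inverse[OF r'(3,4), symmetric]) simp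
    also have "\<dots> = r ^ ?n *\<^sub>R mean s ?n (mean r ?n x - x)"
      unfolding mean_inverse[OF r'(1,2) zero_less_Suc]
      by (simp only: scaleC_of_real[symmetric] clinear_scale[OF mean_clinear[OF r'(3,4)]])
    finally have "inverse (s ^ ?n) *\<^sub>R s ^ ?n *\<^sub>R (mean s ?n (mean r ?n x) - mean r ?n x) =
        inverse (s ^ ?n) *\<^sub>R r ^ ?n *\<^sub>R mean s ?n (mean r ?n x - x)" by simp
    then show ?thesis unfolding power_divide using r'(3) by (simp add: divide_inverse mult.commute del: power_Suc)
  qed
  have "(\<lambda>n. (r / s) ^ Suc n * (C * ((C + 1) * norm x))) \<longlonglongrightarrow> 0 * (C * ((C + 1) * norm x))"
    using r r' by (intro tendsto_mult tendsto_const LIMSEQ_Suc[OF LIMSEQ_power_zero]) simp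
  then have small: "(\<lambda>n. (r / s) ^ Suc n * (C * ((C + 1) * norm x))) \<longlonglongrightarrow> 0" by simp
  have "(\<lambda>n. mean s (Suc n) (mean r (Suc n) x) - mean r (Suc n) x) \<longlonglongrightarrow> 0"
  proof (rule Lim_null_comparison[OF _ small], intro always_eventually allI)
    fix n
    have "norm (mean r (Suc n) x - x) \<le> C * norm x + norm x"
      using norm_triangle_ineq4[of "mean r (Suc n) x" x] CL(2)[of r n x] r by simp
    then have "norm (mean s (Suc n) (mean r (Suc n) x - x)) \<le> C * ((C + 1) * norm x)"
      using order_trans[OF CL(2)[of s n "mean r (Suc n) x - x"] mult_left_mono[OF _ less_imp_le[OF CL(1)]]] r
      by (simp add: distrib_right)
    then show "norm (mean s (Suc n) (mean r (Suc n) x) - mean r (Suc n) x) \<le> (r / s) ^ Suc n * (C * ((C + 1) * norm x))"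
      unfolding eq norm_scaleR using r r' by (intro mult_mono) (simp_all del: power_Suc)
  qed
  moreover have "(\<lambda>n. mean s (Suc n) (mean r (Suc n) x) - mean r (Suc n) x) \<longlonglongrightarrow> proj s (proj r x) - proj r x"
  proof (intro tendsto_diff mean_tendsto_proj r')
    have "(\<lambda>n. C * norm (mean r (Suc n) x - proj r x)) \<longlonglongrightarrow> 0"
      using tendsto_norm_zero[OF LIM_zero[OF mean_tendsto_proj[OF r'(1,2)]]] by (rule tendsto_mult_right_zero)
    then have "(\<lambda>n. mean s (Suc n) (mean r (Suc n) x - proj r x)) \<longlonglongrightarrow> 0"
      by (rule Lim_null_comparison[rotated]) (use CL(2) r in simp)
    then have "(\<lambda>n. mean s (Suc n) (mean r (Suc n) x - proj r x) + mean s (Suc n) (proj r x)) \<longlonglongrightarrow> 0 + proj s (proj r x)"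
      by (intro tendsto_add mean_tendsto_proj r')
    then show "(\<lambda>n. mean s (Suc n) (mean r (Suc n) x)) \<longlonglongrightarrow> proj s (proj r x)"
      by (simp add: clinear_diff[OF mean_clinear[OF r'(3,4)]])
  qed
  ultimately have "proj s (proj r x) - proj r x = 0" using LIMSEQ_unique by metis
  then show ?thesis by simp
qed

text \<open>The preceding identity for \<open>s\<close> slightly larger than \<open>r\<close>, combined with the continuity of the
  projection in the radius.\<close>

lemma proj_idem:
  assumes r: "0 < r" "r < \<rho>"
  shows "proj r (proj r x) = proj r x"
proof -
  define b where "b = (r + \<rho>) / 2"
  have b: "r < b" "b < \<rho>" using r by (auto simp: b_def)
  obtain L where L: "L > 0" "\<And>s y. r \<le> s \<Longrightarrow> s \<le> b \<Longrightarrow> norm (proj r y - proj s y) \<le> L * \<bar>r - s\<bar> * norm y"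
    using proj_lipschitz[OF r(1) b(2)] b(1) by (metis less_imp_le order_refl)
  have "norm (proj r (proj r x) - proj r x) \<le> 0"
  proof (rule tendsto_lowerbound)
    have "((\<lambda>s. L * \<bar>r - s\<bar> * norm (proj r x)) \<longlongrightarrow> L * \<bar>r - r\<bar> * norm (proj r x)) (at_right r)"
      by (intro tendsto_intros)
    then show "((\<lambda>s. L * \<bar>r - s\<bar> * norm (proj r x)) \<longlongrightarrow> 0) (at_right r)" by simp
    show "\<forall>\<^sub>F s in at_right r. norm (proj r (proj r x) - proj r x) \<le> L * \<bar>r - s\<bar> * norm (proj r x)"
      using eventually_at_right_less[of r] eventually_at_right_real[OF b(1)]
    proof eventually_elim
      case (elim s)
      then have "proj s (proj r x) = proj r x" using r b by (intro proj_proj_less) auto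
      then show ?case using L(2)[of s "proj r x"] elim by simp
    qed
  qed simp
  then show ?thesis by simp
qed

lemma proj_proj_greater:
  assumes "0 < r" "r < s" "s < \<rho>"
  shows "proj r (proj s x) = proj r x"
proof -
  have "proj r (proj s x) = proj s (proj r x)"
    by (rule commute_proj[symmetric])
      (use assms in \<open>auto intro!: proj_clinear mean_proj[symmetric]\<close>)
  then show ?thesis using proj_proj_less[OF assms] by simp
qed

text \<open>The difference of the projections for two radii is itself idempotent, and an idempotent operator
  of norm less than \<open>1\<close> is zero.\<close>

lemma proj_locally_constant:
  assumes r: "0 < r" "r < s" "s < \<rho>" and close: "\<And>x. norm (proj s x - proj r x) \<le> q * norm x" and q: "q < 1"
  shows "proj s x = proj r x"
proof -
  define D where "D x = proj s x - proj r x" for x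
  have s: "0 < s" "r < \<rho>" using r by auto
  have "D (D x) = D x"
    using r s by (simp add: D_def clinear_diff[OF proj_clinear] proj_idem proj_proj_less proj_proj_greater)
  then have "norm (D x) \<le> q * norm (D x)" using close[of "D x"] by (simp add: D_def)
  then have "D x = 0" using q by (metis linorder_not_less mult_less_cancel_right2 norm_le_zero_iff)
  then show ?thesis by (simp add: D_def)
qed

lemma proj_constant:
  assumes r: "0 < r" "r < \<rho>" and s: "0 < s" "s < \<rho>"
  shows "proj r x = proj s x"
proof (rule connected_local_const[of "{min r s..max r s}" r s "\<lambda>t. proj t x"])
  obtain L where L: "L > 0"
    "\<And>t u x. min r s \<le> t \<Longrightarrow> t \<le> max r s \<Longrightarrow> min r s \<le> u \<Longrightarrow> u \<le> max r s \<Longrightarrow>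
      norm (proj t x - proj u x) \<le> L * \<bar>t - u\<bar> * norm x"
    using proj_lipschitz[of "min r s" "max r s"] r s by auto
  have eq: "proj t x = proj u x"
    if t: "min r s \<le> t" "t < u" "u \<le> max r s" "\<bar>t - u\<bar> < 1 / L" for t u
  proof (rule proj_locally_constant[symmetric])
    show "0 < t" "t < u" "u < \<rho>" using t r s by auto
    show "norm (proj u x - proj t x) \<le> (L * \<bar>u - t\<bar>) * norm x" for x using L(2)[of u t x] t by simp
    show "L * \<bar>u - t\<bar> < 1" using t L(1) by (simp add: field_simps abs_minus_commute)
  qed
  show "\<forall>t\<in>{min r s..max r s}. \<forall>\<^sub>F u in at t within {min r s..max r s}. proj t x = proj u x"
  proof
    fix t assume t: "t \<in> {min r s..max r s}"
    show "\<forall>\<^sub>F u in at t within {min r s..max r s}. proj t x = proj u x"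
      unfolding eventually_at
    proof (intro exI[of _ "1 / L"] conjI ballI impI)
      show "0 < 1 / L" using L(1) by simp
      fix u assume u: "u \<in> {min r s..max r s}" "u \<noteq> t \<and> dist u t < 1 / L"
      then have "\<bar>t - u\<bar> < 1 / L" "\<bar>u - t\<bar> < 1 / L" by (auto simp: dist_real_def abs_minus_commute)
      then show "proj t x = proj u x"
        using eq[of t u] eq[of u t] t u by (cases "t < u") auto
    qed
  qed
qed auto

text \<open>For large \<open>n\<close> the mean is close to \<open>P\<close>. On the kernel of \<open>P\<close> it is small, so \<open>I - mean\<close>, which is
  \<open>- (T / r) ^ n \<circ> mean\<close>, is bijective there, and hence so is \<open>T\<close>. On the range of \<open>P\<close> it is close to the
  identity, hence onto with controlled preimages, and \<open>T ^ n \<circ> mean = r ^ n (mean - I)\<close> bounds \<open>T ^ n\<close>.\<close>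

lemma riesz_decomposition:
  obtains P where "bounded_clinear P" "\<And>x. P (P x) = P x" "\<And>x. T (P x) = P (T x)"
    "\<And>x. P x = 0 \<Longrightarrow> T x = 0 \<Longrightarrow> x = 0" "\<And>y. P y = 0 \<Longrightarrow> \<exists>x. P x = 0 \<and> T x = y"
    "\<And>r. 0 < r \<Longrightarrow> r < \<rho> \<Longrightarrow> \<exists>N. \<forall>n\<ge>N. \<forall>x. P x = x \<longrightarrow> norm ((T ^^ n) x) \<le> r ^ n * norm x"
proof -
  define P where "P = proj (\<rho> / 2)"
  have h: "0 < \<rho> / 2" "\<rho> / 2 < \<rho>" using \<rho> by auto
  have P: "bounded_clinear P" unfolding P_def by (rule proj_clinear[OF h])
  have Pr: "P x = proj r x" if "0 < r" "r < \<rho>" for r x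
    unfolding P_def by (rule proj_constant[OF h that])
  have PP: "P (P x) = P x" for x unfolding P_def by (rule proj_idem[OF h])
  have TP: "T (P x) = P (T x)" for x unfolding P_def by (rule T_proj[OF h])
  have half: "\<exists>N. \<forall>n\<ge>N. n > 0 \<longrightarrow> (\<forall>x. norm (mean r n x - P x) \<le> 1/2 * norm x)"
    if r: "0 < r" "r < \<rho>" for r
  proof -
    obtain L where L: "L > 0" "\<And>n x. norm (mean r (Suc n) x - proj r x) \<le> L / real (Suc n) * norm x"
      using mean_near_proj[OF r] by blast
    obtain N where N: "2 * L \<le> real N" using real_arch_simple by blast
    show ?thesis
    proof (intro exI[of _ N] allI impI)
      fix n x assume n: "N \<le> n" "n > 0"
      have "norm (mean r n x - P x) \<le> L / real n * norm x"
        using L(2)[of "n - 1" x] n(2) Pr[OF r] by simp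
      also have "\<dots> \<le> 1 / 2 * norm x"
        using n N by (intro mult_right_mono) (auto simp: field_simps)
      finally show "norm (mean r n x - P x) \<le> 1/2 * norm x" .
    qed
  qed
  have mP: "mean r n (P x) = P (mean r n x)" if "0 < r" "r < \<rho>" for r n x
    unfolding P_def by (rule mean_proj[OF h that])
  let ?r = "\<rho> / 2"
  obtain n where n: "n > 0" "\<And>x. norm (mean ?r n x - P x) \<le> 1/2 * norm x"
    using half[OF h] by (metis le_add2 zero_less_Suc add_Suc plus_1_eq_Suc)
  have M: "bounded_clinear (mean ?r n)" by (rule mean_clinear[OF h])
  have rpow: "?r ^ n \<noteq> 0" using h by simp
  have inj: "x = 0" if x: "P x = 0" "T x = 0" for x
  proof -
    have "(T ^^ n) x = 0" using n(1) x(2) power_eigenvector[OF T, of x 0 n] by simp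
    then have "(T ^^ n) (mean ?r n x) = 0" by (simp add: Tpow_mean[OF h] clinear_0[OF M])
    then have "?r ^ n *\<^sub>R (mean ?r n x - x) = 0" using mean_inverse[OF h n(1), of x] by metis
    then have "mean ?r n x = x" unfolding scaleR_eq_0_iff using \<rho> by simp
    then show ?thesis using n(2)[of x] x(1) by simp
  qed
  have onto: "\<exists>x. P x = 0 \<and> T x = y" if y: "P y = 0" for y
  proof -
    let ?M = "{x. P x = 0}"
    have subM: "cvec.subspace ?M" using csubspace_null_space[OF P] by (simp add: null_space_def)
    have clM: "closed ?M"
    proof -
      have "closed (P -` {0})"
        by (intro closed_vimage linear_continuous_on clinear_imp_bounded_linear P) auto
      then show ?thesis by (simp add: vimage_def)
    qed
    have "\<exists>u\<in>?M. u + - mean ?r n u = y \<and> norm u \<le> 2 * 1 * norm y"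
    proof (rule surjective_perturbation[where V = ?M and \<epsilon> = "1/2"])
      have "bounded_linear (mean ?r n)" by (rule clinear_imp_bounded_linear[OF M])
      then show "bounded_linear (\<lambda>u. - mean ?r n u)" by (rule bounded_linear_minus)
      show "subspace ?M" "subspace ?M" using csubspace_imp_subspace[OF subM] by auto
      show "(\<lambda>u. - mean ?r n u) ` ?M \<subseteq> ?M"
        by (auto simp: clinear_minus[OF P] clinear_0[OF M] simp flip: mP[OF h])
      show "norm (- mean ?r n x) \<le> 1 / 2 * norm x" if "x \<in> ?M" for x using n(2)[of x] that by simp
    qed (use clM y in auto)
    then obtain u where u: "P u = 0" "u - mean ?r n u = y" by auto
    obtain k where k: "n = Suc k" using n(1) by (cases n) auto
    define x where "x = (- 1 / ?r ^ n) *\<^sub>R (T ^^ k) (mean ?r n u)"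
    have Tk: "P ((T ^^ k) v) = (T ^^ k) (P v)" for v by (induction k) (auto simp flip: TP)
    have "P ((T ^^ k) (mean ?r n u)) = 0"
      by (simp add: Tk u(1) clinear_0[OF M] clinear_0[OF clinear_power[OF T]]
          flip: mP[OF h])
    then have "P x = 0"
      unfolding x_def scaleC_of_real[symmetric] clinear_scale[OF P] by simp
    moreover have "T x = (- 1 / ?r ^ n) *\<^sub>R (T ^^ n) (mean ?r n u)"
      unfolding x_def k scaleC_of_real[symmetric] clinear_scale[OF T] by simp
    then have "T x = y" using less_imp_neq[OF \<rho>] u(2) unfolding mean_inverse[OF h n(1)] by simp
    ultimately show ?thesis by blast
  qed
  have small: "\<exists>N. \<forall>n\<ge>N. \<forall>x. P x = x \<longrightarrow> norm ((T ^^ n) x) \<le> r ^ n * norm x" if r: "0 < r" "r < \<rho>" for r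
  proof -
    obtain N where N: "\<And>n x. n \<ge> N \<Longrightarrow> n > 0 \<Longrightarrow> norm (mean r n x - P x) \<le> 1/2 * norm x"
      using half[OF r] by blast
    have "norm ((T ^^ n) x) \<le> r ^ n * norm x" if n: "n \<ge> Suc N" and x: "P x = x" for n x
    proof -
      let ?W = "{x. P x = x}"
      have W: "cvec.subspace ?W"
        by (auto simp: cvec.subspace_def clinear_add[OF P] clinear_scale[OF P] clinear_0[OF P])
      have clW: "closed ?W"
        by (intro closed_Collect_eq continuous_on_id linear_continuous_on clinear_imp_bounded_linear P)
      have n': "n \<ge> N" "n > 0" using n by auto
      have m: "norm (mean r n u - u) \<le> 1/2 * norm u" if "P u = u" for u using N[OF n', of u] that by simp
      have "\<exists>u\<in>?W. u + (mean r n u - u) = x \<and> norm u \<le> 2 * 1 * norm x"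
      proof (rule surjective_perturbation[where V = ?W and \<epsilon> = "1/2"])
        show "bounded_linear (\<lambda>u. mean r n u - u)"
          by (intro clinear_imp_bounded_linear clinear_minus_op clinear_id mean_clinear r)
        show "subspace ?W" "subspace ?W" using csubspace_imp_subspace[OF W] by auto
        show "(\<lambda>u. mean r n u - u) ` ?W \<subseteq> ?W"
          by (auto simp: clinear_diff[OF P] simp flip: mP[OF r])
        show "norm (mean r n u - u) \<le> 1 / 2 * norm u" if "u \<in> ?W" for u using m that by simp
      qed (use clW x in auto)
      then obtain u where u: "P u = u" "mean r n u = x" "norm u \<le> 2 * norm x" by auto
      have "(T ^^ n) x = r ^ n *\<^sub>R (mean r n u - u)" using mean_inverse[OF r n'(2), of u] u(2) by simp
      also have "norm \<dots> = r ^ n * norm (mean r n u - u)" using r by simp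
      also have "\<dots> \<le> r ^ n * norm x" using m[OF u(1)] u(3) r by (intro mult_left_mono) auto
      finally show ?thesis .
    qed
    then show ?thesis by blast
  qed
  show ?thesis by (rule that[OF P PP TP inj onto small])
qed

end

section \<open>Quasinilpotent restrictions\<close>

lemma bdd_above_norm_ratio:
  assumes A: "bounded_clinear A"
  shows "bdd_above ((\<lambda>x. norm (A x) / norm x) ` M)"
proof -
  obtain K where K: "K > 0" "\<And>x. norm (A x) \<le> K * norm x" using clinear_bounded[OF A] by blast
  have "norm (A y) / norm y \<le> K" for y
    using K(1) K(2)[of y] by (cases "y = 0") (auto simp: pos_divide_le_eq)
  then show ?thesis by (auto intro: bdd_aboveI[of _ K])
qed

lemma norm_le_onorm_on:
  assumes A: "bounded_clinear A" and x: "x \<in> M"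
  shows "norm (A x) \<le> onorm_on M A * norm x"
proof (cases "x = 0")
  case True
  then show ?thesis by (simp add: clinear_0[OF A])
next
  case False
  have "norm (A x) / norm x \<le> onorm_on M A"
    unfolding onorm_on_def by (rule cSUP_upper[OF x bdd_above_norm_ratio[OF A]])
  then show ?thesis using False by (simp add: pos_divide_le_eq)
qed

lemma onorm_on_le:
  assumes "M \<noteq> {}" "\<And>x. x \<in> M \<Longrightarrow> norm (A x) \<le> c * norm x" "0 \<le> c"
  shows "onorm_on M A \<le> c"
  unfolding onorm_on_def
proof (rule cSUP_least[OF assms(1)])
  fix x assume "x \<in> M"
  then show "norm (A x) / norm x \<le> c" using assms(2)[of x] assms(3) by (cases "x = 0") (auto simp: pos_divide_le_eq)
qed

lemma onorm_on_nonneg: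
  fixes A :: "'a::complex_normed_vector \<Rightarrow> 'a"
  assumes A: "bounded_clinear A" and "0 \<in> M"
  shows "0 \<le> onorm_on M A"
proof -
  have "norm (A 0) / norm (0::'a) \<le> onorm_on M A"
    unfolding onorm_on_def by (rule cSUP_upper[OF assms(2) bdd_above_norm_ratio[OF A]])
  then show ?thesis by simp
qed

lemma quasinilpotent_onI:
  assumes T: "bounded_clinear T" and N: "0 \<in> N" and \<rho>: "\<rho> > 0"
    and small: "\<And>r. 0 < r \<Longrightarrow> r < \<rho> \<Longrightarrow> \<exists>k. \<forall>n\<ge>k. \<forall>x\<in>N. norm ((T ^^ n) x) \<le> r ^ n * norm x"
  shows "quasinilpotent_on N T"
  unfolding quasinilpotent_on_def
proof (rule LIMSEQ_I)
  fix e :: real assume "e > 0"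
  define r where "r = min e \<rho> / 2"
  have r: "0 < r" "r < \<rho>" "r < e" using \<open>e > 0\<close> \<rho> by (auto simp: r_def min_def)
  obtain k where k: "\<And>n x. n \<ge> k \<Longrightarrow> x \<in> N \<Longrightarrow> norm ((T ^^ n) x) \<le> r ^ n * norm x"
    using small[OF r(1,2)] by blast
  show "\<exists>no. \<forall>n\<ge>no. norm (root n (onorm_on N (T ^^ n)) - 0) < e"
  proof (intro exI allI impI)
    \<comment> \<open>\<open>Suc k\<close> instead of \<open>k\<close>, because \<open>root n\<close> inverts the \<open>n\<close>-th power only for \<open>n > 0\<close>.\<close>
    fix n assume n: "Suc k \<le> n"
    have "onorm_on N (T ^^ n) \<le> r ^ n"
      by (rule onorm_on_le) (use N k n r in auto)
    then have "root n (onorm_on N (T ^^ n)) \<le> root n (r ^ n)" using n by simp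
    also have "\<dots> = r" using n r by (simp add: real_root_power_cancel)
    finally show "norm (root n (onorm_on N (T ^^ n)) - 0) < e"
      using real_root_ge_zero[OF onorm_on_nonneg[OF clinear_power[OF T] N], of n n] r(3) by simp
  qed
qed

text \<open>Some power satisfies \<open>\<parallel>T ^ n x\<parallel> \<le> |z| ^ n \<parallel>x\<parallel> / 2\<close> on \<open>N\<close>. Hence \<open>T ^ n - z ^ n\<close> is bijective on \<open>N\<close>,
  and it factors through \<open>T - z\<close>.\<close>

lemma quasinilpotent_on_imp_shift_bijective:
  fixes T :: "'a::complex_banach \<Rightarrow> 'a"
  assumes T: "bounded_clinear T" and N: "cvec.subspace N" "closed N" "T ` N \<subseteq> N"
    and q: "quasinilpotent_on N T" and z: "z \<noteq> 0"
  shows "(\<forall>y\<in>N. \<exists>x\<in>N. shift T z x = y) \<and> (\<forall>x\<in>N. shift T z x = 0 \<longrightarrow> x = 0)"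
proof -
  have N0: "0 \<in> N" using N(1) by (rule cvec.subspace_0)
  have "(\<lambda>n. root n (onorm_on N (T ^^ n))) \<longlonglongrightarrow> 0" using q by (simp add: quasinilpotent_on_def)
  then obtain k where k: "\<And>n. n \<ge> k \<Longrightarrow> root n (onorm_on N (T ^^ n)) < norm z / 2"
    using order_tendstoD(2)[of _ 0 sequentially "norm z / 2"] z by (auto simp: eventually_sequentially)
  define n where "n = Suc k"
  have Tn: "bounded_clinear (T ^^ n)" by (rule clinear_power[OF T])
  have "onorm_on N (T ^^ n) = root n (onorm_on N (T ^^ n)) ^ n"
    using onorm_on_nonneg[OF Tn N0] by (simp add: n_def real_root_pow_pos2 del: power_Suc funpow.simps)
  also have "\<dots> \<le> (norm z / 2) ^ n"
    using k[of n] onorm_on_nonneg[OF Tn N0] by (intro power_mono) (auto simp: n_def simp del: funpow.simps)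
  also have "\<dots> = norm z ^ n / 2 ^ n" by (rule power_divide)
  also have "\<dots> \<le> norm z ^ n / 2" by (intro divide_left_mono) (auto simp: n_def)
  finally have "onorm_on N (T ^^ n) \<le> norm z ^ n / 2" .
  then have small: "norm ((T ^^ n) x) \<le> norm z ^ n / 2 * norm x" if "x \<in> N" for x
    using norm_le_onorm_on[OF Tn that] by (meson mult_right_mono norm_ge_zero order_trans)
  have zn: "norm z ^ n > 0" using z by simp
  have "x = 0" if x: "x \<in> N" "shift T z x = 0" for x
  proof -
    have "T x = z *\<^sub>C x" using x(2) by (simp add: shift_def)
    then have "norm z ^ n * norm x \<le> norm z ^ n / 2 * norm x"
      using small[OF x(1)] power_eigenvector[OF T, of x z n] by (simp add: norm_scaleC norm_power)
    then have "norm x \<le> 0" using zn by (simp add: mult_le_0_iff field_simps)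
    then show ?thesis by simp
  qed
  moreover have "\<exists>x\<in>N. shift T z x = y" if y: "y \<in> N" for y
  proof -
    have TnN: "(T ^^ m) ` N \<subseteq> N" for m using N(3) by (induction m) auto
    have rN: "subspace N" by (rule csubspace_imp_subspace[OF N(1)])
    obtain Q where Q: "\<forall>x. (T ^^ n) x - z ^ n *\<^sub>C x = shift T z (Q x)"
        "\<forall>W. cvec.subspace W \<longrightarrow> T ` W \<subseteq> W \<longrightarrow> Q ` W \<subseteq> W"
      using power_minus_scalar_factor[OF T, of n z] by (elim exE conjE)
    have QN: "Q ` N \<subseteq> N" using Q(2) N(1,3) by simp
    have "\<exists>x\<in>N. (- (z ^ n)) *\<^sub>C x + (T ^^ n) x = y \<and> norm x \<le> 2 * (1 / norm z ^ n) * norm y"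
    proof (rule surjective_perturbation[where \<epsilon> = "norm z ^ n / 2" and V = N])
      show "bounded_linear (\<lambda>x::'a. (- (z ^ n)) *\<^sub>C x)"
        by (intro clinear_imp_bounded_linear clinear_scaleC clinear_id)
      show "bounded_linear (T ^^ n)" by (rule clinear_imp_bounded_linear[OF Tn])
      show "(\<lambda>x. (- (z ^ n)) *\<^sub>C x) ` N \<subseteq> N" using cvec.subspace_scale[OF N(1)] by blast
      show "\<exists>x\<in>N. (- (z ^ n)) *\<^sub>C x = u \<and> norm x \<le> 1 / norm z ^ n * norm u" if "u \<in> N" for u
      proof (rule bexI[of _ "inverse (- (z ^ n)) *\<^sub>C u"])
        have "norm (inverse (- (z ^ n))) = 1 / norm z ^ n"
          by (simp add: norm_inverse norm_power inverse_eq_divide norm_divide)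
        then show "(- (z ^ n)) *\<^sub>C inverse (- (z ^ n)) *\<^sub>C u = u \<and> norm (inverse (- (z ^ n)) *\<^sub>C u) \<le> 1 / norm z ^ n * norm u"
          using z by (simp only: scaleC_scaleC norm_scaleC) simp
        show "inverse (- (z ^ n)) *\<^sub>C u \<in> N" using that by (rule cvec.subspace_scale[OF N(1)])
      qed
      show "1 / norm z ^ n * (norm z ^ n / 2) \<le> 1 / 2" using z by simp
    qed (use rN N(2) TnN y small in auto)
    then obtain x where "x \<in> N" "(T ^^ n) x - z ^ n *\<^sub>C x = y" by auto
    then show ?thesis using Q(1) QN by (intro bexI[of _ "Q x"]) auto
  qed
  ultimately show ?thesis by blast
qed

section \<open>Independence modulo a subspace\<close>

lemma le_ecodim_imp_independent:
  assumes "enat k \<le> ecodim V W"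
  shows "\<exists>B. finite B \<and> B \<subseteq> V \<and> indep_mod W B \<and> card B = k"
proof -
  have "\<exists>B. finite B \<and> B \<subseteq> V \<and> indep_mod W B \<and> k \<le> card B"
  proof (rule ccontr)
    assume no: "\<not> ?thesis"
    have "indep_mod W {}" by (auto simp: indep_mod_def)
    then have "k \<noteq> 0" using no by auto
    have "ecodim V W \<le> enat (k - 1)"
      unfolding ecodim_def by (rule Sup_least) (use no in force)
    then have "enat k \<le> enat (k - 1)" using assms by (rule order_trans[rotated])
    then show False using \<open>k \<noteq> 0\<close> by simp
  qed
  then obtain B where B: "finite B" "B \<subseteq> V" "indep_mod W B" "k \<le> card B" by blast
  obtain B' where "B' \<subseteq> B" "card B' = k" "finite B'"
    using obtain_subset_with_card_n[OF B(4)] by metis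
  moreover have "indep_mod W B'" using B(3) \<open>B' \<subseteq> B\<close> unfolding indep_mod_def by blast
  ultimately show ?thesis using B(2) by blast
qed

text \<open>\<open>B\<close> is an independent set modulo \<open>W\<close> of maximal cardinality.\<close>

lemma finite_ecodim_imp_spanning:
  fixes V W :: "'a::complex_normed_vector set"
  assumes "ecodim V W < \<infinity>" and W: "cvec.subspace W"
  shows "\<exists>B. finite B \<and> enat (card B) \<le> ecodim V W \<and> (\<forall>v\<in>V. \<exists>w\<in>W. \<exists>g\<in>cvec.span B. v = w + g)"
proof -
  obtain m where m: "ecodim V W = enat m" using assms(1) by auto
  let ?P = "\<lambda>B. finite B \<and> B \<subseteq> V \<and> indep_mod W B"
  have le: "enat (card B) \<le> ecodim V W" if "?P B" for B
    unfolding ecodim_def by (rule Sup_upper) (use that in blast)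
  have "?P {}" by (auto simp: indep_mod_def)
  then obtain B where B: "?P B" and max: "\<And>C. ?P C \<Longrightarrow> card C \<le> card B"
    using ex_has_greatest_nat[of ?P "{}" card "Suc m"] le m by (auto simp: less_Suc_eq_le)
  have "\<exists>w\<in>W. \<exists>g\<in>cvec.span B. v = w + g" if v: "v \<in> V" for v
  proof (rule ccontr)
    assume no: "\<not> ?thesis"
    have "v \<notin> B"
    proof
      assume "v \<in> B"
      then have "v \<in> cvec.span B" by (rule cvec.span_base)
      then show False using no cvec.subspace_0[OF W] by (metis add_0)
    qed
    have "indep_mod W (insert v B)"
      unfolding indep_mod_def
    proof (intro allI impI, elim conjE)
      fix F c assume F: "finite F" "F \<subseteq> insert v B" and s: "(\<Sum>b\<in>F. c b *\<^sub>C b) \<in> W"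
      have cB: "\<forall>b\<in>G. c b = 0" if "finite G" "G \<subseteq> B" "(\<Sum>b\<in>G. c b *\<^sub>C b) \<in> W" for G
        using B that unfolding indep_mod_def by blast
      show "\<forall>b\<in>F. c b = 0"
      proof (cases "v \<in> F")
        case False
        then show ?thesis using cB F s by blast
      next
        case True
        define g where "g = (\<Sum>b\<in>F - {v}. c b *\<^sub>C b)"
        have FB: "F - {v} \<subseteq> B" using F(2) by blast
        have g: "g \<in> cvec.span B"
          unfolding g_def using FB by (intro cvec.span_sum cvec.span_scale cvec.span_base) blast
        have s': "(\<Sum>b\<in>F. c b *\<^sub>C b) = c v *\<^sub>C v + g"
          unfolding g_def using F(1) True by (rule sum.remove)
        have "c v = 0"
        proof (rule ccontr)
          assume cv: "c v \<noteq> 0"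
          have "v = inverse (c v) *\<^sub>C (c v *\<^sub>C v + g) + (- inverse (c v)) *\<^sub>C g"
            using cv by (simp add: scaleC_add_right scaleC_scaleC)
          moreover have "inverse (c v) *\<^sub>C (c v *\<^sub>C v + g) \<in> W"
            using s s' cvec.subspace_scale[OF W] by metis
          moreover have "(- inverse (c v)) *\<^sub>C g \<in> cvec.span B" using g by (rule cvec.span_scale)
          ultimately show False using no by blast
        qed
        moreover from this have "\<forall>b\<in>F - {v}. c b = 0"
          using cB[of "F - {v}"] F(1) FB s s' by (simp add: g_def)
        ultimately show ?thesis by blast
      qed
    qed
    then have "card (insert v B) \<le> card B" using B v by (intro max) auto
    then show False using B \<open>v \<notin> B\<close> by simp
  qed
  then show ?thesis using B le by blast
qed

lemma indep_mod_imp_independent: "indep_mod {0} B \<Longrightarrow> cvec.independent B"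
  by (simp add: indep_mod_0)

section \<open>Reduction along a decomposition\<close>

locale reducing_pair =
  fixes T :: "'a::complex_banach \<Rightarrow> 'a" and M N :: "'a set"
  assumes T: "bounded_clinear T" and Red: "(M, N) \<in> Red T"
begin

lemma csubspace_M: "cvec.subspace M" and closed_M: "closed M" and T_in_M: "x \<in> M \<Longrightarrow> T x \<in> M"
  and csubspace_N: "cvec.subspace N" and closed_N: "closed N" and T_in_N: "x \<in> N \<Longrightarrow> T x \<in> N"
  and sum_MN: "\<exists>m\<in>M. \<exists>n\<in>N. x = m + n" and inter_MN: "x \<in> M \<Longrightarrow> x \<in> N \<Longrightarrow> x = 0"
  using Red unfolding Red_def by blast+

text \<open>The projection onto \<open>M\<close> along \<open>N\<close>.\<close>

definition P :: "'a \<Rightarrow> 'a" where "P x = (SOME m. m \<in> M \<and> x - m \<in> N)"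

lemma P_in_M: "P x \<in> M" and residue_in_N: "x - P x \<in> N"
proof -
  obtain m n where "m \<in> M" "n \<in> N" "x = m + n" using sum_MN by blast
  then have "m \<in> M \<and> x - m \<in> N" by simp
  then have "P x \<in> M \<and> x - P x \<in> N" unfolding P_def by (rule someI)
  then show "P x \<in> M" "x - P x \<in> N" by auto
qed

lemma P_unique: assumes "m \<in> M" "x - m \<in> N" shows "P x = m"
proof -
  have "P x - m = (x - m) - (x - P x)" by simp
  then have "P x - m \<in> N" using cvec.subspace_diff[OF csubspace_N assms(2) residue_in_N] by metis
  moreover have "P x - m \<in> M" using cvec.subspace_diff[OF csubspace_M P_in_M assms(1)] .
  ultimately show ?thesis using inter_MN by fastforce
qed

text \<open>Continuity is the open mapping theorem for the addition map from \<open>M \<times> N\<close>.\<close>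

lemma P_clinear: "bounded_clinear P"
proof -
  have W: "subspace (M \<times> N)" "closed (M \<times> N)"
    using csubspace_imp_subspace csubspace_M csubspace_N closed_M closed_N by (auto intro: subspace_Times closed_Times)
  have bl: "bounded_linear (\<lambda>p::'a \<times> 'a. fst p + snd p)"
    by (intro bounded_linear_add bounded_linear_fst bounded_linear_snd)
  have onto: "(\<lambda>p. fst p + snd p) ` (M \<times> N) = UNIV"
  proof (intro equalityI subsetI)
    fix x :: 'a
    obtain m n where "m \<in> M" "n \<in> N" "x = m + n" using sum_MN by blast
    then show "x \<in> (\<lambda>p. fst p + snd p) ` (M \<times> N)" by force
  qed auto
  obtain C where C: "\<And>x. \<exists>p\<in>M \<times> N. fst p + snd p = x \<and> norm p \<le> C * norm x"
    using open_mapping[OF bl W subspace_UNIV closed_UNIV onto] by auto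
  show ?thesis
  proof (rule bounded_clinearI)
    show "P (x + y) = P x + P y" for x y
    proof (rule P_unique)
      have "(x - P x) + (y - P y) \<in> N" by (rule cvec.subspace_add[OF csubspace_N residue_in_N residue_in_N])
      then show "x + y - (P x + P y) \<in> N" by (simp add: algebra_simps)
    qed (rule cvec.subspace_add[OF csubspace_M P_in_M P_in_M])
    show "P (c *\<^sub>C x) = c *\<^sub>C P x" for c x
    proof (rule P_unique)
      have "c *\<^sub>C (x - P x) \<in> N" by (rule cvec.subspace_scale[OF csubspace_N residue_in_N])
      then show "c *\<^sub>C x - c *\<^sub>C P x \<in> N" by (simp add: cvec.scale_right_diff_distrib)
    qed (rule cvec.subspace_scale[OF csubspace_M P_in_M])
    show "norm (P x) \<le> C * norm x" for x
    proof -
      obtain m n where mn: "m \<in> M" "n \<in> N" "m + n = x" "norm (m, n) \<le> C * norm x" using C[of x] by auto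
      have "P x = m" by (rule P_unique) (use mn in auto)
      then show ?thesis using norm_fst_le[of m n] mn(4) by simp
    qed
  qed
qed

lemma P_M: "x \<in> M \<Longrightarrow> P x = x"
  by (rule P_unique) (auto simp: cvec.subspace_0[OF csubspace_N])

lemma T_P: "T (P x) = P (T x)"
proof (rule P_unique[symmetric])
  show "T (P x) \<in> M" by (rule T_in_M[OF P_in_M])
  show "T x - T (P x) \<in> N" using T_in_N[OF residue_in_N] by (simp add: clinear_diff[OF T])
qed

text \<open>The operator that is \<open>T\<close> on \<open>M\<close> and the identity on \<open>N\<close>. It has the null space of the restriction of \<open>T\<close>
  to \<open>M\<close> and the same codimension of the range, so nothing has to be relativised to \<open>M\<close>.\<close>

definition S :: "'a \<Rightarrow> 'a" where "S x = T (P x) + (x - P x)"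

lemma S_clinear: "bounded_clinear S"
proof -
  have "bounded_clinear (\<lambda>x. T (P x) + (x - P x))"
    by (intro clinear_plus clinear_compose[OF T] clinear_minus_op P_clinear clinear_id)
  then show ?thesis by (simp add: S_def[abs_def])
qed

lemma P_add: "m \<in> M \<Longrightarrow> n \<in> N \<Longrightarrow> P (m + n) = m"
  by (rule P_unique) auto

lemma shift_P: "shift T w (P x) = P (shift T w x)"
  by (simp add: shift_def T_P clinear_diff[OF P_clinear] clinear_scale[OF P_clinear])

lemma shift_power_P: "(shift T w ^^ k) (P x) = P ((shift T w ^^ k) x)"
  by (induction k) (auto simp: shift_P)

lemma shift_S_power: "(shift S w ^^ k) x = (shift T w ^^ k) (P x) + (1 - w) ^ k *\<^sub>C (x - P x)"
proof (induction k)
  case 0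
  then show ?case by simp
next
  case (Suc k)
  define m where "m = (shift T w ^^ k) (P x)"
  define n where "n = (1 - w) ^ k *\<^sub>C (x - P x)"
  have m: "m \<in> M" unfolding m_def shift_power_P by (rule P_in_M)
  have n: "n \<in> N" unfolding n_def by (rule cvec.subspace_scale[OF csubspace_N residue_in_N])
  have "shift S w (m + n) = shift T w m + (1 - w) *\<^sub>C n"
    by (simp add: shift_def S_def P_add[OF m n] scaleC_add_right cvec.scale_left_diff_distrib)
  then show ?case by (simp add: Suc m_def n_def scaleC_scaleC)
qed

lemma null_space_S: "null_space S = {x \<in> M. T x = 0}"
proof (intro equalityI subsetI)
  fix x assume "x \<in> null_space S"
  then have x: "T (P x) + (x - P x) = 0" by (simp add: null_space_def S_def)
  then have "T (P x) = 0"
    using P_add[OF T_in_M[OF P_in_M] residue_in_N, of x x] by (simp add: clinear_0[OF P_clinear])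
  then have "x = P x" using x by simp
  then show "x \<in> {x \<in> M. T x = 0}" using P_in_M[of x] \<open>T (P x) = 0\<close> by simp
next
  fix x assume "x \<in> {x \<in> M. T x = 0}"
  then show "x \<in> null_space S" by (simp add: null_space_def S_def P_M)
qed

lemma range_S: "y \<in> range S \<longleftrightarrow> P y \<in> T ` M"
proof
  assume "y \<in> range S"
  then obtain x where "y = T (P x) + (x - P x)" by (auto simp: S_def)
  then have "P y = T (P x)" using P_add[OF T_in_M[OF P_in_M] residue_in_N] by simp
  then show "P y \<in> T ` M" using P_in_M by blast
next
  assume "P y \<in> T ` M"
  then obtain m where m: "m \<in> M" "P y = T m" by blast
  have "S (m + (y - P y)) = T m + (m + (y - P y) - m)"
    unfolding S_def P_add[OF m(1) residue_in_N] ..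
  then have "S (m + (y - P y)) = y" by (simp flip: m(2))
  then show "y \<in> range S" by (metis rangeI)
qed

lemma closed_range_S: "closed (T ` M) \<Longrightarrow> closed (range S)"
proof -
  assume "closed (T ` M)"
  then have "closed (P -` (T ` M))"
    by (intro closed_vimage linear_continuous_on clinear_imp_bounded_linear P_clinear)
  moreover have "P -` (T ` M) = range S" by (rule set_eqI) (simp only: vimage_eq range_S)
  ultimately show ?thesis by simp
qed

lemma indep_mod_range_S:
  assumes "B \<subseteq> M" "indep_mod (T ` M) B"
  shows "indep_mod (range S) B"
  unfolding indep_mod_def
proof (intro allI impI, elim conjE)
  fix F c assume F: "finite F" "F \<subseteq> B" "(\<Sum>b\<in>F. c b *\<^sub>C b) \<in> range S"
  have "(\<Sum>b\<in>F. c b *\<^sub>C b) \<in> M" using F(2) assms(1) csubspace_M by (intro cvec.subspace_sum cvec.subspace_scale) auto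
  then have "(\<Sum>b\<in>F. c b *\<^sub>C b) \<in> T ` M" using F(3) by (simp add: range_S P_M)
  then show "\<forall>b\<in>F. c b = 0" using assms(2) F(1,2) unfolding indep_mod_def by blast
qed

text \<open>On \<open>N\<close> the operator \<open>S - w\<close> is multiplication by \<open>1 - w\<close>, which is invertible for \<open>|w| < 1\<close>, so only
  the behaviour on \<open>M\<close> matters.\<close>

lemma range_shift_S_power:
  assumes w: "norm w < 1" and eq: "range (shift T w ^^ k) = range (shift T w ^^ Suc k)"
  shows "range (shift S w ^^ k) = range (shift S w ^^ Suc k)"
proof
  show "range (shift S w ^^ Suc k) \<subseteq> range (shift S w ^^ k)" by (rule range_power_antimono) simp
  show "range (shift S w ^^ k) \<subseteq> range (shift S w ^^ Suc k)"
  proof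
    fix y assume "y \<in> range (shift S w ^^ k)"
    then obtain x where x: "y = (shift S w ^^ k) x" by blast
    have w1: "1 - w \<noteq> 0" using w by auto
    obtain u where u: "(shift T w ^^ k) (P x) = (shift T w ^^ Suc k) u" using eq by (metis rangeE rangeI)
    then have u': "(shift T w ^^ k) (P x) = (shift T w ^^ Suc k) (P u)"
      unfolding shift_power_P by (metis P_in_M P_M shift_power_P)
    define v where "v = inverse (1 - w) *\<^sub>C (x - P x)"
    have v: "v \<in> N" unfolding v_def by (rule cvec.subspace_scale[OF csubspace_N residue_in_N])
    have "(shift S w ^^ Suc k) (P u + v) = (shift T w ^^ Suc k) (P u) + (1 - w) ^ Suc k *\<^sub>C v"
      unfolding shift_S_power P_add[OF P_in_M v] by simp
    also have "(1 - w) ^ Suc k *\<^sub>C v = (1 - w) ^ k *\<^sub>C (x - P x)"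
      using w1 by (simp add: v_def scaleC_scaleC)
    finally have "(shift S w ^^ Suc k) (P u + v) = y" unfolding x shift_S_power u' .
    then show "y \<in> range (shift S w ^^ Suc k)" by (metis rangeI)
  qed
qed

lemma null_space_shift_S_power:
  assumes w: "norm w < 1" and eq: "null_space (shift T w ^^ k) = null_space (shift T w ^^ Suc k)"
  shows "null_space (shift S w ^^ k) = null_space (shift S w ^^ Suc k)"
proof -
  have w1: "1 - w \<noteq> 0" using w by auto
  have char: "x \<in> null_space (shift S w ^^ j) \<longleftrightarrow> P x \<in> null_space (shift T w ^^ j) \<and> (1 - w) ^ j *\<^sub>C (x - P x) = 0" for x j
  proof
    assume "x \<in> null_space (shift S w ^^ j)"
    then have s: "(shift T w ^^ j) (P x) + (1 - w) ^ j *\<^sub>C (x - P x) = 0"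
      by (simp add: null_space_def shift_S_power)
    have "(shift T w ^^ j) (P x) \<in> M" unfolding shift_power_P by (rule P_in_M)
    from P_add[OF this cvec.subspace_scale[OF csubspace_N residue_in_N], of "(1 - w) ^ j" x] s
    have "(shift T w ^^ j) (P x) = 0" by (simp add: clinear_0[OF P_clinear])
    then show "P x \<in> null_space (shift T w ^^ j) \<and> (1 - w) ^ j *\<^sub>C (x - P x) = 0"
      using s by (simp add: null_space_def)
  qed (simp add: null_space_def shift_S_power)
  show ?thesis
  proof (rule set_eqI)
    fix x show "x \<in> null_space (shift S w ^^ k) \<longleftrightarrow> x \<in> null_space (shift S w ^^ Suc k)"
      unfolding char eq using w1 by (simp del: funpow.simps)
  qed
qed

lemma closed_range_shift_S_power:
  assumes w: "norm w < 1" and cl: "closed (range (shift T w ^^ k))"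
  shows "closed (range (shift S w ^^ k))"
proof -
  have w1: "1 - w \<noteq> 0" using w by auto
  have "range (shift S w ^^ k) = P -` range (shift T w ^^ k)"
  proof (intro equalityI subsetI)
    fix y assume "y \<in> range (shift S w ^^ k)"
    then obtain x where x: "y = (shift T w ^^ k) (P x) + (1 - w) ^ k *\<^sub>C (x - P x)" by (auto simp: shift_S_power)
    have "(shift T w ^^ k) (P x) \<in> M" unfolding shift_power_P by (rule P_in_M)
    then have "P y = (shift T w ^^ k) (P x)"
      unfolding x by (rule P_add) (rule cvec.subspace_scale[OF csubspace_N residue_in_N])
    then show "y \<in> P -` range (shift T w ^^ k)" by simp
  next
    fix y assume "y \<in> P -` range (shift T w ^^ k)"
    then obtain u where "P y = (shift T w ^^ k) u" by auto
    then have u: "P y = (shift T w ^^ k) (P u)" by (metis P_in_M P_M shift_power_P)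
    define v where "v = inverse ((1 - w) ^ k) *\<^sub>C (y - P y)"
    have v: "v \<in> N" unfolding v_def by (rule cvec.subspace_scale[OF csubspace_N residue_in_N])
    have "(shift S w ^^ k) (P u + v) = (shift T w ^^ k) (P u) + (1 - w) ^ k *\<^sub>C v"
      unfolding shift_S_power P_add[OF P_in_M v] by simp
    also have "\<dots> = y" using w1 by (simp add: v_def scaleC_scaleC flip: u)
    finally show "y \<in> range (shift S w ^^ k)" by (metis rangeI)
  qed
  moreover have "closed (P -` range (shift T w ^^ k))"
    using cl by (intro closed_vimage linear_continuous_on clinear_imp_bounded_linear P_clinear)
  ultimately show ?thesis by simp
qed

lemma bij_shift_T:
  assumes q: "quasinilpotent_on N T" and z: "z \<noteq> 0" and bij: "bij (shift S z)"
  shows "bij (shift T z)"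
proof -
  have TN: "T ` N \<subseteq> N" using T_in_N by blast
  note qN = quasinilpotent_on_imp_shift_bijective[OF T csubspace_N closed_N TN q z]
  note lin = clinear_shift[OF T, of z]
  have S1: "shift S z x = shift T z (P x) + (1 - z) *\<^sub>C (x - P x)" for x
    using shift_S_power[where w = z and k = 1 and x = x] by simp
  have PS: "P (shift S z x) = shift T z (P x)" for x
  proof -
    have "shift T z (P x) \<in> M" unfolding shift_P by (rule P_in_M)
    then show ?thesis unfolding S1 by (rule P_add) (rule cvec.subspace_scale[OF csubspace_N residue_in_N])
  qed
  have "x = 0" if x: "shift T z x = 0" for x
  proof -
    have 1: "shift T z (P x) = 0" using x by (simp add: shift_P clinear_0[OF P_clinear])
    then have "shift T z (x - P x) = 0" using x by (simp add: clinear_diff[OF lin])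
    then have xP: "x - P x = 0" using qN residue_in_N by blast
    then have "shift S z x = 0" using 1 by (simp add: S1)
    then show ?thesis
      using bij by (simp add: bij_def cpair.linear_inj_iff_eq_0[OF clinear_linear[OF clinear_shift[OF S_clinear]]])
  qed
  then have "inj (shift T z)"
    by (simp add: cpair.linear_inj_iff_eq_0[OF clinear_linear[OF lin]])
  moreover have "\<exists>x. y = shift T z x" for y
  proof -
    obtain x where "shift S z x = y" using bij by (metis bij_pointE)
    then have x: "shift T z (P x) = P y" using PS by metis
    obtain n where n: "shift T z n = y - P y" using qN residue_in_N by blast
    have "y = shift T z (P x + n)" by (simp add: clinear_add[OF lin] x n)
    then show ?thesis by blast
  qed
  ultimately show ?thesis by (simp add: bij_def surj_def)
qed

lemma Koliha_Drazin_if_punctured_disc: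
  assumes q: "quasinilpotent_on N T"
    and d: "\<exists>d>0. \<forall>z. 0 < norm z \<and> norm z < d \<longrightarrow> bij (shift S z)"
  shows "Koliha_Drazin_invertible T"
proof -
  obtain d where d: "d > 0" "\<And>z. 0 < norm z \<Longrightarrow> norm z < d \<Longrightarrow> bij (shift S z)" using d by blast
  have "z \<notin> spectrum T" if "z \<noteq> 0" "norm z < d" for z :: complex
    using bij_shift_T[OF q that(1) d(2)] that by (simp add: spectrum_iff_not_bij[OF T])
  then show ?thesis
    unfolding Koliha_Drazin_invertible_def islimpt_approachable using d(1) by force
qed

text \<open>Nonpositive index: there are as many vectors independent modulo the range as there are in a basis
  of the null space, so a finite-rank correction can remove the whole kernel.\<close>

lemma Koliha_Drazin_if_descent:
  assumes uw: "upper_semi_Weyl_on M T" and q: "quasinilpotent_on N T" and desc: "0 \<notin> interior (spectrum_desc T)"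
  shows "Koliha_Drazin_invertible T"
proof (rule Koliha_Drazin_if_punctured_disc[OF q])
  define K where "K = {x \<in> M. T x = 0}"
  have cl: "closed (T ` M)" and fin: "edim K < \<infinity>" and idx: "index_on M T \<le> 0"
    using uw by (auto simp: upper_semi_Weyl_on_def upper_semi_Fredholm_on_def nullity_on_def K_def)
  have K: "K = null_space S" by (simp add: K_def null_space_S)
  have subK: "cvec.subspace K" unfolding K by (rule csubspace_null_space[OF S_clinear])
  obtain A where A: "finite A" "K \<subseteq> cvec.span A" using fin by (auto simp: edim_def split: if_splits)
  obtain E where E: "E \<subseteq> K" "cvec.independent E" "K \<subseteq> cvec.span E" "card E = cvec.dim K"
    using cvec.basis_exists[of K] by blast
  have finE: "finite E" using cvec.independent_span_bound[OF A(1) E(2)] E(1) A(2) by auto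
  have spanE: "null_space S = cvec.span E"
    using E(3) cvec.span_minimal[OF E(1) subK] by (simp add: K)
  have "nullity_on M T = enat (card E)"
    using A E(4) by (auto simp: nullity_on_def edim_def K_def)
  then have le: "enat (card E) \<le> ecodim M (T ` M)"
    using idx unfolding index_on_def defect_on_def by (cases "ecodim M (T ` M)") auto
  obtain B where B: "finite B" "B \<subseteq> M" "indep_mod (T ` M) B" "card B = card E"
    using le_ecodim_imp_independent[OF le] by (elim exE conjE)
  then obtain b where b: "bij_betw b E B" using finite_same_card_bij[OF finE B(1)] by metis
  show "\<exists>d>0. \<forall>z. 0 < norm z \<and> norm z < d \<longrightarrow> bij (shift S z)"
  proof (rule punctured_disc_bij_if_descent[OF S_clinear closed_range_S[OF cl] finE E(2) spanE])
    show "inj_on b E" using b by (simp add: bij_betw_def)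
    show "indep_mod (range S) (b ` E)"
      using b indep_mod_range_S[OF B(2,3)] by (simp add: bij_betw_def)
    fix d :: real assume "d > 0"
    then have "\<not> ball 0 (min d 1) \<subseteq> spectrum_desc T" using desc mem_interior by (metis min_less_iff_conj zero_less_one)
    then obtain w where "w \<in> ball 0 (min d 1)" and w: "w \<notin> spectrum_desc T" by blast
    then have wd: "norm w < d" and w1: "norm w < 1" by (simp_all add: dist_norm)
    from w obtain k where "range (shift T w ^^ k) = range (shift T w ^^ Suc k)"
      by (auto simp: spectrum_desc_def descent_def split: if_splits)
    then have "range (shift S w ^^ k) = range (shift S w ^^ Suc k)" by (rule range_shift_S_power[OF w1])
    then show "\<exists>w n. norm w < d \<and> range (shift S w ^^ n) = range (shift S w ^^ Suc n)" using wd by blast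
  qed
qed

text \<open>Nonnegative index: the null space contains as many independent vectors as are needed to fill the
  missing range.\<close>

lemma Koliha_Drazin_if_left_Drazin:
  assumes lw: "lower_semi_Weyl_on M T" and q: "quasinilpotent_on N T" and LD: "0 \<notin> interior (spectrum_LD T)"
  shows "Koliha_Drazin_invertible T"
proof (rule Koliha_Drazin_if_punctured_disc[OF q])
  define K where "K = {x \<in> M. T x = 0}"
  have cl: "closed (T ` M)" and fin: "ecodim M (T ` M) < \<infinity>" and idx: "index_on M T \<ge> 0"
    using lw by (auto simp: lower_semi_Weyl_on_def lower_semi_Fredholm_on_def defect_on_def)
  have K: "K = null_space S" by (simp add: K_def null_space_S)
  have TM: "cvec.subspace (T ` M)"
    by (rule cpair.linear_subspace_image[OF clinear_linear[OF T] csubspace_M])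
  obtain B where B: "finite B" "enat (card B) \<le> ecodim M (T ` M)"
      "\<And>v. v \<in> M \<Longrightarrow> \<exists>w\<in>T ` M. \<exists>g\<in>cvec.span B. v = w + g"
    using finite_ecodim_imp_spanning[OF fin TM] by (elim exE conjE) (erule that, assumption, erule bspec)
  have "enat (card B) \<le> edim K"
    using idx B(2) fin unfolding index_on_def defect_on_def nullity_on_def K_def
    by (cases "edim {x \<in> M. T x = 0}"; cases "ecodim M (T ` M)") auto
  then have le: "enat (card B) \<le> ecodim K {0}" by (simp add: ecodim_0)
  obtain E where E: "finite E" "E \<subseteq> K" "indep_mod {0} E" "card E = card B"
    using le_ecodim_imp_independent[OF le] by (elim exE conjE)
  obtain b where b: "bij_betw b E B" using finite_same_card_bij[OF E(1) B(1) E(4)] by blast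
  show "\<exists>d>0. \<forall>z. 0 < norm z \<and> norm z < d \<longrightarrow> bij (shift S z)"
  proof (rule punctured_disc_bij_if_ascent[OF S_clinear E(1) indep_mod_imp_independent[OF E(3)]])
    show "E \<subseteq> null_space S" using E(2) by (simp add: K)
    show "{w + g |w g. w \<in> range S \<and> g \<in> cvec.span (b ` E)} = UNIV"
    proof (intro equalityI subsetI)
      fix y :: 'a
      obtain w g where wg: "w \<in> T ` M" "g \<in> cvec.span B" "P y = w + g" using B(3)[OF P_in_M] by blast
      have wM: "w \<in> M" using wg(1) T_in_M by blast
      have "P (w + (y - P y)) = w" by (rule P_add[OF wM residue_in_N])
      then have "w + (y - P y) \<in> range S" using wg(1) by (simp add: range_S)
      moreover have "y = (w + (y - P y)) + g" using wg(3) by simp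
      moreover have "g \<in> cvec.span (b ` E)" using wg(2) b by (simp add: bij_betw_def)
      ultimately show "y \<in> {w + g |w g. w \<in> range S \<and> g \<in> cvec.span (b ` E)}" by blast
    qed simp
    fix d :: real assume "d > 0"
    then have "\<not> ball 0 (min d 1) \<subseteq> spectrum_LD T" using LD mem_interior by (metis min_less_iff_conj zero_less_one)
    then obtain w where "w \<in> ball 0 (min d 1)" and w: "w \<notin> spectrum_LD T" by blast
    then have wd: "norm w < d" and w1: "norm w < 1" by (simp_all add: dist_norm)
    from w obtain p where p: "ascent (shift T w) = enat p" "closed (range (shift T w ^^ Suc p))"
      by (auto simp: spectrum_LD_def left_Drazin_invertible_def)
    have "null_space (shift T w ^^ p) = null_space (shift T w ^^ Suc p)"
    proof -
      let ?Q = "\<lambda>p. null_space (shift T w ^^ p) = null_space (shift T w ^^ (p + 1))"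
      have "\<exists>p. ?Q p" "p = (LEAST p. ?Q p)" using p(1) by (auto simp: ascent_def split: if_splits)
      then have "?Q p" using LeastI_ex[of ?Q] by metis
      then show ?thesis by simp
    qed
    then have "null_space (shift S w ^^ p) = null_space (shift S w ^^ Suc p)"
      by (rule null_space_shift_S_power[OF w1])
    moreover have "closed (range (shift S w ^^ Suc p))"
      by (rule closed_range_shift_S_power[OF w1 p(2)])
    ultimately show "\<exists>w n. norm w < d \<and>
      null_space (shift S w ^^ n) = null_space (shift S w ^^ Suc n) \<and> closed (range (shift S w ^^ Suc n))"
      using wd by blast
  qed
qed

end

section \<open>The characterization\<close>

text \<open>The summands are the kernel and the range of the Riesz projection.\<close>

lemma Koliha_Drazin_imp_decomposition:
  fixes T :: "'a::complex_banach \<Rightarrow> 'a"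
  assumes T: "bounded_clinear T" and KD: "Koliha_Drazin_invertible T"
  shows "\<exists>(M, N) \<in> Red T. closed (T ` M) \<and> nullity_on M T = 0 \<and> defect_on M T = 0 \<and> quasinilpotent_on N T"
proof -
  obtain \<rho> where \<rho>: "\<rho> > 0" "\<And>z. z \<in> spectrum T \<Longrightarrow> z \<noteq> 0 \<Longrightarrow> \<rho> \<le> norm z"
    using KD unfolding Koliha_Drazin_invertible_def islimpt_approachable by (auto simp: not_less)
  interpret isolated_spectral_point T \<rho>
    by unfold_locales (use T \<rho> spectrum_iff_not_bij[OF T] in force)+
  obtain P where P: "bounded_clinear P" "\<And>x. P (P x) = P x" "\<And>x. T (P x) = P (T x)"
    "\<And>x. P x = 0 \<Longrightarrow> T x = 0 \<Longrightarrow> x = 0" "\<And>y. P y = 0 \<Longrightarrow> \<exists>x. P x = 0 \<and> T x = y"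
    "\<And>r. 0 < r \<Longrightarrow> r < \<rho> \<Longrightarrow> \<exists>N. \<forall>n\<ge>N. \<forall>x. P x = x \<longrightarrow> norm ((T ^^ n) x) \<le> r ^ n * norm x"
    by (rule riesz_decomposition) blast
  define M where "M = {x. P x = 0}"
  define N where "N = {x. P x = x}"
  have contP: "continuous_on UNIV P"
    by (intro linear_continuous_on clinear_imp_bounded_linear P(1))
  have "(M, N) \<in> Red T"
    unfolding Red_def
  proof (intro CollectI case_prodI conjI allI)
    show "cvec.subspace M" "cvec.subspace N"
      by (auto simp: M_def N_def cvec.subspace_def clinear_add[OF P(1)] clinear_scale[OF P(1)]
          clinear_0[OF P(1)])
    show "closed M" "closed N"
      unfolding M_def N_def by (intro closed_Collect_eq contP continuous_on_id continuous_on_const)+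
    show "T ` M \<subseteq> M" "T ` N \<subseteq> N"
      by (auto simp: M_def N_def clinear_0[OF T] simp flip: P(3))
    show "M \<inter> N = {0}" by (auto simp: M_def N_def clinear_0[OF P(1)])
    fix x
    have "x - P x \<in> M" "P x \<in> N" "x = (x - P x) + P x"
      by (auto simp: M_def N_def P(2) clinear_diff[OF P(1)])
    then show "\<exists>m\<in>M. \<exists>n\<in>N. x = m + n" by blast
  qed
  moreover have TM: "T ` M = M"
    using P(5) by (force simp: M_def clinear_0[OF T] simp flip: P(3))
  moreover have "closed M" unfolding M_def by (intro closed_Collect_eq contP continuous_on_const)
  moreover have "nullity_on M T = 0"
  proof -
    have "{x \<in> M. T x = 0} = {0}" using P(4) by (auto simp: M_def clinear_0[OF P(1)] clinear_0[OF T])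
    moreover have "\<exists>B. finite B \<and> {0::'a} \<subseteq> cvec.span B" by (rule exI[of _ "{}"]) simp
    moreover have "cvec.dim {0::'a} = 0"
      using cvec.dim_le_card[of "{0::'a}" "{}"] by simp
    ultimately show ?thesis by (simp add: nullity_on_def edim_def zero_enat_def)
  qed
  moreover have "defect_on M T = 0"
  proof -
    have "B = {}" if "B \<subseteq> M" "indep_mod M B" for B :: "'a set"
    proof (rule ccontr)
      assume "B \<noteq> {}"
      then obtain v where v: "v \<in> B" by blast
      have "finite {v} \<and> {v} \<subseteq> B \<and> (\<Sum>b\<in>{v}. 1 *\<^sub>C b) \<in> M" using v that(1) by auto
      then have "\<forall>b\<in>{v}. (1::complex) = 0"
        using that(2)[unfolded indep_mod_def, THEN spec, THEN spec, of "{v}" "\<lambda>_. 1"] by (rule rev_mp)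
      then show False by simp
    qed
    then have "ecodim M M \<le> 0" unfolding ecodim_def by (intro Sup_least) (auto simp: zero_enat_def)
    then show ?thesis by (simp add: defect_on_def TM)
  qed
  moreover have "quasinilpotent_on N T"
    by (rule quasinilpotent_onI[OF T _ \<rho>(1)]) (use P(6) in \<open>auto simp: N_def clinear_0[OF P(1)]\<close>)
  ultimately show ?thesis by (intro bexI[of _ "(M, N)"]) auto
qed

lemma Koliha_Drazin_imp_not_interior:
  fixes T :: "'a::complex_banach \<Rightarrow> 'a"
  assumes T: "bounded_clinear T" and KD: "Koliha_Drazin_invertible T" and A: "A \<subseteq> spectrum T"
  shows "0 \<notin> interior A"
proof
  assume "0 \<in> interior A"
  then have "0 islimpt A" by (rule interior_limit_point)
  then have "0 islimpt spectrum T" using A by (rule islimpt_subset)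
  then show False using KD by (simp add: Koliha_Drazin_invertible_def)
qed

text \<open>A bijective operator has ascent and descent \<open>0\<close>.\<close>

lemma spectrum_desc_LD_subset:
  fixes T :: "'a::complex_banach \<Rightarrow> 'a"
  assumes T: "bounded_clinear T"
  shows "spectrum_desc T \<subseteq> spectrum T" "spectrum_LD T \<subseteq> spectrum T"
proof -
  have "z \<notin> spectrum_desc T \<and> z \<notin> spectrum_LD T" if "z \<notin> spectrum T" for z
  proof -
    have bij: "bij (shift T z)" using that by (simp add: spectrum_iff_not_bij[OF T])
    have "range (shift T z ^^ 0) = range (shift T z ^^ (0 + 1))" using bij by (simp add: bij_def)
    then have "descent (shift T z) \<noteq> \<infinity>" unfolding descent_def by (metis enat.distinct(2))
    moreover have "null_space (shift T z ^^ 0) = null_space (shift T z ^^ (0 + 1))"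
      using bij clinear_0[OF clinear_shift[OF T, of z]]
      by (auto simp: null_space_def bij_def) (metis injD)
    then have "ascent (shift T z) = enat 0"
      unfolding ascent_def by (metis (mono_tags, lifting) Least_eq_0)
    then have "left_Drazin_invertible (shift T z)"
      unfolding left_Drazin_invertible_def using bij by (intro exI[of _ 0]) (simp add: bij_def)
    ultimately show ?thesis by (simp add: spectrum_desc_def spectrum_LD_def)
  qed
  then show "spectrum_desc T \<subseteq> spectrum T" "spectrum_LD T \<subseteq> spectrum T" by auto
qed

theorem theorem2p2:
  fixes T :: "'a::complex_banach \<Rightarrow> 'a"
  assumes "edim (UNIV :: 'a set) = \<infinity>"
    and "bounded_clinear T"
  shows "(Koliha_Drazin_invertible T \<longleftrightarrow>
            0 \<notin> interior (spectrum_desc T) \<and>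
            (\<exists>(M, N) \<in> Red T. upper_semi_Weyl_on M T \<and> quasinilpotent_on N T)) \<and>
         (Koliha_Drazin_invertible T \<longleftrightarrow>
            0 \<notin> interior (spectrum_LD T) \<and>
            (\<exists>(M, N) \<in> Red T. lower_semi_Weyl_on M T \<and> quasinilpotent_on N T))"
proof (intro conjI iffI)
  note T = assms(2)
  assume KD: "Koliha_Drazin_invertible T"
  show "0 \<notin> interior (spectrum_desc T)" "0 \<notin> interior (spectrum_LD T)"
    using Koliha_Drazin_imp_not_interior[OF T KD] spectrum_desc_LD_subset[OF T] by auto
  obtain M N where pair: "(M, N) \<in> Red T" "closed (T ` M)" "nullity_on M T = 0" "defect_on M T = 0"
      "quasinilpotent_on N T"
    using Koliha_Drazin_imp_decomposition[OF T KD] by blast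
  have "index_on M T = 0" by (simp add: index_on_def pair(3,4))
  then have "upper_semi_Weyl_on M T" "lower_semi_Weyl_on M T"
    using pair by (auto simp: upper_semi_Weyl_on_def lower_semi_Weyl_on_def upper_semi_Fredholm_on_def lower_semi_Fredholm_on_def)
  then show "\<exists>(M, N) \<in> Red T. upper_semi_Weyl_on M T \<and> quasinilpotent_on N T"
    "\<exists>(M, N) \<in> Red T. lower_semi_Weyl_on M T \<and> quasinilpotent_on N T"
    using pair(1,5) by blast+
next
  assume "0 \<notin> interior (spectrum_desc T) \<and> (\<exists>(M, N) \<in> Red T. upper_semi_Weyl_on M T \<and> quasinilpotent_on N T)"
  then obtain M N where pair: "(M, N) \<in> Red T" "upper_semi_Weyl_on M T" "quasinilpotent_on N T"
    and int: "0 \<notin> interior (spectrum_desc T)" by blast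
  interpret reducing_pair T M N by unfold_locales (use assms pair in auto)
  show "Koliha_Drazin_invertible T" by (rule Koliha_Drazin_if_descent[OF pair(2,3) int])
next
  assume "0 \<notin> interior (spectrum_LD T) \<and> (\<exists>(M, N) \<in> Red T. lower_semi_Weyl_on M T \<and> quasinilpotent_on N T)"
  then obtain M N where pair: "(M, N) \<in> Red T" "lower_semi_Weyl_on M T" "quasinilpotent_on N T"
    and int: "0 \<notin> interior (spectrum_LD T)" by blast
  interpret reducing_pair T M N by unfold_locales (use assms pair in auto)
  show "Koliha_Drazin_invertible T" by (rule Koliha_Drazin_if_left_Drazin[OF pair(2,3) int])
qed

end
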